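(* Let $p,q$ be prime numbers with $q\mid p-1$. Then there exists a semisimple Hopf algebra over $k$ of dimension $p^2q^2$ which is simple as a Hopf algebra (and which is not isomorphic to a group algebra or the dual of a group algebra).
   Context: $k$ is an algebraically closed field of characteristic zero. A Hopf algebra is simple if it has no normal Hopf subalgebras (i.e., Hopf subalgebras stable under the adjoint action ${}^hx=\sum h_1xS(h_2)$) other than $k$ and itself. *)

theory Defs
  imports "HOL-Algebra.Group" "HOL-Computational_Algebra.Polynomial"
begin

text \<open>Finite-dimensional Hopf algebras over a field 'k, given by structure constants
 with respect to a basis e_0, ..., e_(n-1), n = hdim H:
  e_i e_j = sum_l hmult i j l e_l,   1 = sum_i hunit i e_i,
  Delta(e_l) = sum_(i,j) hcomult l i j e_i (x) e_j,   eps(e_i) = hcounit i,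
  S(e_i) = sum_j hantipode i j e_j.
 Only indices below n are meaningful.\<close>

record 'k hopf =
  hdim :: nat
  hmult :: "nat \<Rightarrow> nat \<Rightarrow> nat \<Rightarrow> 'k"
  hunit :: "nat \<Rightarrow> 'k"
  hcomult :: "nat \<Rightarrow> nat \<Rightarrow> nat \<Rightarrow> 'k"
  hcounit :: "nat \<Rightarrow> 'k"
  hantipode :: "nat \<Rightarrow> nat \<Rightarrow> 'k"

definition delta :: "nat \<Rightarrow> nat \<Rightarrow> 'k::field" where
  "delta i j = (if i = j then 1 else 0)"

definition hopf_algebra :: "('k::field) hopf \<Rightarrow> bool" where
  "hopf_algebra H \<longleftrightarrow> (let n = hdim H; m = hmult H; u = hunit H; d = hcomult H;
       e = hcounit H; s = hantipode H in
     \<comment> \<open>associativity\<close>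
     (\<forall>i<n. \<forall>j<n. \<forall>l<n. \<forall>t<n.
        (\<Sum>r<n. m i j r * m r l t) = (\<Sum>r<n. m j l r * m i r t)) \<and>
     \<comment> \<open>unit\<close>
     (\<forall>i<n. \<forall>t<n. (\<Sum>r<n. u r * m r i t) = delta i t \<and> (\<Sum>r<n. u r * m i r t) = delta i t) \<and>
     \<comment> \<open>coassociativity\<close>
     (\<forall>l<n. \<forall>x<n. \<forall>y<n. \<forall>z<n.
        (\<Sum>a<n. d l a z * d a x y) = (\<Sum>b<n. d l x b * d b y z)) \<and>
     \<comment> \<open>counit\<close>
     (\<forall>l<n. \<forall>b<n. (\<Sum>a<n. d l a b * e a) = delta b l \<and> (\<Sum>a<n. d l b a * e a) = delta b l) \<and>
     \<comment> \<open>comultiplication is an algebra map\<close>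
     (\<forall>i<n. \<forall>j<n. \<forall>x<n. \<forall>y<n.
        (\<Sum>r<n. m i j r * d r x y) =
        (\<Sum>a<n. \<Sum>b<n. \<Sum>c<n. \<Sum>f<n. d i a b * d j c f * m a c x * m b f y)) \<and>
     (\<forall>x<n. \<forall>y<n. (\<Sum>r<n. u r * d r x y) = u x * u y) \<and>
     \<comment> \<open>counit is an algebra map\<close>
     (\<forall>i<n. \<forall>j<n. (\<Sum>r<n. m i j r * e r) = e i * e j) \<and>
     (\<Sum>r<n. u r * e r) = 1 \<and>
     \<comment> \<open>antipode: m(S (x) id)Delta = u eps = m(id (x) S)Delta\<close>
     (\<forall>l<n. \<forall>t<n.
        (\<Sum>a<n. \<Sum>b<n. \<Sum>c<n. d l a b * s a c * m c b t) = e l * u t \<and>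
        (\<Sum>a<n. \<Sum>b<n. \<Sum>c<n. d l a b * s b c * m a c t) = e l * u t))"

definition hvecs :: "('k::field) hopf \<Rightarrow> (nat \<Rightarrow> 'k) set" where
  "hvecs H = {v. \<forall>i\<ge>hdim H. v i = 0}"

definition hbasis :: "nat \<Rightarrow> nat \<Rightarrow> 'k::field" where
  "hbasis i = (\<lambda>j. delta i j)"

definition hzero :: "nat \<Rightarrow> 'k::field" where
  "hzero = (\<lambda>_. 0)"

definition hone :: "('k::field) hopf \<Rightarrow> nat \<Rightarrow> 'k" where
  "hone H = (\<lambda>t. if t < hdim H then hunit H t else 0)"

definition hprod :: "('k::field) hopf \<Rightarrow> (nat \<Rightarrow> 'k) \<Rightarrow> (nat \<Rightarrow> 'k) \<Rightarrow> nat \<Rightarrow> 'k" where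
  "hprod H v w = (\<lambda>t. if t < hdim H then
      (\<Sum>i<hdim H. \<Sum>j<hdim H. v i * w j * hmult H i j t) else 0)"

definition hS :: "('k::field) hopf \<Rightarrow> (nat \<Rightarrow> 'k) \<Rightarrow> nat \<Rightarrow> 'k" where
  "hS H v = (\<lambda>t. if t < hdim H then (\<Sum>i<hdim H. v i * hantipode H i t) else 0)"

definition hDelta :: "('k::field) hopf \<Rightarrow> (nat \<Rightarrow> 'k) \<Rightarrow> nat \<Rightarrow> nat \<Rightarrow> 'k" where
  "hDelta H v = (\<lambda>x y. if x < hdim H \<and> y < hdim H then
      (\<Sum>l<hdim H. v l * hcomult H l x y) else 0)"

definition hadj :: "('k::field) hopf \<Rightarrow> (nat \<Rightarrow> 'k) \<Rightarrow> (nat \<Rightarrow> 'k) \<Rightarrow> nat \<Rightarrow> 'k" where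
  "hadj H h x = (\<lambda>t. \<Sum>i<hdim H. h i * (\<Sum>a<hdim H. \<Sum>b<hdim H.
      hcomult H i a b * hprod H (hprod H (hbasis a) x) (hS H (hbasis b)) t))"

definition hsubspace :: "('k::field) hopf \<Rightarrow> (nat \<Rightarrow> 'k) set \<Rightarrow> bool" where
  "hsubspace H K \<longleftrightarrow> K \<subseteq> hvecs H \<and> hzero \<in> K \<and>
     (\<forall>v\<in>K. \<forall>w\<in>K. (\<lambda>i. v i + w i) \<in> K) \<and> (\<forall>c. \<forall>v\<in>K. (\<lambda>i. c * v i) \<in> K)"

text \<open>T lies in K (x) K (as a subspace of H (x) H, tensors as coefficient arrays).\<close>
definition in_tensor :: "(nat \<Rightarrow> 'k::field) set \<Rightarrow> (nat \<Rightarrow> nat \<Rightarrow> 'k) \<Rightarrow> bool" where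
  "in_tensor K T \<longleftrightarrow> (\<exists>(r::nat) a b. (\<forall>t<r. a t \<in> K \<and> b t \<in> K) \<and>
      T = (\<lambda>x y. \<Sum>t<r. a t x * b t y))"

definition hopf_subalgebra :: "('k::field) hopf \<Rightarrow> (nat \<Rightarrow> 'k) set \<Rightarrow> bool" where
  "hopf_subalgebra H K \<longleftrightarrow> hsubspace H K \<and> hone H \<in> K \<and>
     (\<forall>v\<in>K. \<forall>w\<in>K. hprod H v w \<in> K) \<and>
     (\<forall>v\<in>K. in_tensor K (hDelta H v)) \<and> (\<forall>v\<in>K. hS H v \<in> K)"

definition normal_hopf_subalgebra :: "('k::field) hopf \<Rightarrow> (nat \<Rightarrow> 'k) set \<Rightarrow> bool" where
  "normal_hopf_subalgebra H K \<longleftrightarrow> hopf_subalgebra H K \<and>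
     (\<forall>h\<in>hvecs H. \<forall>x\<in>K. hadj H h x \<in> K)"

definition hscalars :: "('k::field) hopf \<Rightarrow> (nat \<Rightarrow> 'k) set" where
  "hscalars H = {(\<lambda>i. c * hone H i) | c. True}"

definition simple_hopf :: "('k::field) hopf \<Rightarrow> bool" where
  "simple_hopf H \<longleftrightarrow> (\<forall>K. normal_hopf_subalgebra H K \<longrightarrow> K = hscalars H \<or> K = hvecs H)"

definition left_ideal :: "('k::field) hopf \<Rightarrow> (nat \<Rightarrow> 'k) set \<Rightarrow> bool" where
  "left_ideal H L \<longleftrightarrow> hsubspace H L \<and> (\<forall>a\<in>hvecs H. \<forall>x\<in>L. hprod H a x \<in> L)"

text \<open>Semisimple: H is semisimple as an algebra, i.e. the regular left module is semisimple
  (every left ideal is a direct summand).\<close>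
definition semisimple :: "('k::field) hopf \<Rightarrow> bool" where
  "semisimple H \<longleftrightarrow> (\<forall>L. left_ideal H L \<longrightarrow> (\<exists>L'. left_ideal H L' \<and> L \<inter> L' = {hzero} \<and>
      (\<forall>v\<in>hvecs H. \<exists>x\<in>L. \<exists>y\<in>L'. v = (\<lambda>i. x i + y i))))"

text \<open>Hopf algebra isomorphism: e_i maps to sum_j F i j e'_j, F invertible with inverse G.\<close>
definition hopf_iso :: "('k::field) hopf \<Rightarrow> 'k hopf \<Rightarrow> bool" where
  "hopf_iso H H' \<longleftrightarrow> hdim H = hdim H' \<and> (let n = hdim H in
     \<exists>F G :: nat \<Rightarrow> nat \<Rightarrow> 'k.
       (\<forall>i<n. \<forall>l<n. (\<Sum>j<n. F i j * G j l) = delta i l \<and> (\<Sum>j<n. G i j * F j l) = delta i l) \<and>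
       (\<forall>a<n. \<forall>b<n. \<forall>t<n. (\<Sum>r<n. hmult H a b r * F r t) =
           (\<Sum>x<n. \<Sum>y<n. F a x * F b y * hmult H' x y t)) \<and>
       (\<forall>t<n. (\<Sum>r<n. hunit H r * F r t) = hunit H' t) \<and>
       (\<forall>l<n. \<forall>x<n. \<forall>y<n. (\<Sum>a<n. \<Sum>b<n. hcomult H l a b * F a x * F b y) =
           (\<Sum>r<n. F l r * hcomult H' r x y)) \<and>
       (\<forall>l<n. (\<Sum>t<n. F l t * hcounit H' t) = hcounit H l) \<and>
       (\<forall>i<n. \<forall>t<n. (\<Sum>r<n. hantipode H i r * F r t) = (\<Sum>j<n. F i j * hantipode H' j t)))"

text \<open>Group algebra k[G] of a finite group G with carrier {0..<n}, basis = group elements.\<close>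
definition group_algebra :: "nat monoid \<Rightarrow> nat \<Rightarrow> ('k::field) hopf" where
  "group_algebra G n = \<lparr> hdim = n,
     hmult = (\<lambda>i j l. delta (i \<otimes>\<^bsub>G\<^esub> j) l),
     hunit = (\<lambda>i. delta \<one>\<^bsub>G\<^esub> i),
     hcomult = (\<lambda>l i j. if i = l \<and> j = l then 1 else 0),
     hcounit = (\<lambda>i. 1),
     hantipode = (\<lambda>i j. delta (inv\<^bsub>G\<^esub> i) j) \<rparr>"

definition hopf_dual :: "('k::field) hopf \<Rightarrow> 'k hopf" where
  "hopf_dual H = \<lparr> hdim = hdim H,
     hmult = (\<lambda>i j l. hcomult H l i j),
     hunit = hcounit H,
     hcomult = (\<lambda>l i j. hmult H i j l),
     hcounit = hunit H,
     hantipode = (\<lambda>i j. hantipode H j i) \<rparr>"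

end

theory Submission
  imports Defs "HOL-Library.Function_Algebras" "HOL-Number_Theory.Residue_Primitive_Roots"
begin

text \<open>
  Let \<open>F\<close> be the nonabelian group of order \<open>pq\<close>, let \<open>s\<close> and \<open>t\<close> generate the complements of order
  \<open>q\<close> in the two factors of \<open>G = F \<times> F\<close>, and let \<open>e\<^sub>a\<close> be the spectral idempotents of \<open>s\<close>.  The Hopf
  algebra is the dual of the group algebra of \<open>G\<close> twisted by \<open>J = \<Sum>a. e\<^sub>a \<otimes> t\<^sup>a\<close>: as a coalgebra it is
  the algebra of functions on \<open>G\<close>, and only the product is deformed.

  A Hopf subalgebra \<open>K\<close> is invariant under left and right translations, hence also closed under the
  undeformed pointwise product, so it consists of the functions on \<open>G/N\<close> for a normal subgroup \<open>N\<close>.  If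
  \<open>K\<close> is normal, then \<open>H K\<^sup>+\<close> lies in \<open>K\<^sup>+ H\<close>.  Tested on suitable functionals, this inclusion shows that
  \<open>t \<in> N\<close> as soon as \<open>N\<close> meets the Sylow \<open>p\<close>-subgroup of the first factor, and \<open>s \<in> N\<close> as soon as it
  meets that of the second.  A nontrivial normal subgroup meets one of the two, so it contains \<open>s\<close>
  and \<open>t\<close>, whose normal closure is \<open>G\<close>.  Semisimplicity comes from the separability idempotent
  \<open>\<Lambda>\<^sub>1 \<otimes> S(\<Lambda>\<^sub>2)\<close> of the integral \<open>\<Lambda> = \<delta>\<^sub>1\<close>.
\<close>

section \<open>Structure constants and elements\<close>

text \<open>Without the twist the function algebra is commutative, every Hopf subalgebra is normal,
  and each normal subgroup of \<open>G\<close> gives one. The obstruction to normality must come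
  from the deformed product. It is detected by an element of \<open>N\<close> that commutes with one
  of \<open>s\<close>, \<open>t\<close> but with no nontrivial power of the other: members of
  \<open>K\<close> are constant on cosets of \<open>N\<close>, so in a product only the factor
  outside \<open>K\<close> sees that element. Commutators with elements of \<open>N\<close> supply
  it, since the powers of \<open>s\<close> act without fixed points on the Sylow p-subgroup. The two
  implications are not mirror images, because the twist puts \<open>s\<close> on the first leg and
  \<open>t\<close> on the second. In one case evaluation at a single point is the right functional;
  in the other a Fourier-weighted sum of evaluations along conjugates is used, and an extra factor
  \<open>s\<close> compensates the shift that the weight causes. Tensors are never manipulated as
  such. A twist is a double sum over exponents applied to an arbitrary function that is periodic mod
  \<open>q\<close>, and identities between twists become changes of summation variables.\<close>

lemma sum_delta_left [simp]: "(\<Sum>i<n. delta a i * f i) = (if a < n then f a else (0::'k::field))"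
  by (simp add: delta_def if_distrib[of "\<lambda>x. x * _"] cong: if_cong)

lemma sum_delta_left' [simp]: "(\<Sum>i<n. delta i a * f i) = (if a < n then f a else (0::'k::field))"
  by (simp add: delta_def if_distrib[of "\<lambda>x. x * _"] cong: if_cong)

lemma sum_delta_right [simp]: "(\<Sum>i<n. f i * delta a i) = (if a < n then f a else (0::'k::field))"
  using sum_delta_left[of a f n] by (simp add: mult.commute)

lemma sum_delta_right' [simp]: "(\<Sum>i<n. f i * delta i a) = (if a < n then f a else (0::'k::field))"
  using sum_delta_left'[of a f n] by (simp add: mult.commute)

lemma hprod_lincomb_left:
  "hprod H (\<lambda>i. \<Sum>a\<in>A. c a * f a i) g = (\<lambda>t. \<Sum>a\<in>A. c a * hprod H (f a) g t)"
proof
  fix t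
  have "(\<Sum>i<hdim H. \<Sum>j<hdim H. (\<Sum>a\<in>A. c a * f a i) * g j * hmult H i j t)
     = (\<Sum>i<hdim H. \<Sum>j<hdim H. \<Sum>a\<in>A. c a * (f a i * g j * hmult H i j t))"
    by (simp add: sum_distrib_right sum_distrib_left mult.assoc)
  also have "\<dots> = (\<Sum>i<hdim H. \<Sum>a\<in>A. \<Sum>j<hdim H. c a * (f a i * g j * hmult H i j t))"
    by (intro sum.cong refl sum.swap)
  also have "\<dots> = (\<Sum>a\<in>A. \<Sum>i<hdim H. \<Sum>j<hdim H. c a * (f a i * g j * hmult H i j t))"
    by (rule sum.swap)
  finally show "hprod H (\<lambda>i. \<Sum>a\<in>A. c a * f a i) g t = (\<Sum>a\<in>A. c a * hprod H (f a) g t)"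
    by (simp add: hprod_def sum_distrib_left)
qed

lemma hprod_lincomb_right:
  "hprod H g (\<lambda>i. \<Sum>a\<in>A. c a * f a i) = (\<lambda>t. \<Sum>a\<in>A. c a * hprod H g (f a) t)"
proof
  fix t
  have "(\<Sum>i<hdim H. \<Sum>j<hdim H. g i * (\<Sum>a\<in>A. c a * f a j) * hmult H i j t)
     = (\<Sum>i<hdim H. \<Sum>j<hdim H. \<Sum>a\<in>A. c a * (g i * f a j * hmult H i j t))"
    by (simp add: sum_distrib_right sum_distrib_left ac_simps)
  also have "\<dots> = (\<Sum>i<hdim H. \<Sum>a\<in>A. \<Sum>j<hdim H. c a * (g i * f a j * hmult H i j t))"
    by (intro sum.cong refl sum.swap)
  also have "\<dots> = (\<Sum>a\<in>A. \<Sum>i<hdim H. \<Sum>j<hdim H. c a * (g i * f a j * hmult H i j t))"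
    by (rule sum.swap)
  finally show "hprod H g (\<lambda>i. \<Sum>a\<in>A. c a * f a i) t = (\<Sum>a\<in>A. c a * hprod H g (f a) t)"
    by (simp add: hprod_def sum_distrib_left)
qed

lemma hprod_scale_right: "hprod H g (\<lambda>i. c * f i) = (\<lambda>t. c * hprod H g f t)"
  using hprod_lincomb_right[of H g "\<lambda>_. c" "\<lambda>_. f" "{()}"] by simp

lemma hbasis_in_hvecs [simp]: "i < hdim H \<Longrightarrow> hbasis i \<in> hvecs H"
  by (auto simp: hvecs_def hbasis_def delta_def)

lemma hprod_in_hvecs [simp]: "hprod H u v \<in> hvecs H"
  by (simp add: hvecs_def hprod_def)

lemma hvecs_expand:
  assumes "v \<in> hvecs H" shows "v = (\<lambda>i. \<Sum>a<hdim H. v a * hbasis a i)"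
  using assms by (force simp: hbasis_def hvecs_def)

lemma hprod_hbasis:
  assumes "i < hdim H" "j < hdim H"
  shows "hprod H (hbasis i) (hbasis j) = (\<lambda>t. \<Sum>u<hdim H. hmult H i j u * hbasis u t)"
proof
  fix t
  have "(\<Sum>x<hdim H. \<Sum>y<hdim H. delta i x * delta j y * hmult H x y t) = hmult H i j t"
    using assms by (simp add: mult.assoc sum_distrib_left[symmetric])
  then show "hprod H (hbasis i) (hbasis j) t = (\<Sum>u<hdim H. hmult H i j u * hbasis u t)"
    by (simp add: hprod_def hbasis_def)
qed

lemma hS_hbasis:
  assumes "i < hdim H"
  shows "hS H (hbasis i) = (\<lambda>t. \<Sum>u<hdim H. hantipode H i u * hbasis u t)"
  using assms by (auto simp: hS_def hbasis_def)

lemma hprod_assoc: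
  assumes "hopf_algebra H"
  shows "hprod H (hprod H u v) w = hprod H u (hprod H v w)"
proof
  fix t
  let ?n = "hdim H" and ?m = "hmult H"
  show "hprod H (hprod H u v) w t = hprod H u (hprod H v w) t"
  proof (cases "t < ?n")
    case True
    have ax: "(\<Sum>r<?n. ?m i j r * ?m r l t) = (\<Sum>r<?n. ?m j l r * ?m i r t)"
      if "i < ?n" "j < ?n" "l < ?n" for i j l
      using assms that True by (auto simp: hopf_algebra_def Let_def)
    have "hprod H (hprod H u v) w t
        = (\<Sum>r<?n. \<Sum>l<?n. \<Sum>i<?n. \<Sum>j<?n. u i * v j * w l * (?m i j r * ?m r l t))"
      using True by (simp add: hprod_def sum_distrib_right sum_distrib_left ac_simps)
    also have "\<dots> = (\<Sum>l<?n. \<Sum>r<?n. \<Sum>i<?n. \<Sum>j<?n. u i * v j * w l * (?m i j r * ?m r l t))"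
      by (rule sum.swap)
    also have "\<dots> = (\<Sum>l<?n. \<Sum>i<?n. \<Sum>r<?n. \<Sum>j<?n. u i * v j * w l * (?m i j r * ?m r l t))"
      by (intro sum.cong refl sum.swap)
    also have "\<dots> = (\<Sum>l<?n. \<Sum>i<?n. \<Sum>j<?n. \<Sum>r<?n. u i * v j * w l * (?m i j r * ?m r l t))"
      by (intro sum.cong refl sum.swap)
    also have "\<dots> = (\<Sum>l<?n. \<Sum>i<?n. \<Sum>j<?n. \<Sum>r<?n. u i * v j * w l * (?m j l r * ?m i r t))"
      by (simp add: sum_distrib_left[symmetric] ax)
    also have "\<dots> = (\<Sum>i<?n. \<Sum>l<?n. \<Sum>j<?n. \<Sum>r<?n. u i * v j * w l * (?m j l r * ?m i r t))"
      by (rule sum.swap)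
    also have "\<dots> = (\<Sum>i<?n. \<Sum>j<?n. \<Sum>l<?n. \<Sum>r<?n. u i * v j * w l * (?m j l r * ?m i r t))"
      by (intro sum.cong refl sum.swap)
    also have "\<dots> = (\<Sum>i<?n. \<Sum>j<?n. \<Sum>r<?n. \<Sum>l<?n. u i * v j * w l * (?m j l r * ?m i r t))"
      by (intro sum.cong refl sum.swap)
    also have "\<dots> = (\<Sum>i<?n. \<Sum>r<?n. \<Sum>j<?n. \<Sum>l<?n. u i * v j * w l * (?m j l r * ?m i r t))"
      by (intro sum.cong refl sum.swap)
    also have "\<dots> = hprod H u (hprod H v w) t"
      using True by (simp add: hprod_def sum_distrib_right sum_distrib_left ac_simps)
    finally show ?thesis .
  qed (simp add: hprod_def)
qed

lemma hone_expand: "hone H = (\<lambda>t. \<Sum>r<hdim H. hunit H r * hbasis r t)"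
  by (force simp: hone_def hbasis_def)

lemma hprod_hone_left:
  assumes H: "hopf_algebra H" and v: "v \<in> hvecs H"
  shows "hprod H (hone H) v = v"
proof -
  have *: "hprod H (hone H) (hbasis i) = hbasis i" if i: "i < hdim H" for i
  proof
    fix t
    have "hprod H (hone H) (hbasis i) t
      = (\<Sum>r<hdim H. hunit H r * hprod H (hbasis r) (hbasis i) t)"
      by (simp add: hone_expand hprod_lincomb_left)
    also have "\<dots> = (\<Sum>r<hdim H. hunit H r * (if t < hdim H then hmult H r i t else 0))"
      using i by (intro sum.cong refl) (simp add: hprod_hbasis, simp add: hbasis_def)
    also have "\<dots> = hbasis i t"
      using H i by (cases "t < hdim H") (auto simp: hopf_algebra_def Let_def hbasis_def delta_def)
    finally show "hprod H (hone H) (hbasis i) t = hbasis i t" .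
  qed
  have "hprod H (hone H) v = (\<lambda>t. \<Sum>a<hdim H. v a * hprod H (hone H) (hbasis a) t)"
    by (subst hvecs_expand[OF v]) (rule hprod_lincomb_right)
  also have "\<dots> = (\<lambda>t. \<Sum>a<hdim H. v a * hbasis a t)" by (simp add: *)
  finally show ?thesis using hvecs_expand[OF v] by simp
qed

lemma hprod_hone_right:
  assumes H: "hopf_algebra H" and v: "v \<in> hvecs H"
  shows "hprod H v (hone H) = v"
proof -
  have *: "hprod H (hbasis i) (hone H) = hbasis i" if i: "i < hdim H" for i
  proof
    fix t
    have "hprod H (hbasis i) (hone H) t
      = (\<Sum>r<hdim H. hunit H r * hprod H (hbasis i) (hbasis r) t)"
      by (simp add: hone_expand hprod_lincomb_right)
    also have "\<dots> = (\<Sum>r<hdim H. hunit H r * (if t < hdim H then hmult H i r t else 0))"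
      using i by (intro sum.cong refl) (simp add: hprod_hbasis, simp add: hbasis_def)
    also have "\<dots> = hbasis i t"
      using H i by (cases "t < hdim H") (auto simp: hopf_algebra_def Let_def hbasis_def delta_def)
    finally show "hprod H (hbasis i) (hone H) t = hbasis i t" .
  qed
  have "hprod H v (hone H) = (\<lambda>t. \<Sum>a<hdim H. v a * hprod H (hbasis a) (hone H) t)"
    by (subst hvecs_expand[OF v]) (rule hprod_lincomb_left)
  also have "\<dots> = (\<lambda>t. \<Sum>a<hdim H. v a * hbasis a t)" by (simp add: *)
  finally show ?thesis using hvecs_expand[OF v] by simp
qed

lemma hsubspace_lincomb:
  assumes "hsubspace H K" "finite A" "\<And>a. a \<in> A \<Longrightarrow> f a \<in> K"
  shows "(\<lambda>i. \<Sum>a\<in>A. c a * f a i) \<in> K"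
  using assms(2,3)
proof (induction A rule: finite_induct)
  case empty
  then show ?case using assms(1) by (simp add: hsubspace_def hzero_def)
next
  case (insert x A)
  have "(\<lambda>i. c x * f x i) \<in> K" "(\<lambda>i. \<Sum>a\<in>A. c a * f a i) \<in> K"
    using insert assms(1) by (auto simp: hsubspace_def)
  then have "(\<lambda>i. c x * f x i + (\<Sum>a\<in>A. c a * f a i)) \<in> K"
    using assms(1) by (fastforce simp: hsubspace_def)
  then show ?case using insert by simp
qed

section \<open>Separable algebras are semisimple\<close>

text \<open>A linear left inverse of the inclusion, taken on all sequences. Linearity is recorded
  for indexed finite combinations, the shape in which products expand over the basis.\<close>

lemma hsubspace_projection:
  fixes H :: "'k::field hopf"
  assumes L: "hsubspace H L"
  obtains P where "\<And>v. P v \<in> L" "\<And>v. v \<in> L \<Longrightarrow> P v = v"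
    "\<And>(A::nat set) c f. finite A \<Longrightarrow>
       P (\<lambda>i. \<Sum>a\<in>A. c a * f a i) = (\<lambda>i. \<Sum>a\<in>A. c a * P (f a) i)"
proof -
  define sc :: "'k \<Rightarrow> (nat \<Rightarrow> 'k) \<Rightarrow> nat \<Rightarrow> 'k" where "sc = (\<lambda>c v i. c * v i)"
  interpret V: vector_space sc
    by unfold_locales (auto simp: sc_def plus_fun_def algebra_simps)
  interpret VP: vector_space_pair sc sc ..
  have sub: "V.subspace L"
    unfolding V.subspace_def
    using L by (auto simp: hsubspace_def sc_def plus_fun_def zero_fun_def hzero_def)
  have "Vector_Spaces.linear sc sc id" by (rule V.linear_id)
  from VP.linear_exists_left_inverse_on[OF this sub] obtain P where P:
    "range P \<subseteq> L" "Vector_Spaces.linear sc sc P" "\<forall>v\<in>L. P v = v" by auto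
  have "P (\<lambda>i. \<Sum>a\<in>A. c a * f a i) = (\<lambda>i. \<Sum>a\<in>A. c a * P (f a) i)"
    if "finite A" for A :: "nat set" and c f using that
  proof (induction A rule: finite_induct)
    case empty
    then show ?case using VP.linear_0[OF P(2)] by (simp add: zero_fun_def)
  next
    case (insert x A)
    have "P (\<lambda>i. \<Sum>a\<in>insert x A. c a * f a i)
      = P (sc (c x) (f x) + (\<lambda>i. \<Sum>a\<in>A. c a * f a i))"
      using insert by (simp add: sc_def plus_fun_def)
    also have "\<dots> = sc (c x) (P (f x)) + P (\<lambda>i. \<Sum>a\<in>A. c a * f a i)"
      by (simp add: VP.linear_add[OF P(2)] VP.linear_scale[OF P(2)])
    finally show ?case using insert by (simp add: sc_def plus_fun_def)
  qed
  with P show ?thesis by (intro that[of P]) auto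
qed

text \<open>Maschke's argument. In coordinates, \<open>central\<close> says \<open>h T = T h\<close>
  and \<open>unit\<close> says that multiplication sends \<open>T\<close> to one. Averaging a
  projection onto \<open>L\<close> over \<open>T\<close> gives an \<open>H\<close>-linear
  projection, whose kernel is the complement.\<close>

lemma separable_imp_semisimple:
  fixes H :: "'k::field hopf"
  assumes H: "hopf_algebra H"
    and central: "\<And>h u y. h < hdim H \<Longrightarrow> u < hdim H \<Longrightarrow> y < hdim H \<Longrightarrow>
       (\<Sum>x<hdim H. T x y * hmult H h x u) = (\<Sum>v<hdim H. T u v * hmult H v h y)"
    and unit: "\<And>u. u < hdim H \<Longrightarrow> (\<Sum>x<hdim H. \<Sum>y<hdim H. T x y * hmult H x y u) = hunit H u"
  shows "semisimple H"
  unfolding semisimple_def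
proof (intro allI impI)
  fix L assume "left_ideal H L"
  then have sub: "hsubspace H L" and ideal: "\<And>a x. a \<in> hvecs H \<Longrightarrow> x \<in> L \<Longrightarrow> hprod H a x \<in> L"
    by (auto simp: left_ideal_def)
  then have Lv: "L \<subseteq> hvecs H" by (simp add: hsubspace_def)
  let ?n = "hdim H"
  obtain P where PL: "\<And>v. P v \<in> L" and Pid: "\<And>v. v \<in> L \<Longrightarrow> P v = v"
    and Plin: "\<And>(A::nat set) c f. finite A \<Longrightarrow>
       P (\<lambda>i. \<Sum>a\<in>A. c a * f a i) = (\<lambda>i. \<Sum>a\<in>A. c a * P (f a) i)"
    by (rule hsubspace_projection[OF sub], rule that)
  \<comment> \<open>Averaging a linear projection over the separability element makes it \<open>H\<close>-linear; the factor \<open>1\<close>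
    brings the double sum into the shape expected by the rules for linear combinations.\<close>
  define R where "R f = (\<lambda>t. \<Sum>x<?n. 1 * (\<Sum>y<?n. T x y * hprod H (hbasis x) (P (hprod H (hbasis y) f)) t))" for f
  have RL: "R f \<in> L" for f
    unfolding R_def
  proof (rule hsubspace_lincomb[OF sub, where c = "\<lambda>_. 1"])
    show "(\<lambda>t. \<Sum>y<?n. T x y * hprod H (hbasis x) (P (hprod H (hbasis y) f)) t) \<in> L"
      if "x \<in> {..<?n}" for x
      using that by (intro hsubspace_lincomb[OF sub, where c = "T x"] ideal PL) auto
  qed simp
  have Rlin: "R (\<lambda>i. \<Sum>a\<in>A. c a * f a i) = (\<lambda>i. \<Sum>a\<in>A. c a * R (f a) i)"
    if A: "finite A" for A :: "nat set" and c f
  proof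
    fix t
    have "R (\<lambda>i. \<Sum>a\<in>A. c a * f a i) t
      = (\<Sum>x<?n. \<Sum>y<?n. \<Sum>a\<in>A. c a * (T x y * hprod H (hbasis x) (P (hprod H (hbasis y) (f a))) t))"
      by (simp add: R_def hprod_lincomb_right Plin[OF A] sum_distrib_left ac_simps)
    also have "\<dots> = (\<Sum>x<?n. \<Sum>a\<in>A. \<Sum>y<?n. c a * (T x y * hprod H (hbasis x) (P (hprod H (hbasis y) (f a))) t))"
      by (intro sum.cong refl sum.swap)
    also have "\<dots> = (\<Sum>a\<in>A. \<Sum>x<?n. \<Sum>y<?n. c a * (T x y * hprod H (hbasis x) (P (hprod H (hbasis y) (f a))) t))"
      by (rule sum.swap)
    finally show "R (\<lambda>i. \<Sum>a\<in>A. c a * f a i) t = (\<Sum>a\<in>A. c a * R (f a) t)"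
      by (simp add: R_def sum_distrib_left)
  qed
  \<comment> \<open>The inner \<open>P\<close> acts on \<open>hprod H (hbasis y) f\<close>, which
    lies in the left ideal \<open>L\<close> and is therefore fixed.\<close>
  have Rid: "R f = f" if f: "f \<in> L" for f
  proof
    fix t
    have "R f t = (\<Sum>x<?n. \<Sum>y<?n. T x y * hprod H (hprod H (hbasis x) (hbasis y)) f t)"
      using f by (simp add: R_def Pid ideal hprod_assoc[OF H])
    also have "\<dots> = (\<Sum>x<?n. 1 * hprod H (\<lambda>i. \<Sum>y<?n. T x y * hprod H (hbasis x) (hbasis y) i) f t)"
      by (simp add: hprod_lincomb_left)
    also have "\<dots> = hprod H (\<lambda>i. \<Sum>x<?n. 1 * (\<Sum>y<?n. T x y * hprod H (hbasis x) (hbasis y) i)) f t"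
      by (simp only: hprod_lincomb_left)
    also have "(\<lambda>i. \<Sum>x<?n. 1 * (\<Sum>y<?n. T x y * hprod H (hbasis x) (hbasis y) i)) = hone H"
    proof
      fix i
      show "(\<Sum>x<?n. 1 * (\<Sum>y<?n. T x y * hprod H (hbasis x) (hbasis y) i)) = hone H i"
      proof (cases "i < ?n")
        case True
        then have "(\<Sum>x<?n. 1 * (\<Sum>y<?n. T x y * hprod H (hbasis x) (hbasis y) i))
           = (\<Sum>x<?n. \<Sum>y<?n. T x y * hmult H x y i)"
          by (simp add: hprod_hbasis, simp add: hbasis_def)
        then show ?thesis using unit True by (simp add: hone_def)
      qed (simp add: hone_def hprod_def)
    qed
    finally show "R f t = f t" using f Lv by (simp add: hprod_hone_left[OF H] subsetD)
  qed
  have Rbasis: "R (hprod H (hbasis h) f) = hprod H (hbasis h) (R f)" if h: "h < ?n" for h f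
  proof
    fix t
    let ?q = "\<lambda>u y. hprod H (hbasis u) (P (hprod H (hbasis y) f)) t"
    have "hprod H (hbasis h) (R f) t = (\<Sum>x<?n. \<Sum>y<?n. T x y * hprod H (hprod H (hbasis h) (hbasis x)) (P (hprod H (hbasis y) f)) t)"
      unfolding R_def hprod_lincomb_right by (simp add: hprod_lincomb_right hprod_assoc[OF H])
    also have "\<dots> = (\<Sum>x<?n. \<Sum>y<?n. \<Sum>u<?n. T x y * hmult H h x u * ?q u y)"
      using h by (intro sum.cong refl) (simp add: hprod_hbasis hprod_lincomb_left sum_distrib_left mult.assoc)
    also have "\<dots> = (\<Sum>x<?n. \<Sum>u<?n. \<Sum>y<?n. T x y * hmult H h x u * ?q u y)"
      by (intro sum.cong refl sum.swap)
    also have "\<dots> = (\<Sum>u<?n. \<Sum>x<?n. \<Sum>y<?n. T x y * hmult H h x u * ?q u y)"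
      by (rule sum.swap)
    also have "\<dots> = (\<Sum>u<?n. \<Sum>y<?n. \<Sum>x<?n. T x y * hmult H h x u * ?q u y)"
      by (intro sum.cong refl sum.swap)
    \<comment> \<open>Here \<open>h\<close> passes from the left leg of \<open>T\<close> to the
      right leg.\<close>
    also have "\<dots> = (\<Sum>u<?n. \<Sum>y<?n. \<Sum>v<?n. T u v * hmult H v h y * ?q u y)"
      using h by (simp add: sum_distrib_right[symmetric] central)
    also have "\<dots> = (\<Sum>u<?n. \<Sum>v<?n. \<Sum>y<?n. T u v * hmult H v h y * ?q u y)"
      by (intro sum.cong refl sum.swap)
    also have "\<dots> = (\<Sum>u<?n. \<Sum>v<?n. T u v * hprod H (hbasis u) (P (hprod H (hprod H (hbasis v) (hbasis h)) f)) t)"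
      using h by (intro sum.cong refl)
        (simp add: hprod_hbasis hprod_lincomb_left hprod_lincomb_right Plin sum_distrib_left mult.assoc)
    also have "\<dots> = R (hprod H (hbasis h) f) t"
      by (simp add: R_def hprod_assoc[OF H])
    finally show "R (hprod H (hbasis h) f) t = hprod H (hbasis h) (R f) t" by simp
  qed
  have Rprod: "R (hprod H a f) = hprod H a (R f)" if a: "a \<in> hvecs H" for a f
  proof -
    have "R (hprod H a f) = R (\<lambda>i. \<Sum>h<?n. a h * hprod H (hbasis h) f i)"
      by (subst hvecs_expand[OF a]) (simp add: hprod_lincomb_left)
    also have "\<dots> = (\<lambda>i. \<Sum>h<?n. a h * hprod H (hbasis h) (R f) i)"
      by (simp add: Rlin Rbasis)
    also have "\<dots> = hprod H a (R f)"
      by (subst (2) hvecs_expand[OF a]) (simp add: hprod_lincomb_left)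
    finally show ?thesis .
  qed
  \<comment> \<open>The scalar \<open>c\<close> lets one rule give additivity, homogeneity and the
    difference of \<open>v\<close> and \<open>R v\<close>.\<close>
  have Radd: "R (\<lambda>i. v i + c * w i) = (\<lambda>i. R v i + c * R w i)" for v w c
    using Rlin[of "{0,1}" "\<lambda>i. if i = 0 then 1 else c" "\<lambda>i. if i = 0 then v else w"] by simp
  have R0: "R hzero = hzero" using Rlin[of "{}"] by (simp add: hzero_def)
  have Rscale: "R (\<lambda>i. c * w i) = (\<lambda>i. c * R w i)" for w c
    using Radd[of hzero c w] by (simp add: R0) (simp add: hzero_def)
  define L' where "L' = {f \<in> hvecs H. R f = hzero}"
  have "left_ideal H L'"
    using Radd[of _ 1] R0 Rscale
    by (auto simp: left_ideal_def hsubspace_def L'_def Rprod hvecs_def hzero_def)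
       (auto simp: hprod_def)
  moreover have "L \<inter> L' = {hzero}"
    using Rid sub R0 by (auto simp: L'_def hsubspace_def)
  moreover have "\<exists>x\<in>L. \<exists>y\<in>L'. v = (\<lambda>i. x i + y i)" if v: "v \<in> hvecs H" for v
  proof (intro bexI)
    show "R v \<in> L" by (rule RL)
    have "R (\<lambda>i. v i + (- 1) * R v i) = hzero"
      by (simp only: Radd Rid[OF RL]) (simp add: hzero_def)
    then show "(\<lambda>i. v i + (- 1) * R v i) \<in> L'"
      using v RL[of v] Lv by (auto simp: L'_def hvecs_def)
  qed simp
  ultimately show "\<exists>L'. left_ideal H L' \<and> L \<inter> L' = {hzero} \<and>
      (\<forall>v\<in>hvecs H. \<exists>x\<in>L. \<exists>y\<in>L'. v = (\<lambda>i. x i + y i))" by blast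
qed

section \<open>Normal Hopf subalgebras\<close>

lemma hadj_hbasis:
  assumes "a < hdim H"
  shows "hadj H (hbasis a) f = (\<lambda>t. \<Sum>x<hdim H. 1 * (\<Sum>y<hdim H.
      hcomult H a x y * hprod H (hprod H (hbasis x) f) (hS H (hbasis y)) t))"
  using assms by (simp add: hadj_def, simp add: hbasis_def)

text \<open>In Sweedler notation, \<open>g f = g_1 f S(g_2) g_3 = ad(g_1)(f) g_2\<close>, by
  coassociativity, antipode and counit. A left factor is moved to the right of \<open>f\<close> at
  the price of an adjoint action.\<close>

lemma hprod_eq_hadj_hprod:
  assumes H: "hopf_algebra H" and g: "g < hdim H" and f: "f \<in> hvecs H"
  shows "hprod H (hbasis g) f = (\<lambda>t. \<Sum>a<hdim H. \<Sum>b<hdim H.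
      hcomult H g a b * hprod H (hadj H (hbasis a) f) (hbasis b) t)"
proof
  fix t
  let ?n = "hdim H" and ?d = "hcomult H"
  let ?q = "\<lambda>x y b. hprod H (hprod H (hbasis x) f) (hprod H (hS H (hbasis y)) (hbasis b)) t"
  have coassoc: "(\<Sum>a<?n. ?d g a z * ?d a x y) = (\<Sum>b<?n. ?d g x b * ?d b y z)"
    if "x < ?n" "y < ?n" "z < ?n" for x y z
    using H g that by (simp add: hopf_algebra_def Let_def)
  have anti: "(\<lambda>t. \<Sum>y<?n. 1 * (\<Sum>b<?n. ?d c y b * hprod H (hS H (hbasis y)) (hbasis b) t))
      = (\<lambda>t. hcounit H c * hone H t)" if c: "c < ?n" for c
  proof
    fix t
    show "(\<Sum>y<?n. 1 * (\<Sum>b<?n. ?d c y b * hprod H (hS H (hbasis y)) (hbasis b) t)) = hcounit H c * hone H t"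
    proof (cases "t < ?n")
      case True
      have "(\<Sum>y<?n. 1 * (\<Sum>b<?n. ?d c y b * hprod H (hS H (hbasis y)) (hbasis b) t))
        = (\<Sum>y<?n. \<Sum>b<?n. \<Sum>r<?n. ?d c y b * hantipode H y r * hmult H r b t)"
      proof -
        have "?d c y b * hprod H (hS H (hbasis y)) (hbasis b) t
          = (\<Sum>r<?n. ?d c y b * hantipode H y r * hmult H r b t)" if "y < ?n" "b < ?n" for y b
          using that True
          by (simp add: hS_hbasis hprod_lincomb_left hprod_hbasis, simp add: hbasis_def,
              simp add: sum_distrib_left mult.assoc)
        then show ?thesis by simp
      qed
      also have "\<dots> = hcounit H c * hunit H t"
        using H c True by (simp add: hopf_algebra_def Let_def)
      finally show ?thesis using True by (simp add: hone_def)
    qed (simp add: hprod_def hone_def)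
  qed
  have "(\<Sum>a<?n. \<Sum>b<?n. ?d g a b * hprod H (hadj H (hbasis a) f) (hbasis b) t)
    = (\<Sum>a<?n. \<Sum>b<?n. \<Sum>x<?n. \<Sum>y<?n. ?d g a b * ?d a x y * ?q x y b)"
  proof -
    have "hprod H (hadj H (hbasis a) f) (hbasis b) t = (\<Sum>x<?n. \<Sum>y<?n. ?d a x y * ?q x y b)"
      if "a < ?n" for a b
      using that by (simp only: hadj_hbasis hprod_lincomb_left) (simp only: mult_1 hprod_assoc[OF H])
    then show ?thesis by (simp add: sum_distrib_left mult.assoc)
  qed
  also have "\<dots> = (\<Sum>b<?n. \<Sum>a<?n. \<Sum>x<?n. \<Sum>y<?n. ?d g a b * ?d a x y * ?q x y b)"
    by (rule sum.swap)
  also have "\<dots> = (\<Sum>b<?n. \<Sum>x<?n. \<Sum>a<?n. \<Sum>y<?n. ?d g a b * ?d a x y * ?q x y b)"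
    by (intro sum.cong refl sum.swap)
  also have "\<dots> = (\<Sum>b<?n. \<Sum>x<?n. \<Sum>y<?n. \<Sum>a<?n. ?d g a b * ?d a x y * ?q x y b)"
    by (intro sum.cong refl sum.swap)
  also have "\<dots> = (\<Sum>b<?n. \<Sum>x<?n. \<Sum>y<?n. \<Sum>c<?n. ?d g x c * ?d c y b * ?q x y b)"
    by (simp add: sum_distrib_right[symmetric] coassoc)
  also have "\<dots> = (\<Sum>x<?n. \<Sum>b<?n. \<Sum>y<?n. \<Sum>c<?n. ?d g x c * ?d c y b * ?q x y b)"
    by (rule sum.swap)
  also have "\<dots> = (\<Sum>x<?n. \<Sum>b<?n. \<Sum>c<?n. \<Sum>y<?n. ?d g x c * ?d c y b * ?q x y b)"
    by (intro sum.cong refl sum.swap)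
  also have "\<dots> = (\<Sum>x<?n. \<Sum>c<?n. \<Sum>b<?n. \<Sum>y<?n. ?d g x c * ?d c y b * ?q x y b)"
    by (intro sum.cong refl sum.swap)
  also have "\<dots> = (\<Sum>x<?n. \<Sum>c<?n. \<Sum>y<?n. \<Sum>b<?n. ?d g x c * ?d c y b * ?q x y b)"
    by (intro sum.cong refl sum.swap)
  also have "\<dots> = (\<Sum>x<?n. \<Sum>c<?n. ?d g x c * hprod H (hprod H (hbasis x) f)
      (\<lambda>t. \<Sum>y<?n. 1 * (\<Sum>b<?n. ?d c y b * hprod H (hS H (hbasis y)) (hbasis b) t)) t)"
    unfolding hprod_lincomb_right
    by (simp add: hprod_lincomb_right sum_distrib_left mult.assoc)
  also have "\<dots> = (\<Sum>x<?n. \<Sum>c<?n. (?d g x c * hcounit H c) * hprod H (hbasis x) f t)"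
    by (intro sum.cong refl)
       (simp only: lessThan_iff anti hprod_scale_right hprod_hone_right[OF H] hprod_in_hvecs mult.assoc)
  also have "\<dots> = (\<Sum>x<?n. delta x g * hprod H (hbasis x) f t)"
    using H g by (intro sum.cong refl) (simp add: sum_distrib_right[symmetric] hopf_algebra_def Let_def)
  also have "\<dots> = hprod H (hbasis g) f t" using g by simp
  finally show "hprod H (hbasis g) f t = (\<Sum>a<?n. \<Sum>b<?n. ?d g a b * hprod H (hadj H (hbasis a) f) (hbasis b) t)"
    by simp
qed

definition heps :: "('k::field) hopf \<Rightarrow> (nat \<Rightarrow> 'k) \<Rightarrow> 'k" where
  "heps H v = (\<Sum>i<hdim H. v i * hcounit H i)"

lemma heps_lincomb: "heps H (\<lambda>i. \<Sum>a\<in>A. c a * f a i) = (\<Sum>a\<in>A. c a * heps H (f a))"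
proof -
  have "heps H (\<lambda>i. \<Sum>a\<in>A. c a * f a i) = (\<Sum>i<hdim H. \<Sum>a\<in>A. c a * f a i * hcounit H i)"
    by (simp add: heps_def sum_distrib_right)
  also have "\<dots> = (\<Sum>a\<in>A. \<Sum>i<hdim H. c a * f a i * hcounit H i)" by (rule sum.swap)
  finally show ?thesis by (simp add: heps_def sum_distrib_left mult.assoc)
qed

lemma heps_hprod:
  assumes H: "hopf_algebra H"
  shows "heps H (hprod H u v) = heps H u * heps H v"
proof -
  let ?n = "hdim H"
  have "heps H (hprod H u v) = (\<Sum>r<?n. \<Sum>i<?n. \<Sum>j<?n. u i * v j * (hmult H i j r * hcounit H r))"
    by (simp add: heps_def hprod_def sum_distrib_right mult.assoc)
  also have "\<dots> = (\<Sum>i<?n. \<Sum>r<?n. \<Sum>j<?n. u i * v j * (hmult H i j r * hcounit H r))"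
    by (rule sum.swap)
  also have "\<dots> = (\<Sum>i<?n. \<Sum>j<?n. \<Sum>r<?n. u i * v j * (hmult H i j r * hcounit H r))"
    by (intro sum.cong refl sum.swap)
  also have "\<dots> = (\<Sum>i<?n. \<Sum>j<?n. u i * v j * (hcounit H i * hcounit H j))"
    using H by (intro sum.cong refl) (simp add: sum_distrib_left[symmetric] hopf_algebra_def Let_def)
  finally show ?thesis by (simp add: heps_def sum_product ac_simps)
qed

text \<open>Normality gives the inclusion of \<open>H K\<^sup>+\<close> in \<open>K\<^sup>+ H\<close>, stated for the functionals vanishing on
  \<open>K\<^sup>+ H\<close>.\<close>

lemma normal_hopf_subalgebra_functional:
  fixes H :: "'k::field hopf"
  assumes H: "hopf_algebra H" and K: "normal_hopf_subalgebra H K"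
    and van: "\<And>k b. k \<in> K \<Longrightarrow> heps H k = 0 \<Longrightarrow> b < hdim H \<Longrightarrow>
        (\<Sum>i\<in>I. c i * hprod H k (hbasis b) (x i)) = 0"
    and f: "f \<in> K" "heps H f = 0" and g: "g < hdim H"
  shows "(\<Sum>i\<in>I. c i * hprod H (hbasis g) f (x i)) = 0"
proof -
  let ?n = "hdim H" and ?d = "hcomult H"
  have fv: "f \<in> hvecs H" and adK: "hadj H h f \<in> K" if "h \<in> hvecs H" for h
    using K f that by (auto simp: normal_hopf_subalgebra_def hopf_subalgebra_def hsubspace_def)
  \<comment> \<open>The counit is multiplicative, so the adjoint action preserves its kernel and
    \<open>van\<close> applies to every term.\<close>
  have eps: "heps H (hadj H (hbasis a) f) = 0" if "a < ?n" for a
    using that f(2) by (simp only: hadj_hbasis heps_lincomb heps_hprod[OF H]) simp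
  have "(\<Sum>i\<in>I. c i * hprod H (hbasis g) f (x i))
     = (\<Sum>i\<in>I. \<Sum>a<?n. \<Sum>b<?n. ?d g a b * (c i * hprod H (hadj H (hbasis a) f) (hbasis b) (x i)))"
    using g by (subst hprod_eq_hadj_hprod[OF H g fv[OF hbasis_in_hvecs[OF g]]])
      (simp add: sum_distrib_left ac_simps)
  also have "\<dots> = (\<Sum>a<?n. \<Sum>i\<in>I. \<Sum>b<?n. ?d g a b * (c i * hprod H (hadj H (hbasis a) f) (hbasis b) (x i)))"
    by (rule sum.swap)
  also have "\<dots> = (\<Sum>a<?n. \<Sum>b<?n. \<Sum>i\<in>I. ?d g a b * (c i * hprod H (hadj H (hbasis a) f) (hbasis b) (x i)))"
    by (intro sum.cong refl sum.swap)
  also have "\<dots> = 0"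
    by (simp add: sum_distrib_left[symmetric] van adK eps)
  finally show ?thesis .
qed

section \<open>Isomorphism and (co)commutativity\<close>

lemma sum_mult_invertible_eq:
  fixes F G :: "nat \<Rightarrow> nat \<Rightarrow> 'k::field"
  assumes inv: "\<And>i l. i < n \<Longrightarrow> l < n \<Longrightarrow> (\<Sum>j<n. F i j * G j l) = delta i l"
    and eq: "\<And>t. t < n \<Longrightarrow> (\<Sum>r<n. u r * F r t) = (\<Sum>r<n. v r * F r t)" and r: "r < n"
  shows "u r = v r"
proof -
  have *: "(\<Sum>t<n. (\<Sum>i<n. w i * F i t) * G t r) = w r" for w
  proof -
    have "(\<Sum>t<n. (\<Sum>i<n. w i * F i t) * G t r) = (\<Sum>t<n. \<Sum>i<n. w i * (F i t * G t r))"
      by (simp add: sum_distrib_right mult.assoc)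
    also have "\<dots> = (\<Sum>i<n. \<Sum>t<n. w i * (F i t * G t r))" by (rule sum.swap)
    also have "\<dots> = w r" using r by (simp add: sum_distrib_left[symmetric] inv)
    finally show ?thesis .
  qed
  show ?thesis using *[of u] *[of v] eq by simp
qed

lemma hopf_iso_commutative:
  assumes iso: "hopf_iso H H'"
    and comm: "\<And>x y t. hmult H' x y t = hmult H' y x t"
    and "a < hdim H" "b < hdim H" "r < hdim H"
  shows "hmult H a b r = hmult H b a r"
proof -
  let ?n = "hdim H"
  from iso obtain F G where
    inv': "\<forall>i<?n. \<forall>l<?n. (\<Sum>j<?n. F i j * G j l) = delta i l \<and> (\<Sum>j<?n. G i j * F j l) = delta i l"
    and mult: "\<forall>a<?n. \<forall>b<?n. \<forall>t<?n. (\<Sum>r<?n. hmult H a b r * F r t) =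
           (\<Sum>x<?n. \<Sum>y<?n. F a x * F b y * hmult H' x y t)"
    unfolding hopf_iso_def Let_def by (elim conjE exE) (rule that)
  from inv' have inv: "\<And>i l. i < ?n \<Longrightarrow> l < ?n \<Longrightarrow> (\<Sum>j<?n. F i j * G j l) = delta i l" by simp
  have "(\<Sum>r<?n. hmult H a b r * F r t) = (\<Sum>r<?n. hmult H b a r * F r t)" if t: "t < ?n" for t
  proof -
    have "(\<Sum>x<?n. \<Sum>y<?n. F a x * F b y * hmult H' x y t)
      = (\<Sum>y<?n. \<Sum>x<?n. F b y * F a x * hmult H' y x t)"
      by (subst sum.swap) (simp add: comm[of _ _ t] mult.commute)
    then show ?thesis using assms t by (simp add: mult)
  qed
  from sum_mult_invertible_eq[OF inv this] assms show ?thesis by blast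
qed

lemma hopf_iso_cocommutative:
  assumes iso: "hopf_iso H H'"
    and comm: "\<And>x y t. hcomult H' t x y = hcomult H' t y x"
    and l: "l < hdim H" and "a < hdim H" "b < hdim H"
  shows "hcomult H l a b = hcomult H l b a"
proof -
  let ?n = "hdim H" and ?d = "hcomult H"
  from iso obtain F G where
    inv': "\<forall>i<?n. \<forall>l<?n. (\<Sum>j<?n. F i j * G j l) = delta i l \<and> (\<Sum>j<?n. G i j * F j l) = delta i l"
    and comult': "\<forall>l<?n. \<forall>x<?n. \<forall>y<?n. (\<Sum>a<?n. \<Sum>b<?n. ?d l a b * F a x * F b y)
          = (\<Sum>r<?n. F l r * hcomult H' r x y)"
    unfolding hopf_iso_def Let_def by (elim conjE exE) (rule that)
  from inv' have inv: "\<And>i l. i < ?n \<Longrightarrow> l < ?n \<Longrightarrow> (\<Sum>j<?n. F i j * G j l) = delta i l" by simp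
  from comult' have comult: "\<And>l x y. l < ?n \<Longrightarrow> x < ?n \<Longrightarrow> y < ?n \<Longrightarrow>
          (\<Sum>a<?n. \<Sum>b<?n. ?d l a b * F a x * F b y) = (\<Sum>r<?n. F l r * hcomult H' r x y)" by blast
  have sym: "(\<Sum>a<?n. (\<Sum>b<?n. ?d l a b * F b y) * F a x) = (\<Sum>a<?n. (\<Sum>b<?n. ?d l b a * F b y) * F a x)"
    if xy: "x < ?n" "y < ?n" for x y
  proof -
    have "(\<Sum>a<?n. (\<Sum>b<?n. ?d l a b * F b y) * F a x) = (\<Sum>r<?n. F l r * hcomult H' r x y)"
      using comult[OF l xy] by (simp add: sum_distrib_right sum_distrib_left ac_simps)
    also have "\<dots> = (\<Sum>r<?n. F l r * hcomult H' r y x)" by (simp add: comm)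
    also have "\<dots> = (\<Sum>a<?n. \<Sum>b<?n. ?d l a b * F a y * F b x)"
      using comult[OF l xy(2,1)] by simp
    also have "\<dots> = (\<Sum>b<?n. \<Sum>a<?n. ?d l a b * F a y * F b x)" by (rule sum.swap)
    finally show ?thesis by (simp add: sum_distrib_right)
  qed
  \<comment> \<open>The invertible matrix is cancelled on the first tensor leg here and on the
    second leg in the last step.\<close>
  have "(\<Sum>b<?n. ?d l a b * F b y) = (\<Sum>b<?n. ?d l b a * F b y)" if "a < ?n" "y < ?n" for a y
    using sum_mult_invertible_eq[OF inv, of "\<lambda>a. \<Sum>b<?n. ?d l a b * F b y"
        "\<lambda>a. \<Sum>b<?n. ?d l b a * F b y" a] sym that by blast
  from sum_mult_invertible_eq[OF inv this] assms show ?thesis by blast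
qed

section \<open>The finite Fourier kernel\<close>

lemma periodic_eqI:
  fixes F :: "int \<Rightarrow> 'a"
  assumes per: "\<And>x. F (x + q) = F x" and eq: "x = y + q * m"
  shows "F x = F y"
proof -
  have "F (y + q * m) = F y"
  proof (induction m rule: int_induct[where k = 0])
    case (step1 i)
    then show ?case using per[of "y + q * i"] by (simp add: algebra_simps)
  next
    case (step2 i)
    then show ?case using per[of "y + q * (i - 1)"] by (simp add: algebra_simps)
  qed simp
  then show ?thesis by (simp add: eq)
qed

text \<open>Lets exponents stay plain integers while sums run over one period, which keeps residue
  arithmetic out of the kernel calculations.\<close>

lemma sum_periodic_shift:
  fixes F :: "int \<Rightarrow> 'a::comm_monoid_add"
  assumes per: "\<And>x. F (x + int q) = F x"
  shows "(\<Sum>c\<in>{0..<int q}. F (c + k)) = (\<Sum>c\<in>{0..<int q}. F c)"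
proof -
  have mod: "F (x mod int q) = F x" for x
    by (rule periodic_eqI[where F = F and q = "int q" and m = "- (x div int q)"]) (rule per, simp add: minus_mult_div_eq_mod[symmetric])
  show ?thesis
  proof (cases "q = 0")
    case False
    then have q: "int q > 0" by simp
    show ?thesis
      by (rule sum.reindex_bij_witness[where i = "\<lambda>c. (c - k) mod int q" and j = "\<lambda>c. (c + k) mod int q"])
         (use q in \<open>simp_all add: mod mod_diff_left_eq mod_add_left_eq\<close>)
  qed simp
qed

lemma sum_periodic_neg:
  fixes F :: "int \<Rightarrow> 'a::comm_monoid_add"
  assumes per: "\<And>x. F (x + int q) = F x"
  shows "(\<Sum>c\<in>{0..<int q}. F (- c)) = (\<Sum>c\<in>{0..<int q}. F c)"
proof -
  \<comment> \<open>The reflection of the interval \<open>{0..<int q}\<close> turns negation into a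
    shift.\<close>
  have "(\<Sum>c\<in>{0..<int q}. F (- c)) = (\<Sum>c\<in>{0..<int q}. F (c + (1 - int q)))"
    by (rule sum.reindex_bij_witness[where i = "\<lambda>c. int q - 1 - c" and j = "\<lambda>c. int q - 1 - c"]) auto
  also have "\<dots> = (\<Sum>c\<in>{0..<int q}. F c)" by (rule sum_periodic_shift[where F = F, OF per])
  finally show ?thesis .
qed

text \<open>A primitive character of the integers mod \<open>q\<close>, written on all integers;
  \<open>z_sum\<close> is the orthogonality relation.\<close>

locale fourier =
  fixes q :: nat and z :: "int \<Rightarrow> 'k::field_char_0"
  assumes q_pos: "q > 0"
    and z_0: "z 0 = 1"
    and z_add: "\<And>a b. z (a + b) = z a * z b"
    and z_sum: "\<And>a. (\<Sum>c\<in>{0..<int q}. z (a * c)) = (if int q dvd a then of_nat q else 0)"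
    and z_q: "z (int q) = 1"
begin

abbreviation "Q \<equiv> {0..<int q}"

lemma z_q_mult: "z (int q * a) = 1"
proof (induction a rule: int_induct[where k = 0])
  case (step1 i)
  then show ?case by (simp add: ring_distribs z_add z_q)
next
  case (step2 i)
  have "z (int q * i) = z (int q * (i - 1)) * z (int q)"
    using z_add[of "int q * (i - 1)" "int q"] by (simp add: algebra_simps)
  with step2 show ?case by (simp add: z_q)
qed (simp add: z_0)

lemma z_eqI: "a = b + int q * y \<Longrightarrow> z a = z b"
  by (simp add: z_add z_q_mult)

lemma z_periodic: "z (s * ((a + int q) * b)) = z (s * (a * b))" "z (s * (b * (a + int q))) = z (s * (b * a))"
  by (rule z_eqI[where y = "s * b"], simp add: algebra_simps)+

lemma Q_dvd: "c \<in> Q \<Longrightarrow> int q dvd c \<longleftrightarrow> c = 0"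
  using zdvd_not_zless[of c "int q"] by force

lemma sum_Q_dvd: "(\<Sum>c\<in>Q. (if int q dvd c then F c else 0)) = (F 0 :: 'k)"
proof -
  have "(\<Sum>c\<in>Q. (if int q dvd c then F c else 0)) = (\<Sum>c\<in>Q. (if c = 0 then F c else 0))"
    by (intro sum.cong refl) (simp add: Q_dvd)
  also have "\<dots> = F 0" using q_pos by simp
  finally show ?thesis .
qed

text \<open>If \<open>\<Phi> a c\<close> is the value of a linear form at
  \<open>s^c (x) t^a\<close>, then \<open>J 1 \<Phi>\<close> is its value at the twist and
  \<open>J (- 1) \<Phi>\<close> its value at the inverse twist.\<close>

definition J :: "int \<Rightarrow> (int \<Rightarrow> int \<Rightarrow> 'k) \<Rightarrow> 'k" where
  "J s \<Phi> = (\<Sum>a\<in>Q. \<Sum>c\<in>Q. z (s * (a * c)) * \<Phi> a c) / of_nat q"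

section \<open>Linearity, counit and inversion rules for the kernel\<close>

lemma J_mult: "J s (\<lambda>a c. k * \<Phi> a c) = k * J s \<Phi>"
  by (simp add: J_def sum_distrib_left ac_simps)

lemma J_sum: "J s (\<lambda>a c. \<Sum>i\<in>I. \<Phi> i a c) = (\<Sum>i\<in>I. J s (\<Phi> i))"
proof -
  have "(\<Sum>a\<in>Q. \<Sum>c\<in>Q. z (s * (a * c)) * (\<Sum>i\<in>I. \<Phi> i a c))
      = (\<Sum>a\<in>Q. \<Sum>c\<in>Q. \<Sum>i\<in>I. z (s * (a * c)) * \<Phi> i a c)" by (simp add: sum_distrib_left)
  also have "\<dots> = (\<Sum>a\<in>Q. \<Sum>i\<in>I. \<Sum>c\<in>Q. z (s * (a * c)) * \<Phi> i a c)"
    by (intro sum.cong refl sum.swap)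
  also have "\<dots> = (\<Sum>i\<in>I. \<Sum>a\<in>Q. \<Sum>c\<in>Q. z (s * (a * c)) * \<Phi> i a c)" by (rule sum.swap)
  finally show ?thesis by (simp add: J_def sum_divide_distrib)
qed

lemma J_flip: "J s (\<lambda>a c. \<Phi> c a) = J s \<Phi>"
  unfolding J_def by (subst sum.swap) (simp add: mult.commute)

lemma J_commute: "J s (\<lambda>a c. J r (\<lambda>b d. \<Phi> a c b d)) = J r (\<lambda>b d. J s (\<lambda>a c. \<Phi> a c b d))"
proof -
  have "J s (\<lambda>a c. J r (\<lambda>b d. \<Phi> a c b d))
    = J s (\<lambda>a c. \<Sum>b\<in>Q. \<Sum>d\<in>Q. (z (r * (b * d)) / of_nat q) * \<Phi> a c b d)"
    by (simp add: J_def[of r] sum_divide_distrib)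
  also have "\<dots> = (\<Sum>b\<in>Q. \<Sum>d\<in>Q. (z (r * (b * d)) / of_nat q) * J s (\<lambda>a c. \<Phi> a c b d))"
    by (simp only: J_sum J_mult)
  also have "\<dots> = J r (\<lambda>b d. J s (\<lambda>a c. \<Phi> a c b d))"
    by (simp add: J_def[of r] sum_divide_distrib)
  finally show ?thesis .
qed

text \<open>Orthogonality in the absent exponent forces the other one to be 0. In Hopf terms, the
  counit on one leg of the twist gives 1.\<close>

lemma J_const_right:
  assumes "s = 1 \<or> s = - 1"
  shows "J s (\<lambda>a c. F a) = F 0"
proof -
  have "(\<Sum>c\<in>Q. z (s * (a * c)) * F a) = of_nat q * (if int q dvd a then F a else 0)" for a
  proof -
    have "(\<Sum>c\<in>Q. z (s * (a * c)) * F a) = (\<Sum>c\<in>Q. z ((s * a) * c)) * F a"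
      by (simp add: sum_distrib_right mult.assoc)
    also have "\<dots> = of_nat q * (if int q dvd a then F a else 0)"
      unfolding z_sum using assms by auto
    finally show ?thesis .
  qed
  then show ?thesis
    using q_pos by (simp add: J_def sum_distrib_left[symmetric] sum_Q_dvd)
qed

lemma J_const_left:
  assumes "s = 1 \<or> s = - 1"
  shows "J s (\<lambda>a c. F c) = F 0"
  using J_flip[of s "\<lambda>a c. F a"] J_const_right[OF assms] by simp

text \<open>The antipode on one leg inverts the twist: the sign moves into the bicharacter.\<close>

lemma J_neg_left:
  assumes per: "\<And>x c. \<Phi> (x + int q) c = \<Phi> x c"
  shows "J s (\<lambda>a c. \<Phi> (- a) c) = J (- s) \<Phi>"
proof -
  have "(\<Sum>a\<in>Q. \<Sum>c\<in>Q. z (s * (a * c)) * \<Phi> (- a) c)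
     = (\<Sum>a\<in>Q. (\<lambda>a. \<Sum>c\<in>Q. z (- s * (a * c)) * \<Phi> a c) (- a))" by simp
  also have "\<dots> = (\<Sum>a\<in>Q. (\<Sum>c\<in>Q. z (- s * (a * c)) * \<Phi> a c))"
    by (subst sum_periodic_neg) (simp_all only: per z_periodic)
  finally show ?thesis by (simp add: J_def)
qed

lemma J_neg_right:
  assumes per: "\<And>x c. \<Phi> c (x + int q) = \<Phi> c x"
  shows "J s (\<lambda>a c. \<Phi> a (- c)) = J (- s) \<Phi>"
  using J_neg_left[of "\<lambda>a c. \<Phi> c a" s, OF per] J_flip[of s "\<lambda>a c. \<Phi> a (-c)"] J_flip[of "-s" \<Phi>]
  by simp

text \<open>With \<open>A = a + b\<close> and \<open>C = c + d\<close> the exponent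
  \<open>s(ac - bd)\<close> becomes \<open>s(aC - Ad)\<close>, so the sum over \<open>a\<close>
  forces \<open>C = 0\<close>. This is the twist meeting its inverse while one exponent of the
  latter also occurs elsewhere.\<close>

lemma J_fuse:
  assumes s: "s = 1 \<or> s = - 1"
    and per1: "\<And>x c d. \<Phi> (x + int q) c d = \<Phi> x c d"
    and per2: "\<And>x c d. \<Phi> c (x + int q) d = \<Phi> c x d"
  shows "J s (\<lambda>a c. J (- s) (\<lambda>b d. \<Phi> (a + b) (c + d) d)) = J (- s) (\<lambda>A D. \<Phi> A 0 D)"
proof -
  let ?K = "of_nat q * of_nat q :: 'k"
  have "J s (\<lambda>a c. J (- s) (\<lambda>b d. \<Phi> (a + b) (c + d) d))
    = (\<Sum>a\<in>Q. \<Sum>c\<in>Q. \<Sum>b\<in>Q. \<Sum>d\<in>Q. z (s * (a * c) - s * (b * d)) * \<Phi> (a + b) (c + d) d) / ?K"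
    by (simp add: J_def sum_distrib_left sum_divide_distrib z_add[symmetric] mult.assoc[symmetric])
  also have "(\<Sum>a\<in>Q. \<Sum>c\<in>Q. \<Sum>b\<in>Q. \<Sum>d\<in>Q. z (s * (a * c) - s * (b * d)) * \<Phi> (a + b) (c + d) d)
    = (\<Sum>a\<in>Q. \<Sum>c\<in>Q. \<Sum>d\<in>Q. \<Sum>b\<in>Q. z (s * (a * c) - s * (b * d)) * \<Phi> (a + b) (c + d) d)"
    by (intro sum.cong refl sum.swap)
  also have "\<dots> = (\<Sum>a\<in>Q. \<Sum>c\<in>Q. \<Sum>d\<in>Q. \<Sum>A\<in>Q. z (s * (a * c) - s * ((A - a) * d)) * \<Phi> A (c + d) d)"
  proof (rule sum.cong[OF refl], rule sum.cong[OF refl], rule sum.cong[OF refl])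
    fix a c d
    define F where "F A = z (s * (a * c) - s * ((A - a) * d)) * \<Phi> A (c + d) d" for A
    have "F (x + int q) = F x" for x
      unfolding F_def per1
      by (intro arg_cong2[where f = "(*)"] refl z_eqI[where y = "- s * d"]) (simp add: algebra_simps)
    from sum_periodic_shift[of F, OF this, of a]
    show "(\<Sum>b\<in>Q. z (s * (a * c) - s * (b * d)) * \<Phi> (a + b) (c + d) d)
      = (\<Sum>A\<in>Q. z (s * (a * c) - s * ((A - a) * d)) * \<Phi> A (c + d) d)"
      by (simp add: F_def add.commute)
  qed
  also have "\<dots> = (\<Sum>a\<in>Q. \<Sum>d\<in>Q. \<Sum>c\<in>Q. \<Sum>A\<in>Q. z (s * (a * c) - s * ((A - a) * d)) * \<Phi> A (c + d) d)"
    by (intro sum.cong refl sum.swap)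
  also have "\<dots> = (\<Sum>a\<in>Q. \<Sum>d\<in>Q. \<Sum>C\<in>Q. \<Sum>A\<in>Q. z (s * (a * C)) * z (- s * (A * d)) * \<Phi> A C d)"
  proof (rule sum.cong[OF refl], rule sum.cong[OF refl])
    fix a d
    define F where "F C = (\<Sum>A\<in>Q. z (s * (a * C)) * z (- s * (A * d)) * \<Phi> A C d)" for C
    have "F (x + int q) = F x" for x by (simp add: F_def per2 z_periodic)
    from sum_periodic_shift[of F, OF this, of d]
    show "(\<Sum>c\<in>Q. \<Sum>A\<in>Q. z (s * (a * c) - s * ((A - a) * d)) * \<Phi> A (c + d) d)
      = (\<Sum>C\<in>Q. \<Sum>A\<in>Q. z (s * (a * C)) * z (- s * (A * d)) * \<Phi> A C d)"
      by (simp add: F_def z_add[symmetric] algebra_simps)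
  qed
  also have "\<dots> = (\<Sum>d\<in>Q. \<Sum>a\<in>Q. \<Sum>C\<in>Q. \<Sum>A\<in>Q. z (s * (a * C)) * z (- s * (A * d)) * \<Phi> A C d)"
    by (rule sum.swap)
  also have "\<dots> = (\<Sum>d\<in>Q. of_nat q * J s (\<lambda>a C. \<Sum>A\<in>Q. z (- s * (A * d)) * \<Phi> A C d))"
    using q_pos by (simp add: J_def) (simp add: sum_distrib_left mult.assoc)
  also have "\<dots> = of_nat q * (\<Sum>d\<in>Q. \<Sum>A\<in>Q. z (- s * (A * d)) * \<Phi> A 0 d)"
    by (subst J_const_left[OF s]) (simp add: sum_distrib_left)
  also have "\<dots> = of_nat q * (\<Sum>A\<in>Q. \<Sum>d\<in>Q. z (- s * (A * d)) * \<Phi> A 0 d)"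
    by (subst sum.swap) (rule refl)
  finally show ?thesis by (simp add: J_def)
qed

lemma J_fuse':
  assumes s: "s = 1 \<or> s = - 1"
    and per1: "\<And>x c d. \<Phi> (x + int q) c d = \<Phi> x c d"
    and per2: "\<And>x c d. \<Phi> c (x + int q) d = \<Phi> c x d"
  shows "J s (\<lambda>a c. J (- s) (\<lambda>b d. \<Phi> (a + b) (c + d) b)) = J (- s) (\<lambda>B C. \<Phi> 0 C B)"
proof -
  have "J s (\<lambda>a c. J (- s) (\<lambda>b d. \<Phi> (a + b) (c + d) b))
    = J s (\<lambda>c a. J (- s) (\<lambda>d b. \<Phi> (a + b) (c + d) b))"
    by (subst J_flip[symmetric]) (subst J_flip[symmetric], rule refl)
  also have "\<dots> = J (- s) (\<lambda>C B. \<Phi> 0 C B)"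
    using J_fuse[OF s, of "\<lambda>C A B. \<Phi> A C B"] per1 per2 by simp
  finally show ?thesis by (subst (asm) J_flip)
qed

lemma J_cancel:
  assumes s: "s = 1 \<or> s = - 1"
    and per1: "\<And>x c. \<Phi> (x + int q) c = \<Phi> x c"
    and per2: "\<And>x c. \<Phi> c (x + int q) = \<Phi> c x"
  shows "J s (\<lambda>a c. J (- s) (\<lambda>b d. \<Phi> (a + b) (c + d))) = \<Phi> 0 0"
  using J_fuse[OF s, of "\<lambda>A C D. \<Phi> A C"] per1 per2 J_const_right[of "-s" "\<lambda>A. \<Phi> A 0"] s by auto

text \<open>The cocycle identity \<open>J_12 (Delta (x) id)(J) = J_23 (id (x) Delta)(J)\<close>,
  with the middle leg carrying a power of \<open>t\<close> and one of \<open>s\<close>. After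
  shifting, both sides have the phase \<open>s(ac + a'C - a'c)\<close>, because the kernel is a
  bicharacter.\<close>

lemma J_assoc:
  assumes per1: "\<And>x a c d. \<Phi> (x + int q) a c d = \<Phi> x a c d"
    and per2: "\<And>x a c d. \<Phi> a c d (x + int q) = \<Phi> a c d x"
  shows "J s (\<lambda>a c. J s (\<lambda>a' c'. \<Phi> (c + c') a' c a)) = J s (\<lambda>a c. J s (\<lambda>a' c'. \<Phi> c a c' (a + a')))"
proof -
  let ?K = "of_nat q * of_nat q :: 'k"
  let ?f = "\<lambda>a a' c C. z (s * (a * c) + s * (a' * C) - s * (a' * c)) * \<Phi> C a' c a"
  have "J s (\<lambda>a c. J s (\<lambda>a' c'. \<Phi> (c + c') a' c a))
    = (\<Sum>a\<in>Q. \<Sum>c\<in>Q. \<Sum>a'\<in>Q. \<Sum>c'\<in>Q. z (s * (a * c) + s * (a' * c')) * \<Phi> (c + c') a' c a) / ?K"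
    by (simp add: J_def sum_distrib_left sum_divide_distrib z_add mult.assoc)
  also have "(\<Sum>a\<in>Q. \<Sum>c\<in>Q. \<Sum>a'\<in>Q. \<Sum>c'\<in>Q. z (s * (a * c) + s * (a' * c')) * \<Phi> (c + c') a' c a)
    = (\<Sum>a\<in>Q. \<Sum>c\<in>Q. \<Sum>a'\<in>Q. \<Sum>C\<in>Q. ?f a a' c C)"
  proof (rule sum.cong[OF refl], rule sum.cong[OF refl], rule sum.cong[OF refl])
    fix a c a'
    have "?f a a' c (x + int q) = ?f a a' c x" for x
      unfolding per1
      by (intro arg_cong2[where f = "(*)"] refl z_eqI[where y = "s * a'"]) (simp add: algebra_simps)
    from sum_periodic_shift[of "?f a a' c", OF this, of c]
    show "(\<Sum>c'\<in>Q. z (s * (a * c) + s * (a' * c')) * \<Phi> (c + c') a' c a) = (\<Sum>C\<in>Q. ?f a a' c C)"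
      by (simp add: algebra_simps)
  qed
  also have "\<dots> = (\<Sum>a\<in>Q. \<Sum>a'\<in>Q. \<Sum>c\<in>Q. \<Sum>C\<in>Q. ?f a a' c C)"
    by (intro sum.cong refl sum.swap)
  also have "\<dots> = (\<Sum>a'\<in>Q. \<Sum>a\<in>Q. \<Sum>c\<in>Q. \<Sum>C\<in>Q. ?f a a' c C)"
    by (rule sum.swap)
  also have "\<dots> = (\<Sum>a'\<in>Q. \<Sum>a\<in>Q. \<Sum>C\<in>Q. \<Sum>c\<in>Q. ?f a a' c C)"
    by (intro sum.cong refl sum.swap)
  also have "\<dots> = (\<Sum>a'\<in>Q. \<Sum>C\<in>Q. \<Sum>a\<in>Q. \<Sum>c\<in>Q. ?f a a' c C)"
    by (intro sum.cong refl sum.swap)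
  also have "\<dots> = (\<Sum>a'\<in>Q. \<Sum>C\<in>Q. \<Sum>c\<in>Q. \<Sum>a\<in>Q. ?f a a' c C)"
    by (intro sum.cong refl sum.swap)
  also have "\<dots> = (\<Sum>a'\<in>Q. \<Sum>C\<in>Q. \<Sum>c\<in>Q. \<Sum>a\<in>Q. z (s * (a' * C) + s * (a * c)) * \<Phi> C a' c (a' + a))"
  proof (rule sum.cong[OF refl], rule sum.cong[OF refl], rule sum.cong[OF refl])
    fix a' C c
    have "?f (x + int q) a' c C = ?f x a' c C" for x
      unfolding per2
      by (intro arg_cong2[where f = "(*)"] refl z_eqI[where y = "s * c"]) (simp add: algebra_simps)
    from sum_periodic_shift[of "\<lambda>a. ?f a a' c C", OF this, of a']
    show "(\<Sum>a\<in>Q. ?f a a' c C) = (\<Sum>a\<in>Q. z (s * (a' * C) + s * (a * c)) * \<Phi> C a' c (a' + a))"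
      by (simp add: algebra_simps)
  qed
  also have "\<dots> = (\<Sum>a'\<in>Q. \<Sum>C\<in>Q. \<Sum>a\<in>Q. \<Sum>c\<in>Q. z (s * (a' * C) + s * (a * c)) * \<Phi> C a' c (a' + a))"
    by (intro sum.cong refl sum.swap)
  also have "\<dots> / ?K = J s (\<lambda>a c. J s (\<lambda>a' c'. \<Phi> c a c' (a + a')))"
    by (simp add: J_def sum_distrib_left sum_divide_distrib z_add mult.assoc)
  finally show ?thesis .
qed

lemma J_neg_both:
  assumes per1: "\<And>x c. \<Phi> (x + int q) c = \<Phi> x c" and per2: "\<And>x c. \<Phi> c (x + int q) = \<Phi> c x"
  shows "J s (\<lambda>a c. \<Phi> (- a) (- c)) = J s \<Phi>"
proof -
  have "J s (\<lambda>a c. \<Phi> (- a) (- c)) = J (- s) (\<lambda>a c. \<Phi> a (- c))"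
    by (rule J_neg_left[of "\<lambda>a c. \<Phi> a (- c)"]) (rule per1)
  also have "\<dots> = J s \<Phi>" by (subst J_neg_right[of \<Phi>, OF per2]) simp
  finally show ?thesis .
qed

text \<open>When one exponent of the second kernel is reversed, two kernels of equal sign are
  inverse to each other.\<close>

lemma J_cancel_opp:
  assumes s: "s = 1 \<or> s = - 1"
    and per1: "\<And>x c. \<Phi> (x + int q) c = \<Phi> x c"
    and per2: "\<And>x c. \<Phi> c (x + int q) = \<Phi> c x"
  shows "J s (\<lambda>a c. J s (\<lambda>b d. \<Phi> (a + b) (d - c))) = \<Phi> 0 0"
    and "J s (\<lambda>a c. J s (\<lambda>b d. \<Phi> (b - a) (c + d))) = \<Phi> 0 0"
proof -
  have p1: "x = y + int q * m \<Longrightarrow> \<Phi> x c = \<Phi> y c" for x y m c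
    by (rule periodic_eqI[of "\<lambda>x. \<Phi> x c"]) (rule per1)
  have p2: "x = y + int q * m \<Longrightarrow> \<Phi> c x = \<Phi> c y" for x y m c
    by (rule periodic_eqI[of "\<Phi> c"]) (rule per2)
  have "J s (\<lambda>b d. \<Phi> (a + b) (- (c + - d))) = J (- s) (\<lambda>b d. \<Phi> (a + b) (- (c + d)))" for a c
    by (rule J_neg_right[of "\<lambda>b d. \<Phi> (a + b) (- (c + d))"])
       (rule p2[where m = "-1"], simp)
  moreover have "J s (\<lambda>a c. J (- s) (\<lambda>b d. \<Phi> (a + b) (- (c + d)))) = \<Phi> 0 (- 0)"
    by (rule J_cancel[OF s, of "\<lambda>A C. \<Phi> A (- C)"])
       (rule per1, rule p2[where m = "-1"], simp)
  ultimately show "J s (\<lambda>a c. J s (\<lambda>b d. \<Phi> (a + b) (d - c))) = \<Phi> 0 0" by simp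
  have "J s (\<lambda>b d. \<Phi> (- (a + - b)) (c + d)) = J (- s) (\<lambda>b d. \<Phi> (- (a + b)) (c + d))" for a c
    by (rule J_neg_left[of "\<lambda>b d. \<Phi> (- (a + b)) (c + d)"])
       (rule p1[where m = "-1"], simp)
  moreover have "J s (\<lambda>a c. J (- s) (\<lambda>b d. \<Phi> (- (a + b)) (c + d))) = \<Phi> (- 0) 0"
    by (rule J_cancel[OF s, of "\<lambda>A C. \<Phi> (- A) C"])
       (rule p1[where m = "-1"], simp, rule per2)
  ultimately show "J s (\<lambda>a c. J s (\<lambda>b d. \<Phi> (b - a) (c + d))) = \<Phi> 0 0" by simp
qed

lemma J_cancel_diff:
  assumes s: "s = 1 \<or> s = - 1"
    and per1: "\<And>x c. \<Phi> (x + int q) c = \<Phi> x c"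
    and per2: "\<And>x c. \<Phi> c (x + int q) = \<Phi> c x"
  shows "J s (\<lambda>a c. J (- s) (\<lambda>b d. \<Phi> (a - b) (d - c))) = \<Phi> 0 0"
proof -
  have p1: "x = y + int q * m \<Longrightarrow> \<Phi> x c = \<Phi> y c" for x y m c
    by (rule periodic_eqI[of "\<lambda>x. \<Phi> x c"]) (rule per1)
  have p2: "x = y + int q * m \<Longrightarrow> \<Phi> c x = \<Phi> c y" for x y m c
    by (rule periodic_eqI[of "\<Phi> c"]) (rule per2)
  have "J (- s) (\<lambda>b d. \<Phi> (a + - b) (- (c + - d))) = J (- s) (\<lambda>b d. \<Phi> (a + b) (- (c + d)))" for a c
    by (rule J_neg_both[of "\<lambda>b d. \<Phi> (a + b) (- (c + d))"])
       (rule p1[where m = 1], simp, rule p2[where m = "-1"], simp)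
  moreover have "J s (\<lambda>a c. J (- s) (\<lambda>b d. \<Phi> (a + b) (- (c + d)))) = \<Phi> 0 (- 0)"
    by (rule J_cancel[OF s, of "\<lambda>A C. \<Phi> A (- C)"])
       (rule per1, rule p2[where m = "-1"], simp)
  ultimately show ?thesis by simp
qed

text \<open>The four sign patterns met when the separability element is shown to be central. Each
  becomes \<open>J_fuse\<close> or \<open>J_fuse'\<close> after reversing exponents.\<close>

lemma J_fuse_variants:
  assumes s: "s = 1 \<or> s = - 1"
    and per1: "\<And>x c d. \<Phi> (x + int q) c d = \<Phi> x c d"
    and per2: "\<And>x c d. \<Phi> c (x + int q) d = \<Phi> c x d"
    and per3: "\<And>x c d. \<Phi> c d (x + int q) = \<Phi> c d x"
  shows "J s (\<lambda>a c. J s (\<lambda>b d. \<Phi> (c - d) (- a - b) (- d))) = J s (\<lambda>A D. \<Phi> 0 A D)"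
    and "J s (\<lambda>b d. J (- s) (\<lambda>a c. \<Phi> (d - c) (a - b) (- c))) = J s (\<lambda>A D. \<Phi> 0 A D)"
    and "J s (\<lambda>a c. J s (\<lambda>b d. \<Phi> a (c - d) (- b))) = J s (\<lambda>A D. \<Phi> A D A)"
    and "J s (\<lambda>b d. J (- s) (\<lambda>a c. \<Phi> b (d - c) a)) = J s (\<lambda>A D. \<Phi> A D A)"
proof -
  have p1: "x = y + int q * m \<Longrightarrow> \<Phi> x c d = \<Phi> y c d" for x y m c d
    by (rule periodic_eqI[of "\<lambda>x. \<Phi> x c d"]) (rule per1)
  have p2: "x = y + int q * m \<Longrightarrow> \<Phi> c x d = \<Phi> c y d" for x y m c d
    by (rule periodic_eqI[of "\<lambda>x. \<Phi> c x d"]) (rule per2)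
  have p3: "x = y + int q * m \<Longrightarrow> \<Phi> c d x = \<Phi> c d y" for x y m c d
    by (rule periodic_eqI[of "\<Phi> c d"]) (rule per3)
  have fuse: "J s (\<lambda>a c. J (- s) (\<lambda>b d. \<Phi> (c + d) (- (a + b)) d)) = J s (\<lambda>A D. \<Phi> 0 A D)" if s: "s = 1 \<or> s = - 1" for s
  proof -
    have "J s (\<lambda>a c. J (- s) (\<lambda>b d. \<Phi> (c + d) (- (a + b)) d)) = J (- s) (\<lambda>A D. \<Phi> 0 (- A) D)"
      by (rule J_fuse[OF s, of "\<lambda>A C D. \<Phi> C (- A) D"]) (rule p2[where m = "-1"], simp, rule per1)
    also have "\<dots> = J s (\<lambda>A D. \<Phi> 0 A D)"
      by (subst J_neg_left[of "\<lambda>A D. \<Phi> 0 A D"]) (rule per2, simp)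
    finally show ?thesis .
  qed
  have "J s (\<lambda>b d. \<Phi> (c + - d) (- (a + b)) (- d)) = J (- s) (\<lambda>b d. \<Phi> (c + d) (- (a + b)) d)" for a c
    by (rule J_neg_right[of "\<lambda>b d. \<Phi> (c + d) (- (a + b)) d"]) (simp add: per1 per3 add.assoc[symmetric])
  with fuse[OF s] show "J s (\<lambda>a c. J s (\<lambda>b d. \<Phi> (c - d) (- a - b) (- d))) = J s (\<lambda>A D. \<Phi> 0 A D)"
    by simp
  have "J (- s) (\<lambda>a c. \<Phi> (d + - c) (- (b + - a)) (- c)) = J (- s) (\<lambda>a c. \<Phi> (d + c) (- (b + a)) c)" for b d
    by (rule J_neg_both[of "\<lambda>a c. \<Phi> (d + c) (- (b + a)) c"])
       (rule p2[where m = "-1"], simp, simp add: per1 per3 add.assoc[symmetric])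
  with fuse[OF s] show "J s (\<lambda>b d. J (- s) (\<lambda>a c. \<Phi> (d - c) (a - b) (- c))) = J s (\<lambda>A D. \<Phi> 0 A D)"
    by simp
  have fuse': "J s (\<lambda>a c. J (- s) (\<lambda>b d. \<Phi> ((a + b) - b) (c + d) (- b))) = J s (\<lambda>A D. \<Phi> A D A)"
  proof -
    have "J s (\<lambda>a c. J (- s) (\<lambda>b d. \<Phi> ((a + b) - b) (c + d) (- b))) = J (- s) (\<lambda>B C. \<Phi> (0 - B) C (- B))"
      by (rule J_fuse'[OF s, of "\<lambda>A C b. \<Phi> (A - b) C (- b)"]) (simp add: per1 diff_add_eq[symmetric], rule per2)
    also have "\<dots> = J s (\<lambda>A D. \<Phi> A D A)"
      using J_neg_left[of "\<lambda>A D. \<Phi> A D A" "- s"] by (simp add: per1 per3)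
    finally show ?thesis .
  qed
  have "J s (\<lambda>b d. \<Phi> a (c + - d) (- b)) = J (- s) (\<lambda>b d. \<Phi> a (c + d) (- b))" for a c
    by (rule J_neg_right[of "\<lambda>b d. \<Phi> a (c + d) (- b)"]) (simp add: per2 add.assoc[symmetric])
  with fuse' show "J s (\<lambda>a c. J s (\<lambda>b d. \<Phi> a (c - d) (- b))) = J s (\<lambda>A D. \<Phi> A D A)" by simp
  have "J (- s) (\<lambda>a c. \<Phi> b (d + - c) (- (- a))) = J (- s) (\<lambda>a c. \<Phi> b (d + c) (- a))" for b d
    by (rule J_neg_both[of "\<lambda>a c. \<Phi> b (d + c) (- a)"])
       (rule p3[where m = "-1"], simp, simp add: per2 add.assoc[symmetric])
  with fuse' show "J s (\<lambda>b d. J (- s) (\<lambda>a c. \<Phi> b (d - c) a)) = J s (\<lambda>A D. \<Phi> A D A)" by simp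
qed

text \<open>Fourier inversion: the factor \<open>z (k * B)\<close> is absorbed by replacing
  \<open>C\<close> with \<open>C - k\<close>, and the sum over \<open>B\<close> then leaves only
  \<open>C = 0\<close>.\<close>

lemma J_shift:
  assumes per: "\<And>x. F (x + int q) = F x"
  shows "J 1 (\<lambda>B C. z (k * B) * F C) = F (- k)"
proof -
  have "(\<Sum>C\<in>Q. z (B * C) * (z (k * B) * F C)) = (\<Sum>C\<in>Q. z (B * C) * F (C - k))" for B
  proof -
    define G where "G C = z (1 * (B * C)) * F (C - k)" for C
    have "G (x + int q) = G x" for x
    proof -
      have "F (x + int q - k) = F (x - k)" using per[of "x - k"] by (simp add: algebra_simps)
      then show ?thesis unfolding G_def z_periodic by simp
    qed
    from sum_periodic_shift[of G, OF this, of k] show ?thesis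
      by (simp add: G_def ring_distribs z_add mult.assoc mult.commute[of k])
  qed
  then have "J 1 (\<lambda>B C. z (k * B) * F C) = J 1 (\<lambda>B C. F (C - k))" by (simp add: J_def)
  also have "\<dots> = F (0 - k)" by (rule J_const_left) simp
  finally show ?thesis by simp
qed

end

section \<open>The twisted function algebra\<close>

locale twisted = group G + fourier q z
  for G :: "nat monoid" (structure) and q :: nat and z :: "int \<Rightarrow> 'k::field_char_0" +
  fixes n :: nat and w :: "int \<Rightarrow> int \<Rightarrow> nat"
  assumes carrier_eq: "carrier G = {..<n}"
    and w_closed [simp]: "\<And>c a. w c a \<in> carrier G"
    and w_mult: "\<And>c a c' a'. w c a \<otimes> w c' a' = w (c + c') (a + a')"
    and w_periodic1 [simp]: "\<And>c a. w (c + int q) a = w c a"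
    and w_periodic2 [simp]: "\<And>c a. w c (a + int q) = w c a"
begin

section \<open>Calculus in the subgroup generated by the two commuting elements\<close>

lemma less_n: "x < n \<longleftrightarrow> x \<in> carrier G"
  by (simp add: carrier_eq)

lemma w_0 [simp]: "w 0 0 = \<one>"
  using w_mult[of 0 0 0 0] l_cancel_one[of "w 0 0" "w 0 0"] by simp

lemma inv_w: "inv (w c a) = w (- c) (- a)"
  by (rule inv_equality) (simp_all add: w_mult)

lemma w_mult_left: "x \<in> carrier G \<Longrightarrow> w c a \<otimes> (w c' a' \<otimes> x) = w (c + c') (a + a') \<otimes> x"
  by (simp add: m_assoc[symmetric] w_mult)

lemma w_eqI1: "x = y + int q * m \<Longrightarrow> w x a = w y a"
  by (rule periodic_eqI[of "\<lambda>x. w x a" "int q" x y m]) simp_all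

lemma w_eqI2: "x = y + int q * m \<Longrightarrow> w a x = w a y"
  by (rule periodic_eqI[of "w a" "int q" x y m]) simp_all

text \<open>The shapes into which simplification rearranges exponents; they discharge the
  periodicity premises of the kernel rules.\<close>

lemma w_periodic1' [simp]: "w (c + (int q + b)) a = w (c + b) a" "w (int q + b) a = w b a" "w (c - int q) a = w c a"
  "w (c - (int q + b)) a = w (c - b) a" "w (c + int q + b) a = w (c + b) a" "w (c + int q - b) a = w (c - b) a"
  "w (c - (b + int q)) a = w (c - b) a" "w (c + (b + int q)) a = w (c + b) a"
  by (rule w_eqI1[where m = 1] w_eqI1[where m = "-1"], simp; fail)+

lemma w_periodic2' [simp]: "w a (c + (int q + b)) = w a (c + b)" "w a (int q + b) = w a b" "w a (c - int q) = w a c"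
  "w a (c - (int q + b)) = w a (c - b)" "w a (c + int q + b) = w a (c + b)" "w a (c + int q - b) = w a (c - b)"
  "w a (c - (b + int q)) = w a (c - b)" "w a (c + (b + int q)) = w a (c + b)"
  by (rule w_eqI2[where m = 1] w_eqI2[where m = "-1"], simp; fail)+

lemmas w_simps = m_assoc w_mult w_mult_left inv_w inv_mult_group

text \<open>With \<open>s = w 1 0\<close> and \<open>t = w 0 1\<close>, \<open>tw \<Phi> x\<close> is the value of the bilinear extension of \<open>\<Phi>\<close> at the
  twisted coproduct of \<open>x\<close>; the two nested kernels come from the twist and its inverse.\<close>

definition tw :: "(nat \<Rightarrow> nat \<Rightarrow> 'k) \<Rightarrow> nat \<Rightarrow> 'k" where
  "tw \<Phi> x = J (- 1) (\<lambda>a c. J 1 (\<lambda>b d. \<Phi> (w c 0 \<otimes> x \<otimes> w d 0) (w 0 a \<otimes> x \<otimes> w 0 b)))"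

lemma tw_mult: "tw (\<lambda>u v. k * \<Phi> u v) x = k * tw \<Phi> x"
  by (simp add: tw_def J_mult)

lemma tw_mult_right: "tw (\<lambda>u v. \<Phi> u v * k) x = tw \<Phi> x * k"
  using tw_mult[of k \<Phi> x] by (simp add: mult.commute)

lemma tw_sum: "tw (\<lambda>u v. \<Sum>i\<in>I. \<Phi> i u v) x = (\<Sum>i\<in>I. tw (\<Phi> i) x)"
  by (simp add: tw_def J_sum)

lemma tw_cong:
  assumes "x \<in> carrier G" "\<And>u v. u \<in> carrier G \<Longrightarrow> v \<in> carrier G \<Longrightarrow> \<Phi> u v = \<Psi> u v"
  shows "tw \<Phi> x = tw \<Psi> x"
  using assms by (simp add: tw_def)

definition mu :: "nat \<Rightarrow> nat \<Rightarrow> nat \<Rightarrow> 'k" where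
  "mu i j = tw (\<lambda>u v. delta i u * delta j v)"

text \<open>Contractions with structure constants become values of \<open>tw\<close>, so that the
  axioms can be checked on arbitrary functions instead of indices.\<close>

lemma sum_mu_left:
  assumes "x < n"
  shows "(\<Sum>i<n. F i * mu i j x) = tw (\<lambda>u v. F u * delta j v) x"
proof -
  have "(\<Sum>i<n. F i * mu i j x) = tw (\<lambda>u v. \<Sum>i<n. F i * (delta i u * delta j v)) x"
    by (simp only: mu_def tw_sum tw_mult)
  also have "\<dots> = tw (\<lambda>u v. F u * delta j v) x"
    using assms by (intro tw_cong) (simp_all add: less_n mult.assoc[symmetric] sum_distrib_right[symmetric])
  finally show ?thesis .
qed

lemma sum_mu_right:
  assumes "x < n"
  shows "(\<Sum>j<n. F j * mu i j x) = tw (\<lambda>u v. delta i u * F v) x"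
proof -
  have "(\<Sum>j<n. F j * mu i j x) = tw (\<lambda>u v. \<Sum>j<n. F j * (delta i u * delta j v)) x"
    by (simp only: mu_def tw_sum tw_mult)
  also have "\<dots> = tw (\<lambda>u v. delta i u * F v) x"
    using assms by (intro tw_cong) (simp_all add: less_n mult.left_commute[of _ "delta i _"] sum_distrib_left[symmetric])
  finally show ?thesis .
qed

lemma sum_mu:
  assumes "x < n"
  shows "(\<Sum>i<n. \<Sum>j<n. \<Phi> i j * mu i j x) = tw \<Phi> x"
proof -
  have "(\<Sum>i<n. \<Sum>j<n. \<Phi> i j * mu i j x) = (\<Sum>i<n. tw (\<lambda>u v. \<Phi> i v * delta i u) x)"
    using assms by (simp add: sum_mu_right mult.commute)
  also have "\<dots> = tw (\<lambda>u v. \<Sum>i<n. \<Phi> i v * delta i u) x" by (simp only: tw_sum)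
  also have "\<dots> = tw \<Phi> x" using assms by (intro tw_cong) (simp_all add: less_n)
  finally show ?thesis .
qed

text \<open>Coassociativity of the twisted coproduct: the cocycle identity is used once for the
  twist on the right of \<open>t\<close> and once for its inverse on the left.\<close>

lemma tw_assoc:
  assumes t: "t \<in> carrier G"
  shows "tw (\<lambda>u v. tw (\<lambda>x y. \<Psi> x y v) u) t = tw (\<lambda>u v. tw (\<lambda>x y. \<Psi> u x y) v) t"
proof -
  \<comment> \<open>Every exponent gets its own argument, so that \<open>J_assoc\<close> can be
    instantiated for one twist at a time.\<close>
  define X where "X C D A' c B' d A B = \<Psi> (w C 0 \<otimes> t \<otimes> w D 0) (w c A' \<otimes> t \<otimes> w d B') (w 0 A \<otimes> t \<otimes> w 0 B)"
    for C D A' c B' d A B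
  define Y where "Y C A' c A = J 1 (\<lambda>b d. J 1 (\<lambda>b' d'. X C (d + d') A' c b' d A b))" for C A' c A
  have Y': "Y C A' c A = J 1 (\<lambda>b d. J 1 (\<lambda>b' d'. X C d A' c b d' A (b + b')))" for C A' c A
    unfolding Y_def
    by (rule J_assoc[of "\<lambda>D B' d B. X C D A' c B' d A B"]) (simp_all add: X_def)
  have "tw (\<lambda>u v. tw (\<lambda>x y. \<Psi> x y v) u) t
    = J (- 1) (\<lambda>a c. J 1 (\<lambda>b d. J (- 1) (\<lambda>a' c'. J 1 (\<lambda>b' d'. X (c + c') (d + d') a' c b' d a b))))"
    using t by (simp add: tw_def X_def w_simps add.commute)
  also have "\<dots> = J (- 1) (\<lambda>a c. J (- 1) (\<lambda>a' c'. Y (c + c') a' c a))"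
    by (subst J_commute) (simp add: Y_def)
  also have "\<dots> = J (- 1) (\<lambda>a c. J (- 1) (\<lambda>a' c'. Y c a c' (a + a')))"
    by (rule J_assoc) (simp_all add: Y_def X_def)
  also have "\<dots> = J (- 1) (\<lambda>a c. J 1 (\<lambda>b d. J (- 1) (\<lambda>a' c'. J 1 (\<lambda>b' d'. X c d a c' b d' (a + a') (b + b')))))"
    unfolding Y' by (subst J_commute) (rule refl)
  also have "\<dots> = tw (\<lambda>u v. tw (\<lambda>x y. \<Psi> u x y) v) t"
    using t by (simp add: tw_def X_def w_simps add.commute)
  finally show ?thesis .
qed

text \<open>Between \<open>x\<close> and \<open>y\<close> the right twist of one coproduct meets the
  left inverse twist of the other, and they cancel.\<close>

lemma tw_comult:
  assumes x: "x \<in> carrier G" and y: "y \<in> carrier G"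
  shows "tw (\<lambda>a c. tw (\<lambda>b f. \<Psi> (a \<otimes> b) (c \<otimes> f)) y) x = tw \<Psi> (x \<otimes> y)"
proof -
  define X where "X a c B D = J 1 (\<lambda>b' d'. \<Psi> (w c 0 \<otimes> x \<otimes> w D 0 \<otimes> y \<otimes> w d' 0) (w 0 a \<otimes> x \<otimes> w 0 B \<otimes> y \<otimes> w 0 b'))"
    for a c B D
  have "tw (\<lambda>a c. tw (\<lambda>b f. \<Psi> (a \<otimes> b) (c \<otimes> f)) y) x
    = J (- 1) (\<lambda>a c. J 1 (\<lambda>b d. J (- 1) (\<lambda>a' c'. X a c (b + a') (d + c'))))"
    using x y by (simp add: tw_def X_def w_simps)
  also have "\<dots> = J (- 1) (\<lambda>a c. X a c 0 0)"
    by (subst J_cancel[of 1 "X _ _"]) (simp_all add: X_def)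
  also have "\<dots> = tw \<Psi> (x \<otimes> y)"
    using x y by (simp add: tw_def X_def m_assoc)
  finally show ?thesis .
qed

lemma tw_one: "tw \<Phi> \<one> = \<Phi> \<one> \<one>"
proof -
  have "tw \<Phi> \<one> = J (- 1) (\<lambda>a c. J (- (- 1)) (\<lambda>b d. \<Phi> (w (c + d) 0) (w 0 (a + b))))"
    by (simp add: tw_def w_simps)
  also have "\<dots> = \<Phi> \<one> \<one>"
    by (subst J_cancel[of "- 1" "\<lambda>A C. \<Phi> (w C 0) (w 0 A)"]) simp_all
  finally show ?thesis .
qed

lemma tw_fst: "x \<in> carrier G \<Longrightarrow> tw (\<lambda>u v. F u) x = F x"
  by (simp add: tw_def J_const_left[of _ "\<lambda>d. F (_ \<otimes> w d 0)"] J_const_left[of _ "\<lambda>c. F (w c 0 \<otimes> _)"])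

lemma tw_snd: "x \<in> carrier G \<Longrightarrow> tw (\<lambda>u v. F v) x = F x"
  by (simp add: tw_def J_const_right[of _ "\<lambda>d. F (_ \<otimes> w 0 d)"] J_const_right[of _ "\<lambda>c. F (w 0 c \<otimes> _)"])

text \<open>Evaluation at the twisted antipode \<open>v^-1 x^-1 v\<close> with
  \<open>v = m(S (x) id)(J)\<close>; the first kernel gives \<open>v^-1\<close>, the second gives
  \<open>v\<close>.\<close>

definition sap :: "(nat \<Rightarrow> 'k) \<Rightarrow> nat \<Rightarrow> 'k" where
  "sap f x = J (- 1) (\<lambda>a c. J (- 1) (\<lambda>b d. f (w c (- a) \<otimes> inv x \<otimes> w d b)))"

lemma sum_sap:
  assumes "x < n"
  shows "(\<Sum>i<n. F i * sap (delta i) x) = sap F x"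
proof -
  have "(\<Sum>i<n. F i * sap (delta i) x)
      = J (- 1) (\<lambda>a c. J (- 1) (\<lambda>b d. \<Sum>i<n. F i * delta i (w c (- a) \<otimes> inv x \<otimes> w d b)))"
    by (simp only: sap_def J_sum J_mult)
  also have "\<dots> = sap F x" using assms by (simp add: sap_def less_n)
  finally show ?thesis .
qed

text \<open>The inverse twist cancels against \<open>v\<close>; then \<open>inv t\<close> meets
  \<open>t\<close>, and the remaining twist cancels against \<open>v^-1\<close>.\<close>

lemma tw_sap_left:
  assumes t: "t \<in> carrier G"
  shows "tw (\<lambda>u v. sap (\<lambda>x. f (x \<otimes> v)) u) t = f \<one>"
proof -
  define X where "X a' c' b d B D = f (w (c' - d) (- a') \<otimes> inv t \<otimes> w D B \<otimes> t \<otimes> w 0 b)" for a' c' b d B D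
  have "tw (\<lambda>u v. sap (\<lambda>x. f (x \<otimes> v)) u) t
    = J (- 1) (\<lambda>a c. J 1 (\<lambda>b d. J (- 1) (\<lambda>a' c'. J (- 1) (\<lambda>b' d'. X a' c' b d (a + b') (d' - c)))))"
    using t by (simp add: tw_def sap_def X_def w_simps algebra_simps)
  also have "\<dots> = J 1 (\<lambda>b d. J (- 1) (\<lambda>a c. J (- 1) (\<lambda>a' c'. J (- 1) (\<lambda>b' d'. X a' c' b d (a + b') (d' - c)))))"
    by (rule J_commute)
  also have "\<dots> = J 1 (\<lambda>b d. J (- 1) (\<lambda>a' c'. J (- 1) (\<lambda>a c. J (- 1) (\<lambda>b' d'. X a' c' b d (a + b') (d' - c)))))"
    by (subst J_commute) (rule refl)
  also have "\<dots> = J 1 (\<lambda>b d. J (- 1) (\<lambda>a' c'. X a' c' b d 0 0))"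
    by (subst J_cancel_opp(1)[of "- 1" "X _ _ _ _"]) (simp_all add: X_def)
  also have "\<dots> = J 1 (\<lambda>b d. J (- 1) (\<lambda>a' c'. f (w (c' - d) (b - a'))))"
    using t by (simp add: X_def m_assoc[symmetric], simp add: w_simps)
  also have "\<dots> = f \<one>"
    by (subst J_cancel_diff[of 1 "\<lambda>A C. f (w C A)"]) simp_all
  finally show ?thesis .
qed

lemma tw_sap_right:
  assumes t: "t \<in> carrier G"
  shows "tw (\<lambda>u v. sap (\<lambda>x. f (u \<otimes> x)) v) t = f \<one>"
proof -
  define X where "X a c B D = J (- 1) (\<lambda>b' d'. f (w c 0 \<otimes> t \<otimes> w D (- B) \<otimes> inv t \<otimes> w d' (b' - a)))" for a c B D
  have "tw (\<lambda>u v. sap (\<lambda>x. f (u \<otimes> x)) v) t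
    = J (- 1) (\<lambda>a c. J 1 (\<lambda>b d. J (- 1) (\<lambda>a' c'. X a c (b + a') (d + c'))))"
    using t by (simp add: tw_def sap_def X_def w_simps algebra_simps)
  also have "\<dots> = J (- 1) (\<lambda>a c. X a c 0 0)"
    by (subst J_cancel[of 1 "X _ _"]) (simp_all add: X_def)
  also have "\<dots> = J (- 1) (\<lambda>a c. J (- 1) (\<lambda>b' d'. f (w (c + d') (b' - a))))"
    using t by (simp add: X_def m_assoc, simp add: m_assoc[symmetric], simp add: w_simps)
  also have "\<dots> = f \<one>"
    by (subst J_cancel_opp(2)[of "- 1" "\<lambda>A C. f (w C A)"]) simp_all
  finally show ?thesis .
qed

text \<open>Written in the basis of delta functions on \<open>G\<close>: by duality the unit is the
  constant function 1, the counit is evaluation at the group unit, and the comultiplication is the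
  transposed group law.\<close>

definition TH :: "'k hopf" where
  "TH = \<lparr> hdim = n, hmult = mu, hunit = (\<lambda>i. 1), hcomult = (\<lambda>l i j. delta l (i \<otimes> j)),
     hcounit = (\<lambda>i. delta i \<one>), hantipode = (\<lambda>i. sap (delta i)) \<rparr>"

lemma TH_simps [simp]: "hdim TH = n" "hmult TH = mu" "hunit TH = (\<lambda>i. 1)"
  "hcomult TH = (\<lambda>l i j. delta l (i \<otimes> j))" "hcounit TH = (\<lambda>i. delta i \<one>)"
  "hantipode TH = (\<lambda>i. sap (delta i))"
  by (simp_all add: TH_def)

lemma delta_sym: "delta i j = (delta j i :: 'k)"
  by (simp add: delta_def)

section \<open>The Hopf algebra axioms\<close>

lemma mu_assoc:
  assumes "t < n"
  shows "(\<Sum>r<n. mu i j r * mu r l t) = (\<Sum>r<n. mu j l r * mu i r t)"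
proof -
  have "(\<Sum>r<n. mu i j r * mu r l t) = tw (\<lambda>u v. tw (\<lambda>x y. delta i x * delta j y * delta l v) u) t"
    using assms by (simp add: sum_mu_left[of t "mu i j"] tw_mult_right) (simp add: mu_def)
  also have "\<dots> = tw (\<lambda>u v. tw (\<lambda>x y. delta i u * delta j x * delta l y) v) t"
    using assms by (simp add: tw_assoc less_n)
  also have "\<dots> = (\<Sum>r<n. mu j l r * mu i r t)"
    using assms by (simp add: sum_mu_right[of t "mu j l"] tw_mult mult.assoc) (simp add: mu_def)
  finally show ?thesis .
qed

lemma mu_comult:
  assumes x: "x < n" and y: "y < n"
  shows "(\<Sum>a<n. \<Sum>b<n. \<Sum>c<n. \<Sum>f<n. delta i (a \<otimes> b) * delta j (c \<otimes> f) * mu a c x * mu b f y)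
    = mu i j (x \<otimes> y)"
proof -
  let ?g = "\<lambda>a b c f. delta i (a \<otimes> b) * delta j (c \<otimes> f) :: 'k"
  have "(\<Sum>a<n. \<Sum>b<n. \<Sum>c<n. \<Sum>f<n. ?g a b c f * mu a c x * mu b f y)
     = (\<Sum>a<n. \<Sum>c<n. \<Sum>b<n. \<Sum>f<n. ?g a b c f * mu a c x * mu b f y)"
    by (intro sum.cong refl sum.swap)
  also have "\<dots> = (\<Sum>a<n. \<Sum>c<n. (\<Sum>b<n. \<Sum>f<n. ?g a b c f * mu b f y) * mu a c x)"
    by (simp add: sum_distrib_left sum_distrib_right ac_simps)
  also have "\<dots> = tw (\<lambda>a c. tw (\<lambda>b f. ?g a b c f) y) x"
    using x y by (simp add: sum_mu)
  also have "\<dots> = mu i j (x \<otimes> y)"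
    using x y tw_comult[of x y "\<lambda>u v. delta i u * delta j v"] by (simp add: mu_def less_n)
  finally show ?thesis .
qed

lemma antipode_left:
  assumes t: "t < n"
  shows "(\<Sum>a<n. \<Sum>b<n. \<Sum>c<n. delta l (a \<otimes> b) * sap (delta a) c * mu c b t) = delta l \<one>"
proof -
  have "(\<Sum>a<n. \<Sum>b<n. \<Sum>c<n. delta l (a \<otimes> b) * sap (delta a) c * mu c b t)
     = (\<Sum>b<n. \<Sum>a<n. \<Sum>c<n. delta l (a \<otimes> b) * sap (delta a) c * mu c b t)" by (rule sum.swap)
  also have "\<dots> = (\<Sum>b<n. \<Sum>c<n. \<Sum>a<n. delta l (a \<otimes> b) * sap (delta a) c * mu c b t)"
    by (intro sum.cong refl sum.swap)
  also have "\<dots> = (\<Sum>c<n. \<Sum>b<n. \<Sum>a<n. delta l (a \<otimes> b) * sap (delta a) c * mu c b t)"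
    by (rule sum.swap)
  also have "\<dots> = (\<Sum>c<n. \<Sum>b<n. sap (\<lambda>x. delta l (x \<otimes> b)) c * mu c b t)"
    by (simp add: sum_distrib_right[symmetric] sum_sap[of _ "\<lambda>x. delta l (x \<otimes> _)"])
  also have "\<dots> = delta l \<one>" using t by (simp add: sum_mu tw_sap_left[of t "delta l"] less_n)
  finally show ?thesis .
qed

lemma antipode_right:
  assumes t: "t < n"
  shows "(\<Sum>a<n. \<Sum>b<n. \<Sum>c<n. delta l (a \<otimes> b) * sap (delta b) c * mu a c t) = delta l \<one>"
proof -
  have "(\<Sum>a<n. \<Sum>b<n. \<Sum>c<n. delta l (a \<otimes> b) * sap (delta b) c * mu a c t)
     = (\<Sum>a<n. \<Sum>c<n. \<Sum>b<n. delta l (a \<otimes> b) * sap (delta b) c * mu a c t)"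
    by (intro sum.cong refl sum.swap)
  also have "\<dots> = (\<Sum>a<n. \<Sum>c<n. sap (\<lambda>x. delta l (a \<otimes> x)) c * mu a c t)"
    by (simp add: sum_distrib_right[symmetric] sum_sap[of _ "\<lambda>x. delta l (_ \<otimes> x)"])
  also have "\<dots> = delta l \<one>" using t by (simp add: sum_mu tw_sap_right[of t "delta l"] less_n)
  finally show ?thesis .
qed

lemma hopf_algebra_TH: "hopf_algebra TH"
proof -
  have one: "\<one> < n" and mult: "x < n \<Longrightarrow> y < n \<Longrightarrow> x \<otimes> y < n" for x y by (simp_all add: less_n)
  have sum_one: "(\<Sum>r<n. delta r x) = (1::'k)" if "x \<in> carrier G" for x
    using that sum_delta_left'[of x "\<lambda>_. 1" n] by (simp add: less_n)
  show ?thesis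
    unfolding hopf_algebra_def Let_def TH_simps
    using one mult
    by (intro conjI allI impI)
       (simp_all add: mu_assoc mu_comult antipode_left antipode_right
         sum_mu_left[of _ "\<lambda>_. 1", simplified] sum_mu_right[of _ "\<lambda>_. 1", simplified]
         tw_fst tw_snd less_n m_assoc delta_sym, simp_all add: mu_def tw_one sum_one)
qed

section \<open>The separability idempotent\<close>

lemma delta_one_eq:
  assumes "p \<in> carrier G" "u \<in> carrier G" "r \<in> carrier G" "y \<in> carrier G" "t \<in> carrier G"
  shows "(delta \<one> (p \<otimes> u \<otimes> r \<otimes> inv y \<otimes> t) :: 'k) = delta u (inv p \<otimes> inv t \<otimes> y \<otimes> inv r)"
proof -
  have cancel: "x \<otimes> (inv x \<otimes> v) = v" "inv x \<otimes> (x \<otimes> v) = v" if "x \<in> carrier G" "v \<in> carrier G" for x v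
    using that by (simp_all add: m_assoc[symmetric])
  have "\<one> = p \<otimes> u \<otimes> r \<otimes> inv y \<otimes> t \<longleftrightarrow> u = inv p \<otimes> inv t \<otimes> y \<otimes> inv r"
  proof
    assume "\<one> = p \<otimes> u \<otimes> r \<otimes> inv y \<otimes> t"
    then have "inv p \<otimes> \<one> \<otimes> inv t \<otimes> y \<otimes> inv r = inv p \<otimes> (p \<otimes> u \<otimes> r \<otimes> inv y \<otimes> t) \<otimes> inv t \<otimes> y \<otimes> inv r"
      by simp
    also have "\<dots> = u" using assms by (simp add: m_assoc cancel)
    finally show "u = inv p \<otimes> inv t \<otimes> y \<otimes> inv r" using assms by simp
  next
    assume "u = inv p \<otimes> inv t \<otimes> y \<otimes> inv r"
    then show "\<one> = p \<otimes> u \<otimes> r \<otimes> inv y \<otimes> t"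
      using assms by (simp add: m_assoc cancel)
  qed
  then show ?thesis by (simp add: delta_def)
qed

text \<open>Centrality of \<open>T\<close>, the coefficient array of the separability idempotent.
  Both sides reduce to the sum, with kernels \<open>J 1\<close> over \<open>B, E\<close> and
  \<open>J (- 1)\<close> over \<open>A, D\<close>, of \<open>delta h (t^A y t^B)\<close> times
  \<open>delta u (s^D t^A y s^E t^B)\<close>.\<close>

lemma separability:
  assumes u: "u \<in> carrier G" and y: "y \<in> carrier G"
  defines "T \<equiv> \<lambda>x. sap (\<lambda>v. delta \<one> (x \<otimes> v))"
  shows "tw (\<lambda>a b. delta h a * T b y) u = tw (\<lambda>a b. T u a * delta h b) y"
proof -
  define Z where "Z p1 p2 r1 r2 e f = delta h (w p1 p2 \<otimes> y \<otimes> w r1 r2) * (delta u (w e p2 \<otimes> y \<otimes> w f r2) :: 'k)"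
    for p1 p2 r1 r2 e f
  define V where "V a b e p f r = delta h (w 0 a \<otimes> y \<otimes> w 0 b) * (delta u (w e p \<otimes> y \<otimes> w f r) :: 'k)" for a b e p f r
  \<comment> \<open>The delta at \<open>\<one>\<close> determines \<open>u\<close>; substituting its
    value expresses the other delta through \<open>y\<close> as well.\<close>
  have 1: "delta h (w c 0 \<otimes> u \<otimes> w d 0) * delta \<one> (w 0 a \<otimes> u \<otimes> w 0 b \<otimes> (w c' (- a') \<otimes> inv y \<otimes> w d' b'))
      = Z (c - d') (- a - b') (d - c') (a' - b) (- d') (- c')" for a b c d a' b' c' d'
  proof -
    have "delta \<one> (w 0 a \<otimes> u \<otimes> w 0 b \<otimes> (w c' (- a') \<otimes> inv y \<otimes> w d' b'))
      = (delta \<one> (w 0 a \<otimes> u \<otimes> w c' (b - a') \<otimes> inv y \<otimes> w d' b') :: 'k)"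
      using u y by (simp add: w_simps)
    also have "\<dots> = delta u (w (- d') (- a - b') \<otimes> y \<otimes> w (- c') (a' - b))"
      using u y by (simp add: delta_one_eq, simp add: w_simps)
    finally have *: "delta \<one> (w 0 a \<otimes> u \<otimes> w 0 b \<otimes> (w c' (- a') \<otimes> inv y \<otimes> w d' b'))
      = (delta u (w (- d') (- a - b') \<otimes> y \<otimes> w (- c') (a' - b)) :: 'k)" .
    have "w c 0 \<otimes> (w (- d') (- a - b') \<otimes> y \<otimes> w (- c') (a' - b)) \<otimes> w d 0
      = w (c - d') (- a - b') \<otimes> y \<otimes> w (d - c') (a' - b)"
      using y by (simp add: w_simps)
    then show ?thesis unfolding * Z_def
      by (cases "u = w (- d') (- a - b') \<otimes> y \<otimes> w (- c') (a' - b)") (simp_all add: delta_def)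
  qed
  have 2: "delta h (w 0 a \<otimes> y \<otimes> w 0 b) * delta \<one> (u \<otimes> (w c' (- a') \<otimes> inv (w c 0 \<otimes> y \<otimes> w d 0) \<otimes> w d' b'))
      = V a b (c - d') (- b') (d - c') a'" for a b c d a' b' c' d'
  proof -
    have "delta \<one> (u \<otimes> (w c' (- a') \<otimes> inv (w c 0 \<otimes> y \<otimes> w d 0) \<otimes> w d' b'))
      = (delta \<one> (\<one> \<otimes> u \<otimes> w (c' - d) (- a') \<otimes> inv y \<otimes> w (d' - c) b') :: 'k)"
      using u y by (simp add: w_simps)
    also have "\<dots> = delta u (w (c - d') (- b') \<otimes> y \<otimes> w (d - c') a')"
      using u y by (subst delta_one_eq) (simp_all add: w_simps)
    finally show ?thesis by (simp add: V_def)
  qed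
  have swap: "J (- 1) (\<lambda>a c. J 1 (\<lambda>b d. J (- 1) (\<lambda>a' c'. J (- 1) (\<lambda>b' d'. \<Phi> a c b d a' c' b' d'))))
     = J 1 (\<lambda>b d. J (- 1) (\<lambda>a' c'. J (- 1) (\<lambda>a c. J (- 1) (\<lambda>b' d'. \<Phi> a c b d a' c' b' d'))))"
    for \<Phi> :: "int \<Rightarrow> int \<Rightarrow> int \<Rightarrow> int \<Rightarrow> int \<Rightarrow> int \<Rightarrow> int \<Rightarrow> int \<Rightarrow> 'k"
  proof -
    have "J (- 1) (\<lambda>a c. J (- 1) (\<lambda>a' c'. J (- 1) (\<lambda>b' d'. \<Phi> a c b d a' c' b' d')))
      = J (- 1) (\<lambda>a' c'. J (- 1) (\<lambda>a c. J (- 1) (\<lambda>b' d'. \<Phi> a c b d a' c' b' d')))" for b d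
      by (rule J_commute)
    then show ?thesis
      by (simp only: J_commute[of "- 1" 1 "\<lambda>a c b d. J (- 1) (\<lambda>a' c'. J (- 1) (\<lambda>b' d'. \<Phi> a c b d a' c' b' d'))"])
  qed
  have "tw (\<lambda>a b. delta h a * T b y) u
    = J 1 (\<lambda>b d. J (- 1) (\<lambda>a' c'. J (- 1) (\<lambda>a c. J (- 1) (\<lambda>b' d'.
          Z (c - d') (- a - b') (d - c') (a' - b) (- d') (- c')))))"
    by (simp only: tw_def T_def sap_def J_mult[symmetric] 1 swap)
  also have "\<dots> = J 1 (\<lambda>b d. J (- 1) (\<lambda>a' c'. J (- 1) (\<lambda>A D. Z 0 A (d - c') (a' - b) D (- c'))))"
    by (subst J_fuse_variants(1)[of "- 1" "\<lambda>p1 p2 e. Z p1 p2 _ _ e _"]) (simp_all add: Z_def)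
  also have "\<dots> = J 1 (\<lambda>B E. J (- 1) (\<lambda>A D. Z 0 A 0 B D E))"
    by (rule J_fuse_variants(2)[of 1 "\<lambda>r1 r2 f. J (- 1) (\<lambda>A D. Z 0 A r1 r2 D f)"]) (simp_all add: Z_def)
  also have "\<dots> = J 1 (\<lambda>B E. J (- 1) (\<lambda>A D. V A B D A E B))"
    by (simp add: Z_def V_def)
  also have "\<dots> = J 1 (\<lambda>b d. J (- 1) (\<lambda>a' c'. J (- 1) (\<lambda>A D. V A b D A (d - c') a')))"
    by (rule J_fuse_variants(4)[of 1 "\<lambda>b f r. J (- 1) (\<lambda>A D. V A b D A f r)", symmetric]) (simp_all add: V_def)
  also have "\<dots> = J 1 (\<lambda>b d. J (- 1) (\<lambda>a' c'. J (- 1) (\<lambda>a c. J (- 1) (\<lambda>b' d'.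
          V a b (c - d') (- b') (d - c') a'))))"
    by (subst J_fuse_variants(3)[of "- 1" "\<lambda>a e p. V a _ e p _ _"]) (simp_all add: V_def)
  also have "\<dots> = tw (\<lambda>a b. delta h b * T u a) y"
    by (simp only: tw_def T_def sap_def J_mult[symmetric] 2 swap)
  finally show ?thesis by (simp add: mult.commute)
qed

lemma semisimple_TH: "semisimple TH"
proof (rule separable_imp_semisimple[OF hopf_algebra_TH, where T = "\<lambda>x. sap (\<lambda>v. delta \<one> (x \<otimes> v))"], unfold TH_simps)
  fix h u y assume "h < n" "u < n" "y < n"
  then show "(\<Sum>x<n. sap (\<lambda>v. delta \<one> (x \<otimes> v)) y * mu h x u) = (\<Sum>v<n. sap (\<lambda>v. delta \<one> (u \<otimes> v)) v * mu v h y)"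
    by (simp add: sum_mu_left[of y "sap _"] sum_mu_right[of u "\<lambda>x. sap (\<lambda>v. delta \<one> (x \<otimes> v)) y"] separability less_n)
next
  fix u assume "u < n"
  then show "(\<Sum>x<n. \<Sum>y<n. sap (\<lambda>v. delta \<one> (x \<otimes> v)) y * mu x y u) = 1"
    by (simp add: sum_mu tw_sap_right[of u "delta \<one>"] less_n) (simp add: delta_def)
qed

section \<open>Hopf subalgebras of the twisted function algebra\<close>

lemma hprod_TH: "x < n \<Longrightarrow> hprod TH f g x = tw (\<lambda>u v. f u * g v) x"
  by (simp add: hprod_def sum_mu[of x "\<lambda>u v. f u * g v"])

lemma heps_TH: "heps TH f = f \<one>"
  using one_closed by (simp add: heps_def less_n[symmetric])

lemma hDelta_TH: "hDelta TH f x y = (if x < n \<and> y < n then f (x \<otimes> y) else 0)"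
  using m_closed[of x y] by (simp add: hDelta_def less_n[symmetric])

definition translate :: "nat \<Rightarrow> nat \<Rightarrow> (nat \<Rightarrow> 'k) \<Rightarrow> nat \<Rightarrow> 'k" where
  "translate g h f = (\<lambda>x. if x < n then f (g \<otimes> x \<otimes> h) else 0)"

context
  fixes K assumes K: "hopf_subalgebra TH K"
begin

section \<open>Translation invariance and the pointwise product\<close>

lemma K_subspace: "hsubspace TH K"
  using K by (simp add: hopf_subalgebra_def)

lemma K_hvecs: "f \<in> K \<Longrightarrow> x \<ge> n \<Longrightarrow> f x = 0"
  using K_subspace by (auto simp: hsubspace_def hvecs_def)

lemma K_add: "f \<in> K \<Longrightarrow> g \<in> K \<Longrightarrow> (\<lambda>x. f x + g x) \<in> K"
  using K_subspace by (simp add: hsubspace_def)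

lemma K_scale: "f \<in> K \<Longrightarrow> (\<lambda>x. c * f x) \<in> K"
  using K_subspace by (simp add: hsubspace_def)

text \<open>The coproduct of \<open>f\<close> is the function \<open>f (x \<otimes> y)\<close>, and
  fixing one argument of a tensor in \<open>K (x) K\<close> leaves a combination of elements of
  \<open>K\<close>.\<close>

lemma K_translate:
  assumes f: "f \<in> K" and g: "g \<in> carrier G" and h: "h \<in> carrier G"
  shows "translate g h f \<in> K"
proof -
  have right: "translate \<one> h f \<in> K" if f: "f \<in> K" and h: "h \<in> carrier G" for f h
  proof -
    from K f obtain r a b where ab: "\<forall>t<r. a t \<in> K \<and> b t \<in> K"
      and D: "hDelta TH f = (\<lambda>x y. \<Sum>t<(r::nat). a t x * b t y)"
      by (auto simp: hopf_subalgebra_def in_tensor_def)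
    have "(\<lambda>x. \<Sum>t<r. b t h * a t x) \<in> K"
      by (rule hsubspace_lincomb[OF K_subspace]) (use ab in auto)
    moreover have "(\<lambda>x. \<Sum>t<r. b t h * a t x) = (\<lambda>x. hDelta TH f x h)"
      by (simp add: D mult.commute)
    moreover have "\<dots> = translate \<one> h f"
      using h by (auto simp: hDelta_TH translate_def less_n)
    ultimately show ?thesis by simp
  qed
  have left: "translate g \<one> f \<in> K" if f: "f \<in> K" and g: "g \<in> carrier G" for f g
  proof -
    from K f obtain r a b where ab: "\<forall>t<r. a t \<in> K \<and> b t \<in> K"
      and D: "hDelta TH f = (\<lambda>x y. \<Sum>t<(r::nat). a t x * b t y)"
      by (auto simp: hopf_subalgebra_def in_tensor_def)
    have "(\<lambda>x. \<Sum>t<r. a t g * b t x) \<in> K"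
      by (rule hsubspace_lincomb[OF K_subspace]) (use ab in auto)
    moreover have "(\<lambda>x. \<Sum>t<r. a t g * b t x) = hDelta TH f g"
      by (simp add: D)
    moreover have "\<dots> = translate g \<one> f"
      using g by (auto simp: hDelta_TH translate_def less_n)
    ultimately show ?thesis by simp
  qed
  have "translate g \<one> (translate \<one> h f) = translate g h f"
    using g h by (auto simp: translate_def less_n m_assoc)
  then show ?thesis using left[OF right[OF f h] g] by simp
qed

lemma K_J:
  assumes "\<And>a c. F a c \<in> K"
  shows "(\<lambda>x. J s (\<lambda>a c. F a c x)) \<in> K"
proof -
  have "(\<lambda>x. \<Sum>a\<in>Q. 1 * (\<Sum>c\<in>Q. (z (s * (a * c)) / of_nat q) * F a c x)) \<in> K"
    by (rule hsubspace_lincomb[OF K_subspace, where c = "\<lambda>_. 1"], simp,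
        rule hsubspace_lincomb[OF K_subspace, where c = "\<lambda>c. z (s * (_ * c)) / of_nat q"])
       (simp_all add: assms)
  then show ?thesis by (simp add: J_def sum_divide_distrib)
qed

text \<open>The untwisted product is recovered by twisting back, which only uses translations.\<close>

lemma K_pointwise_mult:
  assumes f: "f \<in> K" and g: "g \<in> K"
  shows "(\<lambda>x. f x * g x) \<in> K"
proof -
  \<comment> \<open>The signs are opposite to those in \<open>tw\<close>, so on each side of
    \<open>x\<close> a kernel meets its inverse.\<close>
  have "(\<lambda>x. J 1 (\<lambda>a c. J (- 1) (\<lambda>b d.
      hprod TH (translate (w c 0) (w d 0) f) (translate (w 0 a) (w 0 b) g) x))) \<in> K"
    (is "?F \<in> K")
    using K by (intro K_J) (simp add: hopf_subalgebra_def K_translate f g)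
  also have "?F = (\<lambda>x. f x * g x)"
  proof
    fix x
    show "?F x = f x * g x"
    proof (cases "x < n")
      case True
      then have x: "x \<in> carrier G" by (simp add: less_n)
      define X where "X A C B D = f (w C 0 \<otimes> x \<otimes> w D 0) * g (w 0 A \<otimes> x \<otimes> w 0 B)" for A B C D
      have "?F x = J 1 (\<lambda>a c. J (- 1) (\<lambda>b d. J (- 1) (\<lambda>a' c'. J 1 (\<lambda>b' d'.
          X (a + a') (c + c') (b + b') (d + d')))))"
        using x True
        by (simp add: hprod_TH) (simp add: tw_def translate_def less_n X_def w_simps add.commute)
      also have "\<dots> = J 1 (\<lambda>a c. J (- 1) (\<lambda>a' c'. J (- 1) (\<lambda>b d. J (- (- 1)) (\<lambda>b' d'.
          X (a + a') (c + c') (b + b') (d + d')))))"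
        by (subst J_commute) simp
      also have "\<dots> = J 1 (\<lambda>a c. J (- 1) (\<lambda>a' c'. X (a + a') (c + c') 0 0))"
        by (subst J_cancel[of "- 1" "X _ _"]) (simp_all add: X_def)
      also have "\<dots> = X 0 0 0 0"
        by (rule J_cancel[of 1 "\<lambda>A C. X A C 0 0"]) (simp_all add: X_def)
      finally show ?thesis using x by (simp add: X_def)
    next
      case False
      then show ?thesis using K_hvecs[OF f, of x] by (simp add: hprod_def J_def)
    qed
  qed
  finally show ?thesis .
qed

definition N where "N = {g \<in> carrier G. \<forall>f\<in>K. f g = f \<one>}"

section \<open>The normal subgroup attached to a Hopf subalgebra\<close>

lemma N_carrier: "g \<in> N \<Longrightarrow> g \<in> carrier G"
  by (simp add: N_def)

text \<open>The definition of \<open>N\<close> compares values only at \<open>g\<close> and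
  \<open>\<one>\<close>; applied to translates of \<open>f\<close> it gives invariance at every
  point.\<close>

lemma N_coset:
  assumes "f \<in> K" "g \<in> N" "x \<in> carrier G" "y \<in> carrier G"
  shows "f (x \<otimes> g \<otimes> y) = f (x \<otimes> y)"
proof -
  have "translate x y f g = translate x y f \<one>"
    using assms K_translate by (auto simp: N_def)
  then show ?thesis using assms by (simp add: translate_def less_n N_carrier)
qed

lemma N_mult: "g \<in> N \<Longrightarrow> h \<in> N \<Longrightarrow> g \<otimes> h \<in> N"
  using N_coset[of _ g \<one> h] unfolding N_def by (simp, metis)

lemma N_inv: "g \<in> N \<Longrightarrow> inv g \<in> N"
  using N_coset[of _ g "inv g" \<one>] unfolding N_def by (simp, metis)

lemma N_conj: "g \<in> N \<Longrightarrow> x \<in> carrier G \<Longrightarrow> x \<otimes> g \<otimes> inv x \<in> N"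
  using N_coset[of _ g x "inv x"] by (auto simp: N_def)

lemma N_commutator:
  assumes "g \<in> N" "x \<in> carrier G"
  shows "x \<otimes> g \<otimes> inv x \<otimes> inv g \<in> N" "g \<otimes> x \<otimes> inv g \<otimes> inv x \<in> N"
proof -
  show "x \<otimes> g \<otimes> inv x \<otimes> inv g \<in> N" using assms by (intro N_mult N_conj N_inv)
  have "g \<otimes> (x \<otimes> inv g \<otimes> inv x) \<in> N" using assms by (intro N_mult N_conj N_inv)
  then show "g \<otimes> x \<otimes> inv g \<otimes> inv x \<in> N" using assms by (simp add: m_assoc N_carrier)
qed

lemma N_eq_carrier:
  assumes "N = carrier G" shows "K = hscalars TH"
proof
  show "K \<subseteq> hscalars TH"
  proof
    fix f assume f: "f \<in> K"
    have "f x = f \<one> * hone TH x" for x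
      using f assms K_hvecs[OF f, of x] by (cases "x < n") (auto simp: hone_def N_def less_n)
    then show "f \<in> hscalars TH" unfolding hscalars_def by blast
  qed
  show "hscalars TH \<subseteq> K"
    using K by (auto simp: hscalars_def hopf_subalgebra_def hsubspace_def)
qed

text \<open>Functions in \<open>K\<close> separate \<open>\<one>\<close> from every other point.
  Their pointwise product, suitably normalised, is the delta function at \<open>\<one>\<close>, and
  its translates form the basis.\<close>

lemma N_trivial:
  assumes "N = {\<one>}" shows "K = hvecs TH"
proof
  show "K \<subseteq> hvecs TH" using K_subspace by (simp add: hsubspace_def)
  have oneK: "hone TH \<in> K" using K by (simp add: hopf_subalgebra_def)
  have sep: "\<exists>f\<in>K. f \<one> = 1 \<and> f g = 0" if g: "g \<in> carrier G" "g \<noteq> \<one>" for g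
  proof -
    obtain f where f: "f \<in> K" "f g \<noteq> f \<one>" using assms g by (auto simp: N_def)
    let ?f = "\<lambda>x. inverse (f \<one> - f g) * f x + (- (inverse (f \<one> - f g) * f g)) * hone TH x"
    have "?f \<in> K"
      by (intro K_add[of "\<lambda>x. _ * f x"] K_scale f(1) oneK)
    moreover have "?f \<one> = 1" "?f g = 0"
      using f g by (simp_all add: hone_def less_n right_diff_distrib[symmetric])
    ultimately show ?thesis by (intro bexI[of _ ?f] conjI)
  qed
  have "\<exists>f\<in>K. f \<one> = 1 \<and> (\<forall>g\<in>A. f g = 0)" if "finite A" "A \<subseteq> carrier G - {\<one>}" for A
    using that
  proof (induction A rule: finite_induct)
    case empty
    then show ?case using oneK by (intro bexI[of _ "hone TH"]) (auto simp: hone_def less_n)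
  next
    case (insert g A)
    then obtain f h where "f \<in> K" "f \<one> = 1" "\<forall>g\<in>A. f g = 0" "h \<in> K" "h \<one> = 1" "h g = 0"
      using sep[of g] by auto
    then show ?case
      by (intro bexI[of _ "\<lambda>x. f x * h x"]) (auto intro: K_pointwise_mult)
  qed
  from this[of "carrier G - {\<one>}"] obtain f where f: "f \<in> K" "f \<one> = 1" "\<And>g. g \<in> carrier G \<Longrightarrow> g \<noteq> \<one> \<Longrightarrow> f g = 0"
    by (auto simp: carrier_eq)
  have basis: "hbasis g \<in> K" if g: "g < n" for g
  proof -
    have "translate (inv g) \<one> f = hbasis g"
    proof
      fix x
      have "inv g \<otimes> x = \<one> \<longleftrightarrow> x = g" if "x < n"
        using that g by (metis less_n inv_closed inv_inv inv_equality inv_solve_left l_inv r_one)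
      then show "translate (inv g) \<one> f x = hbasis g x"
        using g f by (auto simp: translate_def hbasis_def delta_def less_n)
    qed
    then show ?thesis using K_translate[of f "inv g" \<one>] f g by (simp add: less_n)
  qed
  show "hvecs TH \<subseteq> K"
  proof
    fix v assume v: "v \<in> hvecs TH"
    have "(\<lambda>i. \<Sum>a<hdim TH. v a * hbasis a i) \<in> K"
      by (rule hsubspace_lincomb[OF K_subspace]) (simp_all add: basis)
    then show "v \<in> K" using hvecs_expand[OF v] by simp
  qed
qed

end

section \<open>Simplicity\<close>

text \<open>Abstracts the nontrivial elements of the Sylow p-subgroup of the first factor;
  \<open>t_free\<close> does the same for the second.\<close>

definition s_free where
  "s_free v \<longleftrightarrow> v \<in> carrier G \<and> (\<forall>a. w 0 a \<otimes> v = v \<otimes> w 0 a) \<and>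
     (\<forall>c. w c 0 \<otimes> v = v \<otimes> w c 0 \<longrightarrow> int q dvd c)"

definition t_free where
  "t_free v \<longleftrightarrow> v \<in> carrier G \<and> (\<forall>c. w c 0 \<otimes> v = v \<otimes> w c 0) \<and>
     (\<forall>a. w 0 a \<otimes> v = v \<otimes> w 0 a \<longrightarrow> int q dvd a)"

text \<open>Equal conjugates give an element centralizing \<open>v\<close>, so for a free
  \<open>v\<close> the conjugates by the \<open>q\<close> powers of \<open>s\<close> are
  distinct.\<close>

lemma conj_eq_imp:
  assumes v: "v \<in> carrier G" and eq: "w (- c) (- a) \<otimes> v \<otimes> w c a = w (- d) (- b) \<otimes> v \<otimes> w d b"
  shows "w (d - c) (b - a) \<otimes> v = v \<otimes> w (d - c) (b - a)"
proof -
  have "w d b \<otimes> (w (- c) (- a) \<otimes> v \<otimes> w c a) \<otimes> w (- c) (- a) = w d b \<otimes> (w (- d) (- b) \<otimes> v \<otimes> w d b) \<otimes> w (- c) (- a)"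
    by (simp only: eq)
  then show ?thesis using v by (simp add: w_simps)
qed

lemma Q_diff_dvd: "c \<in> Q \<Longrightarrow> d \<in> Q \<Longrightarrow> int q dvd d - c \<Longrightarrow> c = d"
  using Q_dvd[of "d - c"] Q_dvd[of "c - d"] by (cases "c \<le> d") (auto simp: dvd_diff_commute)

context
  fixes K assumes K: "normal_hopf_subalgebra TH K"
begin

lemma hopf_K: "hopf_subalgebra TH K"
  using K by (simp add: normal_hopf_subalgebra_def)

lemma N_I:
  assumes g: "g \<in> carrier G" and "\<And>f. f \<in> K \<Longrightarrow> f \<one> = 0 \<Longrightarrow> f g = 0"
  shows "g \<in> N K"
proof -
  have "f g = f \<one>" if f: "f \<in> K" for f
  proof -
    have one: "hone TH \<in> K" using hopf_K by (simp add: hopf_subalgebra_def)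
    have "(\<lambda>x. f x + (- f \<one>) * hone TH x) \<in> K"
      by (intro K_add[OF hopf_K] K_scale[OF hopf_K] f one)
    from assms(2)[OF this] show ?thesis using g by (simp add: hone_def less_n)
  qed
  then show ?thesis using g by (simp add: N_def[OF hopf_K])
qed

text \<open>For \<open>k\<close> in \<open>K\<close> one has
  \<open>(k b)(v) = k(\<one>) b(v)\<close>, so evaluation at \<open>v\<close> kills
  \<open>K\<^sup>+ H\<close> and, by normality, also \<open>H K\<^sup>+\<close>. Its values on
  products of delta functions with \<open>f\<close> are Fourier coefficients of the map from
  \<open>A\<close> to \<open>f(t^A)\<close>, which therefore vanish.\<close>

lemma s_free_imp_t_in_N:
  assumes vN: "v \<in> N K" and free: "s_free v"
  shows "w 0 1 \<in> N K"
proof (rule N_I)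
  fix f assume f: "f \<in> K" "f \<one> = 0"
  have v: "v \<in> carrier G" and comm: "w 0 a \<otimes> v = v \<otimes> w 0 a"
    and free: "w c 0 \<otimes> v = v \<otimes> w c 0 \<Longrightarrow> int q dvd c" for a c
    using free by (auto simp: s_free_def)
  have comm': "w 0 a \<otimes> v \<otimes> w 0 b = w 0 (a + b) \<otimes> v" for a b
    using v comm[of b] by (simp add: m_assoc comm[symmetric]) (simp add: w_simps)
  \<comment> \<open>The factor from \<open>K\<close> sees only the powers of \<open>s\<close> and
    \<open>t\<close> around \<open>v\<close>.\<close>
  have const: "k (w c a \<otimes> v \<otimes> w d b) = k (w (c + d) (a + b))" if "k \<in> K" for k a b c d
    using N_coset[OF hopf_K that vN, of "w c a" "w d b"] by (simp add: w_mult)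
  have van: "(\<Sum>i\<in>{()}. 1 * hprod TH k (hbasis b) v) = 0" if k: "k \<in> K" "heps TH k = 0" for k b
  proof -
    have "hprod TH k (hbasis b) v
      = J (- 1) (\<lambda>a c. J (- (- 1)) (\<lambda>b' d. k (w (c + d) 0) * delta b (w 0 (a + b') \<otimes> v)))"
      using v k by (simp add: hprod_TH less_n) (simp add: tw_def hbasis_def const comm')
    also have "\<dots> = k (w 0 0) * delta b (w 0 0 \<otimes> v)"
      by (rule J_cancel[of "- 1" "\<lambda>A C. k (w C 0) * delta b (w 0 A \<otimes> v)"]) simp_all
    finally show ?thesis using k by (simp add: heps_TH)
  qed
  have vanish: "J 1 (\<lambda>A D. delta g (w (- D) 0 \<otimes> v \<otimes> w D 0) * f (w 0 A)) = 0" if g: "g < n" for g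
  proof -
    have "(\<Sum>i\<in>{()}. 1 * hprod TH (hbasis g) f v) = 0"
      by (rule normal_hopf_subalgebra_functional[OF hopf_algebra_TH K, where x = "\<lambda>_. v" and c = "\<lambda>_. 1"])
         (use van f g in \<open>simp_all add: heps_TH\<close>)
    then have "hprod TH (hbasis g) f v = 0" by simp
    also have "hprod TH (hbasis g) f v
      = J (- 1) (\<lambda>a c. J (- (- 1)) (\<lambda>b d. delta g (w (c + d - d) 0 \<otimes> v \<otimes> w d 0) * f (w 0 (a + b))))"
      using v f by (simp add: hprod_TH less_n) (simp add: tw_def hbasis_def const)
    also have "\<dots> = J (- (- 1)) (\<lambda>A D. delta g (w (0 - D) 0 \<otimes> v \<otimes> w D 0) * f (w 0 A))"
      by (rule J_fuse[of "- 1" "\<lambda>A C D. delta g (w (C - D) 0 \<otimes> v \<otimes> w D 0) * f (w 0 A)"]) simp_all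
    finally show ?thesis by simp
  qed
  have "(\<Sum>A\<in>Q. z (A * D) * f (w 0 A)) = 0" if D: "D \<in> Q" for D
  proof -
    \<comment> \<open>Freeness makes this conjugate differ from those for other exponents in
      \<open>Q\<close>, so the delta isolates one Fourier coefficient.\<close>
    let ?g = "w (- D) 0 \<otimes> v \<otimes> w D 0"
    have "delta ?g (w (- E) 0 \<otimes> v \<otimes> w E 0) = (if D = E then 1 else 0 :: 'k)" if E: "E \<in> Q" for E
      using conj_eq_imp[OF v, of D 0 E 0] free[of "E - D"] Q_diff_dvd[OF D E] by (auto simp: delta_def)
    then have "J 1 (\<lambda>A E. delta ?g (w (- E) 0 \<otimes> v \<otimes> w E 0) * f (w 0 A))
      = (\<Sum>A\<in>Q. \<Sum>E\<in>Q. z (A * E) * ((if D = E then 1 else 0) * f (w 0 A))) / of_nat q"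
      by (simp add: J_def)
    also have "\<dots> = (\<Sum>A\<in>Q. z (A * D) * f (w 0 A)) / of_nat q"
      using D by (simp add: if_distrib[of "\<lambda>x. x * _"] if_distrib[of "\<lambda>x. _ * x"] cong: if_cong)
    finally show ?thesis using vanish[of ?g] v q_pos by (simp add: less_n)
  qed
  \<comment> \<open>Inverse transform at exponent 1, recovering \<open>f(t)\<close> from its
    coefficients.\<close>
  then have "0 = (\<Sum>D\<in>Q. z (- 1 * D) * (\<Sum>A\<in>Q. z (A * D) * f (w 0 A)) / of_nat q)" by simp
  also have "\<dots> = J 1 (\<lambda>D A. z (- 1 * D) * f (w 0 A))"
    by (simp add: J_def sum_distrib_left sum_divide_distrib ac_simps)
  also have "\<dots> = f (w 0 (- (- 1)))" by (rule J_shift) simp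
  finally show "f (w 0 1) = 0" by simp
qed simp

text \<open>Now the delta function stands on the leg of \<open>t\<close>, which does not commute
  with \<open>u\<close>, and evaluation at one point does not decouple the two factors. Summing over
  conjugates with weight \<open>z i\<close> does: a shift by \<open>B\<close> becomes the factor
  \<open>z B\<close>, to which \<open>J_shift\<close> applies.\<close>

lemma t_free_imp_s_in_N:
  assumes uN: "u \<in> N K" and free: "t_free u"
  shows "w 1 0 \<in> N K"
proof (rule N_I)
  fix f assume f: "f \<in> K" "f \<one> = 0"
  have u: "u \<in> carrier G" and comm: "w c 0 \<otimes> u = u \<otimes> w c 0"
    and free: "w 0 a \<otimes> u = u \<otimes> w 0 a \<Longrightarrow> int q dvd a" for a c
    using free by (auto simp: t_free_def)
  have comm': "w c a \<otimes> u \<otimes> w d b = w (c + d) a \<otimes> u \<otimes> w 0 b" for a b c d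
  proof -
    have "w c a \<otimes> u \<otimes> w d b = w c a \<otimes> (u \<otimes> w d 0) \<otimes> w 0 b" using u by (simp add: w_simps)
    also have "\<dots> = w c a \<otimes> (w d 0 \<otimes> u) \<otimes> w 0 b" by (simp only: comm)
    finally show ?thesis using u by (simp add: w_simps)
  qed
  have const: "k (w c a \<otimes> u \<otimes> w d b) = k (w (c + d) (a + b))" if "k \<in> K" for k a b c d
    using N_coset[OF hopf_K that uN, of "w c a" "w d b"] by (simp add: w_mult)
  \<comment> \<open>The extra \<open>s\<close> offsets the shift by -1 from \<open>J_shift\<close>,
    so that \<open>k\<close> is finally evaluated at \<open>\<one>\<close>, where it
    vanishes.\<close>
  define x where "x i = w 1 i \<otimes> u \<otimes> w 0 (- i)" for i
  have x: "x i \<in> carrier G" for i using u by (simp add: x_def)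
  have wx: "w c a \<otimes> x i \<otimes> w d b = w (c + 1) (a + i) \<otimes> u \<otimes> w d (b - i)" for a b c d i
    using u by (simp add: x_def w_simps)
  have van: "(\<Sum>i\<in>Q. z i * hprod TH k (hbasis b) (x i)) = 0" if k: "k \<in> K" "heps TH k = 0" for k b
  proof -
    define F where "F i = (delta b (w 1 i \<otimes> u \<otimes> w 0 (- i)) :: 'k)" for i
    have F: "F (i + int q) = F i" for i by (simp add: F_def)
    have "hprod TH k (hbasis b) (x i) = J 1 (\<lambda>B C. k (w (C + 1) 0) * F (i - B))" for i
    proof -
      have per: "w 1 (a + int q - B + i) = w 1 (a - B + i)" for a B
        by (rule w_eqI2[where m = 1]) simp
      have "hprod TH k (hbasis b) (x i) = J (- 1) (\<lambda>a c. J (- (- 1)) (\<lambda>b' d.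
          k (w (c + d + 1) 0) * delta b (w 1 (a + b' - b' + i) \<otimes> u \<otimes> w 0 (b' - i))))"
        using x k by (simp add: hprod_TH less_n)
          (simp add: tw_def hbasis_def wx const add.commute add.left_commute)
      also have "\<dots> = J (- (- 1)) (\<lambda>B C. k (w (C + 1) 0) * delta b (w 1 (0 - B + i) \<otimes> u \<otimes> w 0 (B - i)))"
        by (rule J_fuse'[of "- 1" "\<lambda>A C B. k (w (C + 1) 0) * delta b (w 1 (A - B + i) \<otimes> u \<otimes> w 0 (B - i))"])
           (simp_all add: per)
      finally show ?thesis by (simp add: F_def)
    qed
    then have "(\<Sum>i\<in>Q. z i * hprod TH k (hbasis b) (x i))
        = J 1 (\<lambda>B C. \<Sum>i\<in>Q. z i * (k (w (C + 1) 0) * F (i - B)))"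
      by (simp only: J_sum J_mult)
    also have "\<dots> = J 1 (\<lambda>B C. (\<Sum>i\<in>Q. z i * F i) * (z (1 * B) * k (w (C + 1) 0)))"
    proof -
      have "(\<Sum>i\<in>Q. z i * (k' * F (i - B))) = (\<Sum>i\<in>Q. z i * F i) * (z (1 * B) * k')" for B k'
      proof -
        define H where "H j = z (j + B) * F j" for j
        have "H (j + int q) = H j" for j by (simp add: H_def F z_add z_q)
        from sum_periodic_shift[of H, OF this, of "- B"]
        have "(\<Sum>i\<in>Q. z i * F (i - B)) = (\<Sum>i\<in>Q. z i * F i) * z B"
          by (simp add: H_def z_add sum_distrib_left sum_distrib_right ac_simps)
        then show ?thesis by (simp add: mult.left_commute[of _ k'] sum_distrib_left[symmetric])
      qed
      then show ?thesis by simp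
    qed
    also have "\<dots> = (\<Sum>i\<in>Q. z i * F i) * J 1 (\<lambda>B C. z (1 * B) * k (w (C + 1) 0))"
      by (rule J_mult)
    also have "J 1 (\<lambda>B C. z (1 * B) * k (w (C + 1) 0)) = k (w (- 1 + 1) 0)"
      by (rule J_shift) simp
    finally show ?thesis using k by (simp add: heps_TH)
  qed
  \<comment> \<open>The left factor is the delta function at \<open>x 0\<close>. Freeness separates
    \<open>x 0\<close> from the other \<open>x i\<close>, and the sum collapses to
    \<open>f(s)\<close>.\<close>
  have sum0: "(\<Sum>i\<in>Q. z i * hprod TH (hbasis (w 1 0 \<otimes> u)) f (x i)) = 0"
    by (rule normal_hopf_subalgebra_functional[OF hopf_algebra_TH K, where x = x and c = z])
       (use van f u in \<open>simp_all add: heps_TH less_n\<close>)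
  have val: "hprod TH (hbasis (w 1 0 \<otimes> u)) f (x i) = delta (w 1 0 \<otimes> u) (x i) * f (w 1 0)" for i
  proof -
    have "hprod TH (hbasis (w 1 0 \<otimes> u)) f (x i) = J (- 1) (\<lambda>a c. J (- (- 1)) (\<lambda>b d.
        delta (w 1 0 \<otimes> u) (w (c + d + 1) i \<otimes> u \<otimes> w 0 (- i)) * f (w 1 (a + b))))"
      using x f by (simp add: hprod_TH less_n)
        (simp add: tw_def hbasis_def wx const comm'[of "_ + 1" _ _ "- i"] add.commute add.left_commute)
    also have "\<dots> = delta (w 1 0 \<otimes> u) (w (0 + 1) i \<otimes> u \<otimes> w 0 (- i)) * f (w 1 0)"
      by (rule J_cancel[of "- 1" "\<lambda>A C. delta (w 1 0 \<otimes> u) (w (C + 1) i \<otimes> u \<otimes> w 0 (- i)) * f (w 1 A)"])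
         simp_all
    finally show ?thesis by (simp add: x_def)
  qed
  have "(\<Sum>i\<in>Q. z i * delta (w 1 0 \<otimes> u) (x i)) * f (w 1 0) = 0"
    using sum0 by (simp only: val sum_distrib_right mult.assoc)
  moreover have "(\<Sum>i\<in>Q. z i * delta (w 1 0 \<otimes> u) (x i)) = 1"
  proof -
    have "delta (w 1 0 \<otimes> u) (x i) = (if i = 0 then 1 else 0 :: 'k)" if i: "i \<in> Q" for i
    proof -
      have "i = 0" if "w 1 0 \<otimes> u = x i"
      proof -
        have "w (- 1) 0 \<otimes> (w 1 0 \<otimes> u) \<otimes> w 0 i = w (- 1) 0 \<otimes> x i \<otimes> w 0 i" by (simp only: that)
        then have "u \<otimes> w 0 i = w 0 i \<otimes> u" using u by (simp add: x_def w_simps)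
        then show ?thesis using free[of i] Q_dvd[OF i] by simp
      qed
      moreover have "x 0 = w 1 0 \<otimes> u" using u by (simp add: x_def)
      ultimately show ?thesis by (auto simp: delta_def)
    qed
    then have "(\<Sum>i\<in>Q. z i * delta (w 1 0 \<otimes> u) (x i)) = (\<Sum>i\<in>Q. if i = 0 then z i else 0)"
      by (intro sum.cong) simp_all
    then show ?thesis using q_pos by (simp add: z_0)
  qed
  ultimately show "f (w 1 0) = 0" by simp
qed simp

end

end

text \<open>The requirements on the group, in commutator form because commutators with elements of
  \<open>N\<close> stay in \<open>N\<close>. \<open>normal_generators\<close> makes the normal
  closure of \<open>s\<close> and \<open>t\<close> everything; \<open>noncommuting\<close> serves
  the comparison with group algebras and their duals.\<close>

locale simple_twisted = twisted G q z n w
  for G :: "nat monoid" (structure) and q and z :: "int \<Rightarrow> 'k::field_char_0" and n and w +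
  assumes commutator_free: "\<And>g. g \<in> carrier G \<Longrightarrow> g \<noteq> \<one> \<Longrightarrow>
      \<exists>h\<in>carrier G. s_free (h \<otimes> g \<otimes> inv h \<otimes> inv g) \<or> t_free (h \<otimes> g \<otimes> inv h \<otimes> inv g)"
    and s_commutator_free: "\<exists>h\<in>carrier G. s_free (w 1 0 \<otimes> h \<otimes> inv (w 1 0) \<otimes> inv h)"
    and t_commutator_free: "\<exists>h\<in>carrier G. t_free (w 0 1 \<otimes> h \<otimes> inv (w 0 1) \<otimes> inv h)"
    and normal_generators: "\<And>x. x \<in> carrier G \<Longrightarrow> \<exists>c a. \<exists>g\<in>carrier G. \<exists>h\<in>carrier G.
      x = w c a \<otimes> (w 1 0 \<otimes> g \<otimes> inv (w 1 0) \<otimes> inv g) \<otimes> (w 0 1 \<otimes> h \<otimes> inv (w 0 1) \<otimes> inv h)"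
    and noncommuting: "\<exists>v. s_free v \<and> (\<forall>a. w 1 0 \<otimes> v \<noteq> w 0 a \<otimes> v \<otimes> w 1 0)"
begin

text \<open>A free commutator puts one of \<open>s\<close>, \<open>t\<close> into \<open>N\<close>.
  A commutator of that element is again free, of the kind that forces the other one into
  \<open>N\<close>.\<close>

lemma simple_TH: "simple_hopf TH"
  unfolding simple_hopf_def
proof (intro allI impI)
  fix K assume K: "normal_hopf_subalgebra TH K"
  note hK = hopf_K[OF K]
  show "K = hscalars TH \<or> K = hvecs TH"
  proof (cases "N K = {\<one>}")
    case True
    then show ?thesis using N_trivial[OF hK] by simp
  next
    case False
    have "\<one> \<in> N K" by (simp add: N_def[OF hK])
    with False obtain g where g: "g \<in> N K" "g \<noteq> \<one>" by blast
    then have gc: "g \<in> carrier G" by (simp add: N_carrier[OF hK])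
    obtain h where h: "h \<in> carrier G"
      and free: "s_free (h \<otimes> g \<otimes> inv h \<otimes> inv g) \<or> t_free (h \<otimes> g \<otimes> inv h \<otimes> inv g)"
      using commutator_free[OF gc g(2)] by blast
    have hN: "h \<otimes> g \<otimes> inv h \<otimes> inv g \<in> N K" by (rule N_commutator(1)[OF hK g(1) h])
    have t_imp_s: "w 1 0 \<in> N K" if "w 0 1 \<in> N K"
      using t_commutator_free N_commutator(2)[OF hK that] t_free_imp_s_in_N[OF K] by blast
    have s_imp_t: "w 0 1 \<in> N K" if "w 1 0 \<in> N K"
      using s_commutator_free N_commutator(2)[OF hK that] s_free_imp_t_in_N[OF K] by blast
    have s: "w 1 0 \<in> N K" and t: "w 0 1 \<in> N K"
      using free s_free_imp_t_in_N[OF K hN] t_free_imp_s_in_N[OF K hN] t_imp_s s_imp_t by blast+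
    have s': "w (- 1) 0 \<in> N K" and t': "w 0 (- 1) \<in> N K"
      using N_inv[OF hK s] N_inv[OF hK t] by (simp_all add: inv_w)
    have "w c 0 \<in> N K" for c
    proof (induction c rule: int_induct[where k = 0])
      case base show ?case using \<open>\<one> \<in> N K\<close> by simp
    next
      case (step1 i) then show ?case using N_mult[OF hK _ s, of "w i 0"] by (simp add: w_mult)
    next
      case (step2 i) then show ?case using N_mult[OF hK _ s', of "w i 0"] by (simp add: w_mult)
    qed
    moreover have "w 0 a \<in> N K" for a
    proof (induction a rule: int_induct[where k = 0])
      case base show ?case using \<open>\<one> \<in> N K\<close> by simp
    next
      case (step1 i) then show ?case using N_mult[OF hK _ t, of "w 0 i"] by (simp add: w_mult)
    next
      case (step2 i) then show ?case using N_mult[OF hK _ t', of "w 0 i"] by (simp add: w_mult)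
    qed
    ultimately have wN: "w c a \<in> N K" for c a
      using N_mult[OF hK, of "w c 0" "w 0 a"] by (simp add: w_mult)
    have "x \<in> N K" if x: "x \<in> carrier G" for x
    proof -
      obtain c a g h where gh: "g \<in> carrier G" "h \<in> carrier G"
        and eq: "x = w c a \<otimes> (w 1 0 \<otimes> g \<otimes> inv (w 1 0) \<otimes> inv g) \<otimes> (w 0 1 \<otimes> h \<otimes> inv (w 0 1) \<otimes> inv h)"
        using normal_generators[OF x] by blast
      show ?thesis unfolding eq
        by (intro N_mult[OF hK] wN N_commutator(2)[OF hK] gh)
    qed
    then have "N K = carrier G" using N_carrier[OF hK] by blast
    then show ?thesis using N_eq_carrier[OF hK] by simp
  qed
qed

text \<open>The delta functions at \<open>v\<close> and \<open>g = s v s^-1\<close> are multiplied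
  in both orders and evaluated at \<open>v\<close>. On the leg of \<open>t\<close> only the elements
  \<open>t^a v\<close> occur, never \<open>g\<close>; on the leg of \<open>s\<close> the conjugate
  \<open>g\<close> does occur, with a positive count divided by \<open>q\<close>.\<close>

lemma TH_not_commutative:
  obtains i j r where "i < n" "j < n" "r < n" "mu i j r \<noteq> mu j i r"
proof -
  obtain v where free: "s_free v" and ne: "\<And>a. w 1 0 \<otimes> v \<noteq> w 0 a \<otimes> v \<otimes> w 1 0"
    using noncommuting by blast
  then have v: "v \<in> carrier G" and comm: "w 0 a \<otimes> v = v \<otimes> w 0 a" for a
    by (auto simp: s_free_def)
  have comm': "w 0 a \<otimes> v \<otimes> w 0 b = w 0 (a + b) \<otimes> v" for a b
    using v comm[of b] by (simp add: m_assoc comm[symmetric]) (simp add: w_simps)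
  obtain u where u: "t_free u" using t_commutator_free by blast
  have order: "int q dvd a" if "w 0 a = \<one>" for a
    using u that by (auto simp: t_free_def)
  have order': "w 0 a = \<one>" if "int q dvd a" for a
    using that w_eqI2[of a 0 _ 0] by (auto elim: dvdE)
  define g where "g = w 1 0 \<otimes> v \<otimes> w (- 1) 0"
  have g: "g \<in> carrier G" using v by (simp add: g_def)
  have "g \<noteq> w 0 a \<otimes> v" for a
  proof
    assume "g = w 0 a \<otimes> v"
    then have "g \<otimes> w 1 0 = w 0 a \<otimes> v \<otimes> w 1 0" by simp
    then show False using ne[of a] v by (simp add: g_def w_simps)
  qed
  then have "mu v g v = 0"
    by (simp add: mu_def tw_def comm' delta_def J_def)
  moreover have "mu g v v \<noteq> 0"
  proof -
    have "mu g v v = J (- 1) (\<lambda>a c. J (- (- 1)) (\<lambda>b d.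
        delta g (w (c + d - d) 0 \<otimes> v \<otimes> w d 0) * delta v (w 0 (a + b) \<otimes> v)))"
      by (simp add: mu_def tw_def comm')
    also have "\<dots> = J (- (- 1)) (\<lambda>A D. delta g (w (0 - D) 0 \<otimes> v \<otimes> w D 0) * delta v (w 0 A \<otimes> v))"
      by (rule J_fuse[of "- 1" "\<lambda>A C D. delta g (w (C - D) 0 \<otimes> v \<otimes> w D 0) * delta v (w 0 A \<otimes> v)"]) simp_all
    also have "\<dots> = (\<Sum>D\<in>Q. \<Sum>A\<in>Q. z (A * D) * (delta g (w (- D) 0 \<otimes> v \<otimes> w D 0) * delta v (w 0 A \<otimes> v))) / of_nat q"
      unfolding J_def by (subst sum.swap) simp
    also have "\<dots> = (\<Sum>D\<in>Q. \<Sum>A\<in>Q. if int q dvd A then z (A * D) * delta g (w (- D) 0 \<otimes> v \<otimes> w D 0) else 0) / of_nat q"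
    proof -
      have "delta v (w 0 A \<otimes> v) = (if int q dvd A then 1 else 0 :: 'k)" for A
        using v order[of A] order'[of A] r_cancel_one'[of v "w 0 A"] by (auto simp: delta_def)
      then have "z (A * D) * (k * delta v (w 0 A \<otimes> v)) = (if int q dvd A then z (A * D) * k else 0)" for A D k
        by simp
      then show ?thesis by simp
    qed
    also have "\<dots> = (\<Sum>D\<in>Q. delta g (w (- D) 0 \<otimes> v \<otimes> w D 0)) / of_nat q"
      by (simp add: sum_Q_dvd z_0)
    also have "(\<Sum>D\<in>Q. delta g (w (- D) 0 \<otimes> v \<otimes> w D 0)) = (of_nat (card {D\<in>Q. g = w (- D) 0 \<otimes> v \<otimes> w D 0}) :: 'k)"
      by (simp add: delta_def sum.If_cases Int_def)
    finally have eq: "mu g v v = of_nat (card {D\<in>Q. g = w (- D) 0 \<otimes> v \<otimes> w D 0}) / of_nat q" .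
    \<comment> \<open>The exponent \<open>D = -1\<close> is represented in \<open>Q\<close> by
      \<open>q - 1\<close>.\<close>
    have "w (- (int q - 1)) 0 = w 1 0" "w (int q - 1) 0 = w (- 1) 0"
      by (rule w_eqI1[where m = "-1"], simp, rule w_eqI1[where m = 1], simp)
    then have "int q - 1 \<in> {D\<in>Q. g = w (- D) 0 \<otimes> v \<otimes> w D 0}"
      using q_pos by (simp add: g_def)
    then have "{D\<in>Q. g = w (- D) 0 \<otimes> v \<otimes> w D 0} \<noteq> {}" by blast
    moreover have "finite {D\<in>Q. g = w (- D) 0 \<otimes> v \<otimes> w D 0}" by (rule finite_subset[of _ Q]) auto
    ultimately have "card {D\<in>Q. g = w (- D) 0 \<otimes> v \<otimes> w D 0} \<noteq> 0"
      by (metis (no_types, lifting) card_0_eq)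
    then show ?thesis using q_pos by (simp add: eq)
  qed
  ultimately show ?thesis using that[of g v v] g v by (simp add: less_n)
qed

text \<open>Group algebras are cocommutative, which fails here because \<open>G\<close> is
  nonabelian; their duals are commutative, which fails for the twisted product.\<close>

lemma TH_not_iso:
  "\<not> hopf_iso TH (group_algebra G' m)" "\<not> hopf_iso TH (hopf_dual (group_algebra G' m))"
proof -
  obtain v where free: "s_free v" and ne: "\<And>a. w 1 0 \<otimes> v \<noteq> w 0 a \<otimes> v \<otimes> w 1 0"
    using noncommuting by blast
  then have v: "v \<in> carrier G" by (simp add: s_free_def)
  show "\<not> hopf_iso TH (group_algebra G' m)"
  proof
    assume "hopf_iso TH (group_algebra G' m)"
    from hopf_iso_cocommutative[OF this, of "w 1 0 \<otimes> v" "w 1 0" v]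
    have "delta (w 1 0 \<otimes> v) (w 1 0 \<otimes> v) = (delta (w 1 0 \<otimes> v) (v \<otimes> w 1 0) :: 'k)"
      using v by (simp add: group_algebra_def less_n conj_commute)
    then show False using ne[of 0] v by (simp add: delta_def split: if_splits)
  qed
  obtain i j r where "i < n" "j < n" "r < n" "mu i j r \<noteq> mu j i r"
    by (rule TH_not_commutative)
  then show "\<not> hopf_iso TH (hopf_dual (group_algebra G' m))"
    using hopf_iso_commutative[of TH "hopf_dual (group_algebra G' m)" i j r]
    by (auto simp: hopf_dual_def group_algebra_def conj_commute)
qed

end

section \<open>Transport to a group on an initial segment\<close>

text \<open>Structure constants are indexed by the numbers below the dimension, so the group must
  live on an initial segment.\<close>

lemma finite_group_iso_nat:
  assumes "group M" and fin: "finite (carrier M)"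
  obtains G :: "nat monoid" and \<phi> where "group G" "carrier G = {..<card (carrier M)}" "\<phi> \<in> iso M G"
proof -
  interpret M: group M by fact
  obtain \<phi> where bij: "bij_betw \<phi> (carrier M) {..<card (carrier M)}"
    using ex_bij_betw_finite_nat[OF fin] by (auto simp: atLeast0LessThan)
  define \<psi> where "\<psi> = inv_into (carrier M) \<phi>"
  define G where "G = \<lparr>carrier = {..<card (carrier M)}, monoid.mult = (\<lambda>i j. \<phi> (\<psi> i \<otimes>\<^bsub>M\<^esub> \<psi> j)), one = \<phi> \<one>\<^bsub>M\<^esub>\<rparr>"
  have \<psi>\<phi> [simp]: "x \<in> carrier M \<Longrightarrow> \<psi> (\<phi> x) = x" for x
    using bij by (simp add: \<psi>_def bij_betw_inv_into_left)
  have \<phi> [simp]: "x \<in> carrier M \<Longrightarrow> \<phi> x < card (carrier M)" for x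
    using bij by (auto simp: bij_betw_def)
  have ex: "\<exists>x\<in>carrier M. i = \<phi> x" if "i \<in> carrier G" for i
    using bij that by (auto simp: bij_betw_def G_def)
  have "group G"
  proof (rule groupI)
    fix i assume "i \<in> carrier G"
    then obtain x where "x \<in> carrier M" "i = \<phi> x" using ex by blast
    then show "\<exists>j\<in>carrier G. j \<otimes>\<^bsub>G\<^esub> i = \<one>\<^bsub>G\<^esub>"
      by (intro bexI[of _ "\<phi> (inv\<^bsub>M\<^esub> x)"]) (simp_all add: G_def)
  next
    fix i j k assume "i \<in> carrier G" "j \<in> carrier G" "k \<in> carrier G"
    then obtain x y u where "x \<in> carrier M" "i = \<phi> x" "y \<in> carrier M" "j = \<phi> y" "u \<in> carrier M" "k = \<phi> u"
      using ex by meson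
    then show "i \<otimes>\<^bsub>G\<^esub> j \<otimes>\<^bsub>G\<^esub> k = i \<otimes>\<^bsub>G\<^esub> (j \<otimes>\<^bsub>G\<^esub> k)" by (simp add: G_def M.m_assoc)
  next
    fix i j assume "i \<in> carrier G" "j \<in> carrier G"
    then obtain x y where "x \<in> carrier M" "i = \<phi> x" "y \<in> carrier M" "j = \<phi> y"
      using ex by meson
    then show "i \<otimes>\<^bsub>G\<^esub> j \<in> carrier G" by (simp add: G_def)
  next
    fix i assume "i \<in> carrier G"
    then obtain x where "x \<in> carrier M" "i = \<phi> x" using ex by blast
    then show "\<one>\<^bsub>G\<^esub> \<otimes>\<^bsub>G\<^esub> i = i" by (simp add: G_def)
  qed (simp add: G_def)
  moreover have "\<phi> \<in> iso M G"
    using bij by (auto simp: iso_def hom_def G_def)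
  ultimately show ?thesis using that[of G \<phi>] by (simp add: G_def)
qed

section \<open>The direct square of a Frobenius-like group\<close>

locale free_pair = group F
  for F :: "'a monoid" (structure) +
  fixes q :: nat and sg :: "int \<Rightarrow> 'a"
  assumes q_gt_1: "q > 1"
    and finite_F: "finite (carrier F)"
    and sg_closed [simp]: "\<And>c. sg c \<in> carrier F"
    and sg_mult: "\<And>c d. sg c \<otimes> sg d = sg (c + d)"
    and sg_periodic: "\<And>c. sg (c + int q) = sg c"
begin

definition free where
  "free v \<longleftrightarrow> v \<in> carrier F \<and> (\<forall>c. sg c \<otimes> v = v \<otimes> sg c \<longrightarrow> int q dvd c)"

lemma sg_0: "sg 0 = \<one>"
  using sg_mult[of 0 0] l_cancel_one[of "sg 0" "sg 0"] by simp

text \<open>Each factor commutes with the other, so a free element of \<open>F\<close> becomes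
  \<open>s_free\<close> in the first factor and \<open>t_free\<close> in the second. If a coordinate
  of \<open>g\<close> is nontrivial, a commutator with an element of that factor trivialises the
  other coordinate.\<close>

lemma direct_square_simple_twisted:
  fixes z :: "int \<Rightarrow> 'k::field_char_0"
  assumes z: "fourier q z"
    and commutator_free: "\<And>g. g \<in> carrier F \<Longrightarrow> g \<noteq> \<one> \<Longrightarrow> \<exists>h\<in>carrier F. free (h \<otimes> g \<otimes> inv h \<otimes> inv g)"
    and sg_commutator_free: "\<exists>h\<in>carrier F. free (sg 1 \<otimes> h \<otimes> inv (sg 1) \<otimes> inv h)"
    and generators: "\<And>x. x \<in> carrier F \<Longrightarrow> \<exists>c. \<exists>h\<in>carrier F. x = sg c \<otimes> (sg 1 \<otimes> h \<otimes> inv (sg 1) \<otimes> inv h)"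
  obtains G w where "simple_twisted G q z ((card (carrier F))\<^sup>2) w"
proof -
  let ?M = "F \<times>\<times> F"
  have M: "group ?M" by (rule DirProd_group) (rule is_group)+
  interpret M: group ?M by (rule M)
  have "finite (carrier ?M)" by (simp add: finite_F)
  then obtain G :: "nat monoid" and \<phi> where G: "group G" "carrier G = {..<card (carrier ?M)}" and iso: "\<phi> \<in> iso ?M G"
    using finite_group_iso_nat[OF M] by metis
  interpret G: group G by (rule G)
  interpret h: group_hom ?M G \<phi>
    using M G(1) iso by (simp add: group_hom_def group_hom_axioms_def iso_def)
  have inj: "x \<in> carrier ?M \<Longrightarrow> y \<in> carrier ?M \<Longrightarrow> \<phi> x = \<phi> y \<longleftrightarrow> x = y" for x y
    using iso by (auto simp: iso_def bij_betw_def inj_on_def)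
  have surj: "\<exists>x\<in>carrier F. \<exists>y\<in>carrier F. g = \<phi> (x, y)" if g: "g \<in> carrier G" for g
  proof -
    have "g \<in> \<phi> ` carrier ?M" using iso g by (simp add: iso_def bij_betw_def)
    then show ?thesis by auto
  qed
  have mult: "\<phi> (x, y) \<otimes>\<^bsub>G\<^esub> \<phi> (x', y') = \<phi> (x \<otimes> x', y \<otimes> y')"
    if "x \<in> carrier F" "y \<in> carrier F" "x' \<in> carrier F" "y' \<in> carrier F" for x y x' y'
    using h.hom_mult[of "(x, y)" "(x', y')"] that by simp
  have inv: "inv\<^bsub>G\<^esub> (\<phi> (x, y)) = \<phi> (inv x, inv y)" if "x \<in> carrier F" "y \<in> carrier F" for x y
    using h.hom_inv[of "(x, y)"] that by (simp add: inv_DirProd[OF is_group is_group])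
  have closed: "\<phi> (x, y) \<in> carrier G" if "x \<in> carrier F" "y \<in> carrier F" for x y
    using h.hom_closed[of "(x, y)"] that by simp
  have one: "\<one>\<^bsub>G\<^esub> = \<phi> (\<one>, \<one>)" using h.hom_one by simp
  define w where "w c a = \<phi> (sg c, sg a)" for c a
  interpret tw: twisted G q z "(card (carrier F))\<^sup>2" w
  proof -
    interpret fourier q z by (rule z)
    show "twisted G q z ((card (carrier F))\<^sup>2) w"
    proof unfold_locales
      show "carrier G = {..<(card (carrier F))\<^sup>2}"
        by (simp add: G(2) card_cartesian_product power2_eq_square)
    qed (simp_all add: w_def closed mult sg_mult sg_periodic)
  qed
  have s_free: "tw.s_free (\<phi> (v, \<one>))" if "free v" for v
    using that sg_0 by (auto simp: tw.s_free_def free_def closed w_def mult inj)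
  have t_free: "tw.t_free (\<phi> (\<one>, v))" if "free v" for v
    using that sg_0 by (auto simp: tw.t_free_def free_def closed w_def mult inj)
  obtain h0 where h0: "h0 \<in> carrier F" "free (sg 1 \<otimes> h0 \<otimes> inv (sg 1) \<otimes> inv h0)"
    using sg_commutator_free by blast
  have "simple_twisted G q z ((card (carrier F))\<^sup>2) w"
  proof
    fix g assume "g \<in> carrier G" and ne: "g \<noteq> \<one>\<^bsub>G\<^esub>"
    then obtain x y where xy: "x \<in> carrier F" "y \<in> carrier F" "g = \<phi> (x, y)" using surj by blast
    then consider "x \<noteq> \<one>" | "y \<noteq> \<one>" using ne one by auto
    then show "\<exists>h\<in>carrier G. tw.s_free (h \<otimes>\<^bsub>G\<^esub> g \<otimes>\<^bsub>G\<^esub> inv\<^bsub>G\<^esub> h \<otimes>\<^bsub>G\<^esub> inv\<^bsub>G\<^esub> g) \<or> tw.t_free (h \<otimes>\<^bsub>G\<^esub> g \<otimes>\<^bsub>G\<^esub> inv\<^bsub>G\<^esub> h \<otimes>\<^bsub>G\<^esub> inv\<^bsub>G\<^esub> g)"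
    proof cases
      case 1
      then obtain h where "h \<in> carrier F" "free (h \<otimes> x \<otimes> inv h \<otimes> inv x)" using commutator_free xy by blast
      then show ?thesis using xy s_free by (intro bexI[of _ "\<phi> (h, \<one>)"]) (simp_all add: mult inv closed)
    next
      case 2
      then obtain h where "h \<in> carrier F" "free (h \<otimes> y \<otimes> inv h \<otimes> inv y)" using commutator_free xy by blast
      then show ?thesis using xy t_free by (intro bexI[of _ "\<phi> (\<one>, h)"]) (simp_all add: mult inv closed)
    qed
  next
    show "\<exists>h\<in>carrier G. tw.s_free (w 1 0 \<otimes>\<^bsub>G\<^esub> h \<otimes>\<^bsub>G\<^esub> inv\<^bsub>G\<^esub> w 1 0 \<otimes>\<^bsub>G\<^esub> inv\<^bsub>G\<^esub> h)"
      using h0 s_free by (intro bexI[of _ "\<phi> (h0, \<one>)"]) (simp_all add: mult inv closed w_def sg_0)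
    show "\<exists>h\<in>carrier G. tw.t_free (w 0 1 \<otimes>\<^bsub>G\<^esub> h \<otimes>\<^bsub>G\<^esub> inv\<^bsub>G\<^esub> w 0 1 \<otimes>\<^bsub>G\<^esub> inv\<^bsub>G\<^esub> h)"
      using h0 t_free by (intro bexI[of _ "\<phi> (\<one>, h0)"]) (simp_all add: mult inv closed w_def sg_0)
  next
    fix g assume "g \<in> carrier G"
    then obtain x y where xy: "x \<in> carrier F" "y \<in> carrier F" "g = \<phi> (x, y)" using surj by blast
    obtain c h where h: "h \<in> carrier F" "x = sg c \<otimes> (sg 1 \<otimes> h \<otimes> inv (sg 1) \<otimes> inv h)"
      using generators[OF xy(1)] by blast
    obtain a k where k: "k \<in> carrier F" "y = sg a \<otimes> (sg 1 \<otimes> k \<otimes> inv (sg 1) \<otimes> inv k)"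
      using generators[OF xy(2)] by blast
    have "g = w c a \<otimes>\<^bsub>G\<^esub> (w 1 0 \<otimes>\<^bsub>G\<^esub> \<phi> (h, \<one>) \<otimes>\<^bsub>G\<^esub> inv\<^bsub>G\<^esub> w 1 0 \<otimes>\<^bsub>G\<^esub> inv\<^bsub>G\<^esub> \<phi> (h, \<one>))
        \<otimes>\<^bsub>G\<^esub> (w 0 1 \<otimes>\<^bsub>G\<^esub> \<phi> (\<one>, k) \<otimes>\<^bsub>G\<^esub> inv\<^bsub>G\<^esub> w 0 1 \<otimes>\<^bsub>G\<^esub> inv\<^bsub>G\<^esub> \<phi> (\<one>, k))"
      using h(1) k(1) by (simp add: xy(3) h(2) k(2) w_def mult inv sg_0)
    then show "\<exists>c a. \<exists>g'\<in>carrier G. \<exists>h\<in>carrier G. g = w c a \<otimes>\<^bsub>G\<^esub> (w 1 0 \<otimes>\<^bsub>G\<^esub> g' \<otimes>\<^bsub>G\<^esub> inv\<^bsub>G\<^esub> w 1 0 \<otimes>\<^bsub>G\<^esub> inv\<^bsub>G\<^esub> g')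
        \<otimes>\<^bsub>G\<^esub> (w 0 1 \<otimes>\<^bsub>G\<^esub> h \<otimes>\<^bsub>G\<^esub> inv\<^bsub>G\<^esub> w 0 1 \<otimes>\<^bsub>G\<^esub> inv\<^bsub>G\<^esub> h)"
      using closed[OF h(1) one_closed] closed[OF one_closed k(1)] by blast
  next
    obtain v where v: "free v" using h0 by blast
    then have vc: "v \<in> carrier F" by (simp add: free_def)
    have "sg 1 \<otimes> v \<noteq> v \<otimes> sg 1"
      using v q_gt_1 zdvd_not_zless[of 1 "int q"] by (auto simp: free_def)
    then have "w 1 0 \<otimes>\<^bsub>G\<^esub> \<phi> (v, \<one>) \<noteq> w 0 a \<otimes>\<^bsub>G\<^esub> \<phi> (v, \<one>) \<otimes>\<^bsub>G\<^esub> w 1 0" for a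
      using vc by (simp add: w_def mult inj sg_0)
    then show "\<exists>v. tw.s_free v \<and> (\<forall>a. w 1 0 \<otimes>\<^bsub>G\<^esub> v \<noteq> w 0 a \<otimes>\<^bsub>G\<^esub> v \<otimes>\<^bsub>G\<^esub> w 1 0)"
      using s_free[OF v] by blast
  qed
  then show ?thesis by (rule that)
qed

end

section \<open>The Frobenius group of order pq\<close>

locale frobenius_pq =
  fixes p q r :: nat
  assumes prime_p: "prime p" and prime_q: "prime q"
    and r_order: "\<And>k. [r ^ k = 1] (mod p) \<longleftrightarrow> q dvd k"
begin

text \<open>Reducing the exponent first makes sense of negative arguments; multiplicativity then
  holds only modulo \<open>p\<close>.\<close>

definition rho :: "int \<Rightarrow> int" where "rho i = int r ^ nat (i mod int q)"

lemma rho_0 [simp]: "rho 0 = 1"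
  by (simp add: rho_def)

lemma rho_mod [simp]: "rho (i mod int q) = rho i"
  by (simp add: rho_def)

lemma r_power_mod: "[int r ^ (m mod q) = int r ^ m] (mod int p)"
proof -
  have "[r ^ (q * (m div q)) = 1] (mod p)" by (simp only: r_order dvd_triv_left)
  then have "[int r ^ (q * (m div q)) = 1] (mod int p)"
    by (metis cong_int_iff of_nat_1 of_nat_power)
  then have "[int r ^ (q * (m div q)) * int r ^ (m mod q) = 1 * int r ^ (m mod q)] (mod int p)"
    by (rule cong_mult) simp
  then show ?thesis by (simp add: power_add[symmetric] cong_sym)
qed

lemma rho_add: "[rho (i + j) = rho i * rho j] (mod int p)"
proof -
  have q: "int q > 0" using prime_q prime_gt_0_nat by simp
  have "nat ((i + j) mod int q) = (nat (i mod int q) + nat (j mod int q)) mod q"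
  proof -
    have "nat ((i + j) mod int q) = nat ((i mod int q + j mod int q) mod int q)" by (simp add: mod_add_eq)
    also have "\<dots> = nat (i mod int q + j mod int q) mod q" using q by (simp add: nat_mod_distrib)
    finally show ?thesis using q by (simp add: nat_add_distrib)
  qed
  then show ?thesis
    using r_power_mod[of "nat (i mod int q) + nat (j mod int q)"] by (simp add: rho_def power_add)
qed

lemma rho_cong_1_iff: "[rho i = 1] (mod int p) \<longleftrightarrow> int q dvd i"
proof -
  have q: "int q > 0" using prime_q prime_gt_0_nat by simp
  have "[rho i = 1] (mod int p) \<longleftrightarrow> [r ^ nat (i mod int q) = 1] (mod p)"
    unfolding rho_def by (metis cong_int_iff of_nat_1 of_nat_power)
  also have "\<dots> \<longleftrightarrow> int q dvd i mod int q"
    using q by (simp only: r_order) (metis int_dvd_int_iff int_nat_eq pos_mod_sign)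
  finally show ?thesis by (simp add: dvd_mod_iff)
qed

lemma coprime_rho: "coprime (rho i) (int p)"
proof -
  have "[rho i * rho (- i) = 1] (mod int p)" using rho_add[of i "- i"] by (simp add: cong_sym)
  then show ?thesis using coprime_iff_invertible_int by blast
qed

text \<open>The semidirect product of the residues mod \<open>p\<close> by those mod
  \<open>q\<close>, with \<open>i\<close> acting as multiplication by \<open>r^i\<close>, on least
  nonnegative representatives.\<close>

definition F :: "(int \<times> int) monoid" where
  "F = \<lparr>carrier = {0..<int p} \<times> {0..<int q},
     monoid.mult = (\<lambda>(x, i) (y, j). ((x + rho i * y) mod int p, (i + j) mod int q)), one = (0, 0)\<rparr>"

lemma p_pos: "int p > 1" and q_pos: "int q > 1"
  using prime_p prime_q prime_gt_1_nat by auto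

lemma F_mult: "(x, i) \<otimes>\<^bsub>F\<^esub> (y, j) = ((x + rho i * y) mod int p, (i + j) mod int q)"
  by (simp add: F_def)

lemma F_carrier: "(x, i) \<in> carrier F \<longleftrightarrow> 0 \<le> x \<and> x < int p \<and> 0 \<le> i \<and> i < int q"
  by (auto simp: F_def)

lemma F_one: "\<one>\<^bsub>F\<^esub> = (0, 0)"
  by (simp add: F_def)

lemma card_F: "card (carrier F) = p * q"
  by (simp add: F_def card_cartesian_product)

lemma rho_add_mult: "(x + rho (i + j) * y) mod int p = (x + rho i * (rho j * y)) mod int p"
  using cong_add[OF cong_refl[of x] cong_mult[OF rho_add[of i j] cong_refl[of y]]]
  by (simp add: cong_def mult.assoc)

lemma mod_add_mult_mod: "(x + c * (y mod m)) mod m = (x + c * y) mod (m::int)"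
  by (metis mod_add_right_eq mod_mult_right_eq)

lemma group_F: "group F"
proof (rule groupI)
  fix g assume "g \<in> carrier F"
  then obtain x i where g: "g = (x, i)" "0 \<le> i" "i < int q" by (cases g) (auto simp: F_carrier)
  have "((- (rho (- i) * x)) mod int p, (- i) mod int q) \<otimes>\<^bsub>F\<^esub> g = \<one>\<^bsub>F\<^esub>"
    by (simp add: g F_mult F_one mod_simps)
  moreover have "((- (rho (- i) * x)) mod int p, (- i) mod int q) \<in> carrier F"
    using p_pos q_pos by (simp add: F_carrier)
  ultimately show "\<exists>h\<in>carrier F. h \<otimes>\<^bsub>F\<^esub> g = \<one>\<^bsub>F\<^esub>" by blast
next
  fix g h k assume "g \<in> carrier F" "h \<in> carrier F" "k \<in> carrier F"
  obtain x i y j u l where "g = (x, i)" "h = (y, j)" "k = (u, l)" by (cases g; cases h; cases k)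
  then show "g \<otimes>\<^bsub>F\<^esub> h \<otimes>\<^bsub>F\<^esub> k = g \<otimes>\<^bsub>F\<^esub> (h \<otimes>\<^bsub>F\<^esub> k)"
    using rho_add_mult[of "x + rho i * y" i j u]
    by (simp add: F_mult mod_simps mod_add_mult_mod) (simp add: algebra_simps)
next
  fix g h assume "g \<in> carrier F" "h \<in> carrier F"
  then show "g \<otimes>\<^bsub>F\<^esub> h \<in> carrier F"
    using p_pos q_pos by (cases g; cases h) (simp add: F_mult F_carrier)
next
  fix g assume "g \<in> carrier F"
  then show "\<one>\<^bsub>F\<^esub> \<otimes>\<^bsub>F\<^esub> g = g" by (cases g) (simp add: F_mult F_one F_carrier)
qed (use p_pos q_pos in \<open>simp add: F_one F_carrier\<close>)

definition sg :: "int \<Rightarrow> int \<times> int" where "sg c = (0, c mod int q)"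

definition tau :: "int \<Rightarrow> int \<times> int" where "tau x = (x mod int p, 0)"

sublocale free_pair F q sg
proof -
  interpret group F by (rule group_F)
  show "free_pair F q sg"
  proof
    show "q > 1" using q_pos by simp
    show "finite (carrier F)" by (simp add: F_def)
  qed (use p_pos q_pos in \<open>simp_all add: sg_def F_carrier F_mult mod_simps\<close>)
qed

section \<open>Commutators in the Frobenius group\<close>

lemma tau_closed: "tau x \<in> carrier F"
  using p_pos q_pos by (simp add: tau_def F_carrier)

text \<open>Conjugation by \<open>sg c\<close> multiplies \<open>x\<close> by \<open>rho c\<close>.
  Since \<open>x\<close> is invertible mod \<open>p\<close>, commuting forces \<open>rho c\<close>
  to be 1 mod \<open>p\<close>.\<close>

lemma free_tau:
  assumes "\<not> int p dvd x" shows "free (tau x)"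
  unfolding free_def
proof (intro conjI allI impI tau_closed)
  fix c assume "sg c \<otimes>\<^bsub>F\<^esub> tau x = tau x \<otimes>\<^bsub>F\<^esub> sg c"
  then have "[rho c * x = 1 * x] (mod int p)" by (simp add: sg_def tau_def F_mult mod_simps cong_def)
  moreover have "coprime x (int p)"
    using assms prime_p by (metis coprime_commute prime_imp_coprime_int prime_nat_int_transfer)
  ultimately have "[rho c = 1] (mod int p)" using cong_mult_rcancel by blast
  then show "int q dvd c" by (simp add: rho_cong_1_iff)
qed

text \<open>Commutators can thus be verified without computing inverses in \<open>F\<close>.\<close>

lemma commutator_eqI:
  assumes "h \<in> carrier F" "g \<in> carrier F" "k \<in> carrier F" "h \<otimes>\<^bsub>F\<^esub> g = k \<otimes>\<^bsub>F\<^esub> (g \<otimes>\<^bsub>F\<^esub> h)"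
  shows "h \<otimes>\<^bsub>F\<^esub> g \<otimes>\<^bsub>F\<^esub> inv\<^bsub>F\<^esub> h \<otimes>\<^bsub>F\<^esub> inv\<^bsub>F\<^esub> g = k"
proof -
  have "h \<otimes>\<^bsub>F\<^esub> g \<otimes>\<^bsub>F\<^esub> inv\<^bsub>F\<^esub> h \<otimes>\<^bsub>F\<^esub> inv\<^bsub>F\<^esub> g = h \<otimes>\<^bsub>F\<^esub> g \<otimes>\<^bsub>F\<^esub> inv\<^bsub>F\<^esub> (g \<otimes>\<^bsub>F\<^esub> h)"
    using assms(1-3) by (simp add: m_assoc inv_mult_group)
  also have "\<dots> = k" unfolding assms(4) using assms(1-3) by (subst m_assoc) simp_all
  finally show ?thesis .
qed

lemma sg_tau_commutator:
  "sg c \<otimes>\<^bsub>F\<^esub> tau x \<otimes>\<^bsub>F\<^esub> inv\<^bsub>F\<^esub> sg c \<otimes>\<^bsub>F\<^esub> inv\<^bsub>F\<^esub> tau x = tau ((rho c - 1) * x)"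
  by (rule commutator_eqI) (simp_all add: tau_closed, simp add: sg_def tau_def F_mult mod_simps, simp add: algebra_simps)

lemma not_dvd_rho_minus_1: "\<not> int q dvd c \<Longrightarrow> \<not> int p dvd rho c - 1"
  by (simp add: rho_cong_1_iff[symmetric] cong_iff_dvd_diff)

lemma not_q_dvd_1: "\<not> int q dvd 1"
  using q_pos by simp

text \<open>A nontrivial translation is moved by \<open>sg 1\<close>, and an element outside the
  translations moves \<open>tau 1\<close>; both commutators are nontrivial translations.\<close>

lemma commutator_free:
  assumes g: "g \<in> carrier F" and ne: "g \<noteq> \<one>\<^bsub>F\<^esub>"
  shows "\<exists>h\<in>carrier F. free (h \<otimes>\<^bsub>F\<^esub> g \<otimes>\<^bsub>F\<^esub> inv\<^bsub>F\<^esub> h \<otimes>\<^bsub>F\<^esub> inv\<^bsub>F\<^esub> g)"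
proof -
  obtain x i where gx: "g = (x, i)" "0 \<le> x" "x < int p" "0 \<le> i" "i < int q"
    using g by (cases g) (auto simp: F_carrier)
  show ?thesis
  proof (cases "i = 0")
    case True
    then have "x \<noteq> 0" using ne gx by (simp add: F_one)
    then have "\<not> int p dvd x" using gx zdvd_not_zless[of x "int p"] by simp
    then have "\<not> int p dvd (rho 1 - 1) * x"
      using prime_p not_dvd_rho_minus_1[OF not_q_dvd_1] by (simp add: prime_dvd_mult_iff)
    moreover have "g = tau x" using gx True by (simp add: tau_def)
    ultimately show ?thesis
      using free_tau sg_tau_commutator by (intro bexI[of _ "sg 1"]) simp_all
  next
    case False
    then have "\<not> int q dvd i" using gx zdvd_not_zless[of i "int q"] by simp
    then have "\<not> int p dvd 1 - rho i" using not_dvd_rho_minus_1 by (simp add: dvd_diff_commute)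
    moreover have "tau 1 \<otimes>\<^bsub>F\<^esub> g \<otimes>\<^bsub>F\<^esub> inv\<^bsub>F\<^esub> tau 1 \<otimes>\<^bsub>F\<^esub> inv\<^bsub>F\<^esub> g = tau (1 - rho i)"
      by (rule commutator_eqI[OF tau_closed g tau_closed])
         (use p_pos in \<open>simp add: tau_def gx(1) F_mult mod_simps\<close>)
    ultimately show ?thesis
      using free_tau by (intro bexI[of _ "tau 1"]) (simp_all add: tau_closed)
  qed
qed

lemma sg_commutator_free: "\<exists>h\<in>carrier F. free (sg 1 \<otimes>\<^bsub>F\<^esub> h \<otimes>\<^bsub>F\<^esub> inv\<^bsub>F\<^esub> sg 1 \<otimes>\<^bsub>F\<^esub> inv\<^bsub>F\<^esub> h)"
  using free_tau[of "rho 1 - 1"] not_dvd_rho_minus_1[OF not_q_dvd_1]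
  by (intro bexI[of _ "tau 1"]) (simp_all add: sg_tau_commutator tau_closed)

text \<open>Since \<open>rho 1 - 1\<close> is invertible mod \<open>p\<close>, commutators of
  \<open>sg 1\<close> with translations exhaust all translations.\<close>

lemma generators:
  assumes g: "g \<in> carrier F"
  shows "\<exists>c. \<exists>h\<in>carrier F. g = sg c \<otimes>\<^bsub>F\<^esub> (sg 1 \<otimes>\<^bsub>F\<^esub> h \<otimes>\<^bsub>F\<^esub> inv\<^bsub>F\<^esub> sg 1 \<otimes>\<^bsub>F\<^esub> inv\<^bsub>F\<^esub> h)"
proof -
  obtain x i where gx: "g = (x, i)" "0 \<le> x" "x < int p" "0 \<le> i" "i < int q"
    using g by (cases g) (auto simp: F_carrier)
  have "coprime (rho 1 - 1) (int p)"
    using not_dvd_rho_minus_1[OF not_q_dvd_1] prime_p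
    by (metis coprime_commute prime_imp_coprime_int prime_nat_int_transfer)
  then have "coprime (rho i * (rho 1 - 1)) (int p)" using coprime_rho by simp
  then obtain y where y: "[rho i * (rho 1 - 1) * y = 1] (mod int p)"
    using cong_solve_coprime_int by blast
  then have "[rho i * (rho 1 - 1) * y * x = 1 * x] (mod int p)" by (rule cong_mult) simp
  then have "g = sg i \<otimes>\<^bsub>F\<^esub> tau ((rho 1 - 1) * (y * x))"
    using gx by (simp add: sg_def tau_def F_mult mod_simps cong_def mult.assoc)
  then show ?thesis
    by (intro exI[of _ i] bexI[of _ "tau (y * x)"]) (simp_all add: sg_tau_commutator tau_closed)
qed

end

lemma ex_order_q:
  fixes p q :: nat
  assumes p: "prime p" and q: "prime q" and dvd: "q dvd p - 1"
  obtains r where "frobenius_pq p q r"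
proof -
  obtain g where "residue_primroot p g" using prime_primitive_root_exists[of p] p prime_gt_1_nat by blast
  then have g: "ord p g = p - 1" using p by (simp add: residue_primroot_def totient_prime)
  from dvd obtain m where m: "p - 1 = q * m" by blast
  have "m > 0" using m prime_gt_1_nat[OF p] by (cases m) auto
  have "[(g ^ m) ^ k = 1] (mod p) \<longleftrightarrow> q dvd k" for k
  proof -
    have "[(g ^ m) ^ k = 1] (mod p) \<longleftrightarrow> q * m dvd k * m"
      unfolding power_mult[symmetric] ord_divides g m by (simp add: mult.commute)
    then show ?thesis using \<open>m > 0\<close> by simp
  qed
  \<comment> \<open>A primitive root raised to the power \<open>m = (p - 1) / q\<close> has order
    \<open>q\<close>.\<close>
  then show ?thesis using that[of "g ^ m"] p q by (simp add: frobenius_pq_def)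
qed

text \<open>A root \<open>x\<close> of \<open>1 + X + ... + X^(q-1)\<close> is not 1, as
  \<open>q\<close> is nonzero in characteristic zero, and satisfies \<open>x^q = 1\<close>.
  Primality of \<open>q\<close> gives \<open>x^a \<noteq> 1\<close> whenever \<open>q\<close> does
  not divide \<open>a\<close>, hence orthogonality by the geometric sum.\<close>

lemma ex_fourier:
  fixes q :: nat
  assumes alg_closed: "\<forall>P :: ('k::field_char_0) poly. degree P > 0 \<longrightarrow> (\<exists>x. poly P x = 0)"
    and q: "prime q"
  obtains z :: "int \<Rightarrow> 'k::field_char_0" where "fourier q z"
proof -
  have q1: "q > 1" using q prime_gt_1_nat by blast
  define P :: "'k poly" where "P = (\<Sum>i<q. Polynomial.monom 1 i)"
  have "Polynomial.coeff P (q - 1) = 1" using q1 by (simp add: P_def coeff_sum)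
  then have "degree P \<ge> q - 1" by (intro le_degree) simp
  then obtain x where "poly P x = 0" using alg_closed q1 by fastforce
  then have sum0: "(\<Sum>i<q. x ^ i) = 0" by (simp add: P_def poly_sum poly_monom)
  have x1: "x \<noteq> 1" using sum0 q1 by auto
  have xq: "x ^ q = 1" using sum0 power_diff_1_eq[of x q] by simp
  then have x0: "x \<noteq> 0" using q1 by (auto simp: power_0_left)
  define z where "z m = x powi m" for m
  have zq: "z (int q * m) = 1" for m by (simp add: z_def power_int_mult xq)
  have zadd: "z (a + b) = z a * z b" for a b by (simp add: z_def power_int_add x0)
  have zsum: "(\<Sum>c\<in>{0..<int q}. z (a * c)) = (if int q dvd a then of_nat q else 0)" for a
  proof -
    define y where "y = z a"
    have "(\<Sum>c\<in>{0..<int q}. z (a * c)) = (\<Sum>k<q. y ^ k)"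
      by (rule sum.reindex_bij_witness[of _ int nat]) (auto simp: y_def z_def power_int_mult, simp add: power_int_def[of "x powi a"])
    moreover have "(\<Sum>k<q. y ^ k) = 0" if "\<not> int q dvd a"
    proof -
      have "coprime (int q) a" using that q by (metis prime_imp_coprime_int prime_nat_int_transfer)
      then obtain u v where uv: "int q * u + a * v = 1"
        by (metis bezout_int coprime_imp_gcd_eq_1 mult.commute)
      have "y \<noteq> 1"
      proof
        assume "y = 1"
        then have "z (int q * u + a * v) = 1" unfolding zadd zq by (simp add: y_def z_def power_int_mult)
        then show False using x1 by (simp add: uv z_def)
      qed
      moreover have "y ^ q = 1"
        using zq[of a] by (simp add: y_def z_def power_int_mult mult.commute[of "int q"])
      ultimately show ?thesis using power_diff_1_eq[of y q] by simp
    qed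
    moreover have "y = 1" if "int q dvd a" using that zq by (auto simp: y_def elim: dvdE)
    ultimately show ?thesis by auto
  qed
  have "fourier q z"
    by unfold_locales (use q1 zadd zsum zq[of 1] in \<open>simp_all add: z_def[of 0]\<close>)
  then show ?thesis by (rule that)
qed

theorem theorem4p5:
  fixes p q :: nat
  assumes alg_closed: "\<forall>P :: ('k::field_char_0) poly. degree P > 0 \<longrightarrow> (\<exists>x. poly P x = 0)"
    and "prime p" and "prime q" and "q dvd p - 1"
  shows "\<exists>H :: 'k hopf. hopf_algebra H \<and> hdim H = p^2 * q^2 \<and> semisimple H \<and> simple_hopf H \<and>
           \<not> (\<exists>G :: nat monoid. group G \<and> carrier G = {..<hdim H} \<and>
                (hopf_iso H (group_algebra G (hdim H)) \<or> hopf_iso H (hopf_dual (group_algebra G (hdim H)))))"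
proof -
  obtain z :: "int \<Rightarrow> 'k" where z: "fourier q z" by (rule ex_fourier[OF assms(1,3)])
  obtain r where "frobenius_pq p q r" by (rule ex_order_q[OF assms(2-4)])
  then interpret frobenius_pq p q r .
  obtain G w where "simple_twisted G q z ((card (carrier F))\<^sup>2) w"
    by (rule direct_square_simple_twisted[OF z commutator_free sg_commutator_free generators])
  then interpret T: simple_twisted G q z "(card (carrier F))\<^sup>2" w .
  have "hdim T.TH = p\<^sup>2 * q\<^sup>2"
    unfolding T.TH_simps(1) by (simp add: card_F power_mult_distrib)
  then show ?thesis
    using T.hopf_algebra_TH T.semisimple_TH T.simple_TH T.TH_not_iso by blast
qed

end
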